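(* Assume GRH for $F$. Let $1/d_F<B_1<B_2\leq B_3<1$ and suppose that for some $c>0$, \[ V_F(X, \delta)=\frac{1}{6}\delta X^2\big(3\log X-4\log 2\big)+O\big(\delta^{1+c} X^2\big) \] uniformly for $X^{-B_3}\ll\delta\ll X^{-B_1}$. Then for every $\varepsilon>0$, \[ \tilde{V}_F(X,h)=\frac{1}{6}h X\Big(6\log X-\big(3+8\log 2\big)\Big)+O_\varepsilon\big(hX^{1+\varepsilon}(h/X)^{c/3}\big)+O_\varepsilon\Big(hX^{1+\varepsilon}\big(hX^{-(1-B_1)}\big)^{1/(3(1-B_1))}\Big) \] uniformly for $X^{1-B_3}\ll h\ll X^{1-B_2}$.
   Context: Let $F(s)=\sum_{n\ge1}a_F(n)n^{-s}$ be a primitive element of the Selberg class: the series converges absolutely for $\mathrm{Re}(s)>1$; $F$ extends meromorphically to $\mathbb C$ with at most a pole at $s=1$, whose order is denoted $m_F\ge0$, and $(s-1)^{m_F}F(s)$ is entire of finite order; $F$ satisfies $\Phi(s)=\varepsilon_F\overline{\Phi}(1-s)$ where $\Phi(s)=Q^s\prod_{j=1}^r\Gamma(\lambda_js+\mu_j)F(s)$ with $Q>0$, $\lambda_j>0$, $\mathrm{Re}(\mu_j)\ge0$, $|\varepsilon_F|=1$, and $\overline{\Phi}(s)=\overline{\Phi(\bar s)}$; $a_F(n)\ll_\varepsilon n^\varepsilon$; and $F(s)=\prod_p\exp\big(\sum_{l\ge1}b_F(p^l)p^{-ls}\big)$ with $b_F(p^l)\ll p^{l\theta}$ for some $\theta<1/2$.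 The degree is $d_F=2\sum_{j}\lambda_j$. Define $\Lambda_F(n)$ by $\frac{F'}{F}(s)=-\sum_{n\ge1}\Lambda_F(n)n^{-s}$ ($\mathrm{Re}(s)>1$) and $\psi_F(x)=\sum_{n\le x}\Lambda_F(n)$. GRH for $F$ means all nontrivial zeros of $F$ are $\rho_F=\tfrac12+i\gamma_F$ with $\gamma_F$ real. Define $V_F(X,\delta)=\int_1^X|\psi_F(x+\delta x)-\psi_F(x)-m_F\delta x|^2dx$, $\tilde V_F(X,h)=\int_1^X|\psi_F(x+h)-\psi_F(x)-m_Fh|^2dx$. "Uniformly for $a\ll y\ll b$" means: for any fixed positive constants $k_1,k_2$, the estimate holds for all $y$ with $k_1a\le y\le k_2b$ (as the main parameter tends to infinity), with implied constants independent of the variables. *)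

theory Defs
  imports "HOL-Analysis.Analysis" "HOL-Computational_Algebra.Primes"
begin

definition dirichlet_rep :: "(nat \<Rightarrow> complex) \<Rightarrow> (complex \<Rightarrow> complex) \<Rightarrow> bool" where
  "dirichlet_rep a F \<longleftrightarrow>
     (\<forall>s. Re s > 1 \<longrightarrow>
        summable (\<lambda>n. norm (a (Suc n) / of_nat (Suc n) powr s)) \<and>
        F s = (\<Sum>n. a (Suc n) / of_nat (Suc n) powr s))"

definition entire_finite_order :: "(complex \<Rightarrow> complex) \<Rightarrow> bool" where
  "entire_finite_order g \<longleftrightarrow> g holomorphic_on UNIV \<and>
     (\<exists>A \<rho>. \<forall>s. norm (g s) \<le> A * exp (norm s powr \<rho>))"

definition pole_order :: "(complex \<Rightarrow> complex) \<Rightarrow> nat \<Rightarrow> bool" where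
  "pole_order F m \<longleftrightarrow>
     (\<exists>g. entire_finite_order g \<and> (\<forall>s. s \<noteq> 1 \<longrightarrow> g s = (s - 1) ^ m * F s)
          \<and> (m > 0 \<longrightarrow> g 1 \<noteq> 0))"

definition Phi_fun :: "(complex \<Rightarrow> complex) \<Rightarrow> real \<Rightarrow> nat \<Rightarrow> (nat \<Rightarrow> real) \<Rightarrow> (nat \<Rightarrow> complex)
     \<Rightarrow> complex \<Rightarrow> complex" where
  "Phi_fun F Q r lam mu s =
     of_real Q powr s * (\<Prod>j<r. Gamma (of_real (lam j) * s + mu j)) * F s"

text \<open>Functional equation Phi(s) = eps * conj(Phi(conj(1-s))), as an identity of meromorphic
  functions; stated at all points where both sides are given by finite values
  (away from s = 0, 1 and the poles of the Gamma factors).\<close>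
definition functional_eq :: "(complex \<Rightarrow> complex) \<Rightarrow> real \<Rightarrow> nat \<Rightarrow> (nat \<Rightarrow> real) \<Rightarrow> (nat \<Rightarrow> complex)
     \<Rightarrow> complex \<Rightarrow> bool" where
  "functional_eq F Q r lam mu eps \<longleftrightarrow>
     Q > 0 \<and> (\<forall>j<r. lam j > 0 \<and> Re (mu j) \<ge> 0) \<and> norm eps = 1 \<and>
     (\<forall>s. s \<noteq> 0 \<and> s \<noteq> 1 \<and>
          (\<forall>j<r. of_real (lam j) * s + mu j \<notin> \<int>\<^sub>\<le>\<^sub>0) \<and>
          (\<forall>j<r. of_real (lam j) * cnj (1 - s) + mu j \<notin> \<int>\<^sub>\<le>\<^sub>0) \<longrightarrow>
        Phi_fun F Q r lam mu s = eps * cnj (Phi_fun F Q r lam mu (cnj (1 - s))))"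

definition euler_product :: "(complex \<Rightarrow> complex) \<Rightarrow> bool" where
  "euler_product F \<longleftrightarrow>
     (\<exists>b :: nat \<Rightarrow> complex. \<exists>\<theta> < 1/2. \<exists>C.
        (\<forall>p l. prime p \<longrightarrow> l \<ge> 1 \<longrightarrow> norm (b (p ^ l)) \<le> C * real p powr (real l * \<theta>)) \<and>
        (\<forall>s. Re s > 1 \<longrightarrow>
           (\<lambda>k. if prime k then exp (\<Sum>l. b (k ^ Suc l) / of_nat (k ^ Suc l) powr s) else 1)
             has_prod F s))"

definition selberg_class :: "(complex \<Rightarrow> complex) \<Rightarrow> bool" where
  "selberg_class F \<longleftrightarrow>
     (\<exists>a. dirichlet_rep a F \<and>
        (\<forall>\<epsilon>>0. \<exists>C. \<forall>n\<ge>1. norm (a n) \<le> C * real n powr \<epsilon>)) \<and>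
     (\<exists>m. pole_order F m) \<and>
     (\<exists>Q r lam mu eps. functional_eq F Q r lam mu eps) \<and>
     euler_product F"

text \<open>Functions are compared on Re s > 1 (where they are given by their Dirichlet series;
  this determines them as meromorphic functions).\<close>
definition primitive_selberg :: "(complex \<Rightarrow> complex) \<Rightarrow> bool" where
  "primitive_selberg F \<longleftrightarrow> selberg_class F \<and>
     \<not> (\<forall>s. Re s > 1 \<longrightarrow> F s = 1) \<and>
     (\<forall>F1 F2. selberg_class F1 \<and> selberg_class F2 \<and>
        (\<forall>s. Re s > 1 \<longrightarrow> F s = F1 s * F2 s) \<longrightarrow>
        (\<forall>s. Re s > 1 \<longrightarrow> F1 s = 1) \<or> (\<forall>s. Re s > 1 \<longrightarrow> F2 s = 1))"

definition log_deriv_coeffs :: "(complex \<Rightarrow> complex) \<Rightarrow> (nat \<Rightarrow> complex) \<Rightarrow> bool" where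
  "log_deriv_coeffs F \<Lambda> \<longleftrightarrow>
     (\<forall>s. Re s > 1 \<longrightarrow>
        (\<lambda>n. \<Lambda> (Suc n) / of_nat (Suc n) powr s) sums (- (deriv F s / F s)))"

definition psiF :: "(nat \<Rightarrow> complex) \<Rightarrow> real \<Rightarrow> complex" where
  "psiF \<Lambda> x = (\<Sum>n\<in>{1..nat \<lfloor>x\<rfloor>}. \<Lambda> n)"

definition VF :: "(nat \<Rightarrow> complex) \<Rightarrow> nat \<Rightarrow> real \<Rightarrow> real \<Rightarrow> real" where
  "VF \<Lambda> m X \<delta> = integral {1..X}
     (\<lambda>x. (norm (psiF \<Lambda> (x + \<delta> * x) - psiF \<Lambda> x - of_real (real m * \<delta> * x)))\<^sup>2)"

definition VtF :: "(nat \<Rightarrow> complex) \<Rightarrow> nat \<Rightarrow> real \<Rightarrow> real \<Rightarrow> real" where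
  "VtF \<Lambda> m X h = integral {1..X}
     (\<lambda>x. (norm (psiF \<Lambda> (x + h) - psiF \<Lambda> x - of_real (real m * h)))\<^sup>2)"

text \<open>GRH: every nontrivial zero (zero not at a pole of a Gamma factor) has real part 1/2.
  The point s = 1 is excluded when F has a pole there.\<close>
definition GRH :: "(complex \<Rightarrow> complex) \<Rightarrow> nat \<Rightarrow> nat \<Rightarrow> (nat \<Rightarrow> real) \<Rightarrow> (nat \<Rightarrow> complex) \<Rightarrow> bool" where
  "GRH F m r lam mu \<longleftrightarrow>
     (\<forall>s. F s = 0 \<and> (s \<noteq> 1 \<or> m = 0) \<and> (\<forall>j<r. of_real (lam j) * s + mu j \<notin> \<int>\<^sub>\<le>\<^sub>0)
          \<longrightarrow> Re s = 1/2)"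

end

theory Submission
  imports Defs "HOL-Complex_Analysis.Complex_Analysis" "HOL-Probability.Probability" "HOL-Real_Asymp.Real_Asymp"
begin

text \<open>
  Write \<open>G(x) = \<psi>(x) - m x\<close>. Multiplicative increments \<open>G(x + \<delta> x) - G(x)\<close> become additive ones
  after averaging over \<open>\<delta>\<close> and substituting \<open>v = \<delta> x\<close> (Saffari and Vaughan): the mean over
  \<open>v \<in> [(1+\<eta>) h, (1+2\<eta>) h]\<close> of \<open>\<integral> |G(x+v) - G(x)|\<^sup>2 dx\<close> is a double integral in \<open>(x, \<delta>)\<close> whose inner
  integral runs over an interval of \<open>x\<close> and is evaluated by the hypothesis, with relative error
  \<open>(h/X)\<^sup>c / \<eta>\<close>. Replacing \<open>v\<close> by \<open>h\<close> costs the mean square of \<open>G(x+v) - G(x+h)\<close>, an increment of length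
  about \<open>\<eta> h\<close>, hence a relative error \<open>\<eta>\<^sup>1\<^sup>/\<^sup>2\<close>; the choice \<open>\<eta> = (h/X)\<^sup>2\<^sup>c\<^sup>/\<^sup>3\<close> balances the two.
  As \<open>\<eta> h\<close> may lie below the range of the hypothesis, this increment is bounded through GRH,
  which also bounds the range \<open>x \<le> h\<^sup>1\<^sup>/\<^sup>(\<^sup>1\<^sup>-\<^sup>B\<^sup>1\<^sup>)\<close>.

  For the GRH bound, Phragmen-Lindelof and Borel-Caratheodory give \<open>F'/F \<lless> log |t|\<close> to the right of the
  critical line, and a Plancherel inequality on the line \<open>Re s = 1/2 + \<epsilon>\<close> bounds the mean square of
  multiplicative increments by \<open>X\<^sup>2\<^sup>+\<^sup>\<epsilon> \<delta>\<close>; the averaging above turns this into \<open>w X\<^sup>1\<^sup>+\<^sup>\<epsilon>\<close> for increments of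
  length \<open>w\<close>.
\<close>

text \<open>At \<open>X = t\<close> the hypothesis reaches increments of length about
  \<open>h\<close> only if \<open>h / t\<close> is at most of order \<open>t powr (- B1)\<close>,
  that is for \<open>t\<close> above \<open>Y = h powr (1 / (1 - B1))\<close>. The discarded range
  has relative size \<open>Y / X\<close>, whereas the theorem allows
  \<open>(Y / X) powr (1/3)\<close>; the slack pays for \<open>c > 1\<close>. The GRH bound for
  increments of length \<open>w\<close> loses a small power of \<open>X / w\<close>, so
  \<open>w\<close> must stay above a fixed negative power of \<open>X\<close>. This is why the
  averaging window starts at \<open>(1 + \<eta>) h\<close> and not at \<open>h\<close>: then
  \<open>v - h\<close> is at least \<open>\<eta> h\<close>. The size of \<open>\<Lambda>\<close> is
  controlled through the convergence of the Dirichlet series of \<open>F'/F\<close>, which lets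
  \<open>psiF \<Lambda> x\<close> be as large as \<open>x powr (5/2)\<close>. Laplace transforms are
  therefore computed far to the right, on \<open>Re s = 3\<close>, and the line
  \<open>1/2 + \<epsilon>\<close> is reached by moving a contour. The main term that cancels the
  pole is the residue of \<open>- F'/F\<close> at 1, called \<open>M\<close>; that it equals
  \<open>m\<close> is a separate matter, settled by the hypothesis on the variance.\<close>

section \<open>Complex-analytic tools\<close>

text \<open>In Euler's product each factor \<open>(p + k) / |p + k + i y|\<close> increases with \<open>p\<close>; this replaces
  Stirling's formula.\<close>
lemma norm_Gamma_vertical_mono:
  fixes p q y :: real
  assumes "0 < p" "p \<le> q"
  shows "norm (Gamma (Complex p y)) / Gamma p \<le> norm (Gamma (Complex q y)) / Gamma q"
proof -
  define R where "R = (\<lambda>p (n::nat). \<Prod>k=0..<n+1. (p + real k) / norm (Complex (p + real k) y))"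
  have lim: "R p \<longlonglongrightarrow> norm (Gamma (Complex p y)) / Gamma p" if "p > 0" for p
  proof -
    have "norm (Gamma_series (Complex p y) n) / Gamma_series p n = R p n" if n: "n > 0" for n
    proof -
      have *: "norm (pochhammer (Complex p y) (n+1)) = (\<Prod>k=0..<n+1. norm (Complex (p + real k) y))"
        unfolding pochhammer_prod prod_norm
        by (intro arg_cong[where f = norm] prod.cong) (auto simp: complex_eq_iff)
      have **: "pochhammer p (n+1) = (\<Prod>k=0..<n+1. p + real k)"
        by (simp add: pochhammer_prod)
      have "norm (exp (Complex p y * of_real (ln (of_nat n)))) = exp (p * ln (real n))"
        by simp
      then have "norm (Gamma_series (Complex p y) n) / Gamma_series p n =
        (fact n * exp (p * ln (real n)) / norm (pochhammer (Complex p y) (n+1)))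
        / (fact n * exp (p * ln (real n)) / pochhammer p (n+1))"
        unfolding Gamma_series_def by (simp add: norm_divide norm_mult)
      also have "\<dots> = pochhammer p (n+1) / norm (pochhammer (Complex p y) (n+1))"
        by simp
      finally show ?thesis
        unfolding * ** R_def by (simp add: prod_dividef)
    qed
    then have "eventually (\<lambda>n. norm (Gamma_series (Complex p y) n) / Gamma_series p n = R p n) sequentially"
      by (intro eventually_mono[OF eventually_gt_at_top[of 0]]) auto
    moreover have "(\<lambda>n. norm (Gamma_series (Complex p y) n) / Gamma_series p n)
        \<longlonglongrightarrow> norm (Gamma (Complex p y)) / Gamma p"
      using Gamma_real_pos[OF that] by (intro tendsto_intros) auto
    ultimately show ?thesis
      by (rule Lim_transform_eventually[rotated])
  qed
  have le: "R p n \<le> R q n" for n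
  proof -
    have frac: "a / norm (Complex a y) \<le> b / norm (Complex b y)" if "0 < a" "a \<le> b" for a b
    proof -
      have "(a * norm (Complex b y))\<^sup>2 \<le> (b * norm (Complex a y))\<^sup>2"
      proof -
        have "a\<^sup>2 * y\<^sup>2 \<le> b\<^sup>2 * y\<^sup>2"
          using that by (intro mult_right_mono power_mono) auto
        then show ?thesis
          by (simp add: power_mult_distrib cmod_power2 distrib_left mult.commute)
      qed
      then have "a * norm (Complex b y) \<le> b * norm (Complex a y)"
        by (rule power2_le_imp_le) (use that in simp)
      moreover have "norm (Complex a y) > 0" "norm (Complex b y) > 0"
        using that by (auto simp: complex_eq_iff)
      ultimately show ?thesis
        by (subst frac_le_eq) (simp_all add: divide_le_0_iff mult.commute)
    qed
    show ?thesis
      unfolding R_def using assms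
      by (intro prod_mono conjI frac) auto
  qed
  show ?thesis
    using lim[of p] lim[of q] assms le by (intro LIMSEQ_le[of "R p" _ "R q"]) auto
qed

text \<open>Monotonicity in the real part replaces the real shift \<open>a\<close> by the integer
  \<open>n\<close> above it, and for integer shifts the recurrence
  \<open>Gamma (z + n) = pochhammer z n * Gamma z\<close> costs only a polynomial factor. The point
  \<open>z\<close> itself may lie in the left half-plane; the condition on \<open>Im z\<close> keeps
  it away from the poles.\<close>

lemma norm_Gamma_shift_bound:
  fixes x a :: real
  assumes "x + a > 0" "a \<ge> 0"
  obtains C N where "C > 0"
    "\<And>z. Re z = x \<Longrightarrow> 1 \<le> \<bar>Im z\<bar> \<Longrightarrow>
       norm (Gamma (z + of_real a)) \<le> C * (1 + \<bar>Im z\<bar>) ^ N * norm (Gamma z)"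
proof -
  define n where "n = nat \<lceil>a\<rceil>"
  have n: "a \<le> real n" unfolding n_def by linarith
  define K where "K = \<bar>x\<bar> + real n + 1"
  define C where "C = Gamma (x + a) / Gamma (x + real n) * K ^ n"
  have pos: "Gamma (x + a) > 0" "Gamma (x + real n) > 0"
    using assms n by (auto intro: Gamma_real_pos)
  show ?thesis
  proof (rule that)
    show "C > 0" unfolding C_def K_def using pos by (intro mult_pos_pos divide_pos_pos zero_less_power) auto
    fix z assume z: "Re z = x" "1 \<le> \<bar>Im z\<bar>"
    have zn: "z \<notin> \<int>\<^sub>\<le>\<^sub>0"
      using z by (auto elim!: nonpos_Ints_cases)
    have "norm (Gamma (Complex (x + a) (Im z))) / Gamma (x + a) \<le>
      norm (Gamma (Complex (x + real n) (Im z))) / Gamma (x + real n)"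
      by (rule norm_Gamma_vertical_mono) (use assms n in auto)
    moreover have "Complex (x + a) (Im z) = z + of_real a" "Complex (x + real n) (Im z) = z + of_nat n"
      using z by (auto simp: complex_eq_iff)
    ultimately have "norm (Gamma (z + of_real a)) \<le> Gamma (x + a) / Gamma (x + real n) * norm (Gamma (z + of_nat n))"
      using pos by (simp add: field_simps)
    also have "Gamma (z + of_nat n) = pochhammer z n * Gamma z"
      using pochhammer_Gamma[OF zn, of n] zn by (simp add: Gamma_eq_zero_iff)
    also have "norm (pochhammer z n * Gamma z) \<le> (K ^ n * (1 + \<bar>Im z\<bar>) ^ n) * norm (Gamma z)"
    proof -
      have "norm (pochhammer z n) = (\<Prod>k=0..<n. norm (z + of_nat k))"
        by (simp add: pochhammer_prod prod_norm)
      also have "\<dots> \<le> (\<Prod>k=0..<n. K * (1 + \<bar>Im z\<bar>))"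
      proof (intro prod_mono conjI)
        fix k assume k: "k \<in> {0..<n}"
        have "norm (z + of_nat k) \<le> norm z + real k"
          by (metis norm_triangle_ineq norm_of_nat)
        also have "norm z \<le> \<bar>x\<bar> + \<bar>Im z\<bar>" using cmod_le[of z] z by simp
        also have "\<bar>x\<bar> + \<bar>Im z\<bar> + real k \<le> K * (1 + \<bar>Im z\<bar>)"
        proof -
          have "real k \<le> real n" using k by simp
          moreover have "0 \<le> (\<bar>x\<bar> + real n) * \<bar>Im z\<bar>" by simp
          moreover have "K * (1 + \<bar>Im z\<bar>) = (\<bar>x\<bar> + real n) * \<bar>Im z\<bar> + \<bar>Im z\<bar> + \<bar>x\<bar> + real n + 1"
            unfolding K_def by (simp add: algebra_simps)
          ultimately show ?thesis by linarith
        qed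
        finally show "norm (z + of_nat k) \<le> K * (1 + \<bar>Im z\<bar>)" by simp
      qed auto
      finally show ?thesis
        by (simp add: norm_mult power_mult_distrib mult_right_mono)
    qed
    finally show "norm (Gamma (z + of_real a)) \<le> C * (1 + \<bar>Im z\<bar>) ^ n * norm (Gamma z)"
      using pos unfolding C_def by (simp add: mult_left_mono mult.assoc divide_right_mono)
  qed
qed

text \<open>The map \<open>w / (2 * M - w)\<close> sends the half-plane \<open>Re w < M\<close> into
  the unit disc and fixes 0, so the Schwarz lemma applies to it; solving for \<open>w\<close> gives
  the bound. The strict hypothesis, read at \<open>z = z0\<close>, yields
  \<open>M > 0\<close>.\<close>

lemma Borel_Caratheodory:
  assumes holf: "f holomorphic_on ball z0 R" and "R > 0"
    and M: "\<And>z. z \<in> ball z0 R \<Longrightarrow> Re (f z - f z0) < M"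
    and z: "z \<in> ball z0 R"
  shows "norm (f z - f z0) \<le> 2 * M * norm (z - z0) / (R - norm (z - z0))"
proof -
  have "M > 0" using M[of z0] \<open>R > 0\<close> by simp
  define w where "w = (\<lambda>\<zeta>. f (z0 + of_real R * \<zeta>) - f z0)"
  have in_ball: "z0 + of_real R * \<zeta> \<in> ball z0 R" if "norm \<zeta> < 1" for \<zeta>
    using that \<open>R > 0\<close> by (simp add: dist_norm norm_mult)
  have less: "norm (w \<zeta>) < norm (of_real (2 * M) - w \<zeta>)" if "norm \<zeta> < 1" for \<zeta>
  proof -
    have "Re (w \<zeta>) < M" using M[OF in_ball[OF that]] by (simp add: w_def)
    then have "M * Re (w \<zeta>) < M * M" using \<open>M > 0\<close> by simp
    then have "(norm (w \<zeta>))\<^sup>2 < (norm (of_real (2 * M) - w \<zeta>))\<^sup>2"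
      unfolding cmod_power2 by (simp add: power2_eq_square algebra_simps)
    then show ?thesis by (rule power_less_imp_less_base) simp
  qed
  have nz: "of_real (2 * M) - w \<zeta> \<noteq> 0" if "norm \<zeta> < 1" for \<zeta>
    using less[OF that] by auto
  define \<zeta> where "\<zeta> = (z - z0) / of_real R"
  have n\<zeta>: "norm \<zeta> = norm (z - z0) / R" using \<open>R > 0\<close> by (simp add: \<zeta>_def norm_divide)
  have \<zeta>1: "norm \<zeta> < 1" using z \<open>R > 0\<close> by (simp add: n\<zeta> dist_norm norm_minus_commute)
  have w\<zeta>: "w \<zeta> = f z - f z0" using \<open>R > 0\<close> by (simp add: w_def \<zeta>_def)
  have holw: "w holomorphic_on ball 0 1"
    unfolding w_def using in_ball
    by (intro holomorphic_intros holomorphic_on_compose_gen[OF _ holf, unfolded o_def]) auto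
  have "norm ((\<lambda>\<zeta>. w \<zeta> / (of_real (2 * M) - w \<zeta>)) \<zeta>) \<le> norm \<zeta>"
  proof (rule Schwarz_Lemma(1))
    show "(\<lambda>\<zeta>. w \<zeta> / (of_real (2 * M) - w \<zeta>)) holomorphic_on ball 0 1"
      using nz by (intro holomorphic_intros holw) auto
    show "w 0 / (of_real (2 * M) - w 0) = 0" by (simp add: w_def)
    fix y :: complex assume "norm y < 1"
    from less[OF this] nz[OF this] show "norm (w y / (of_real (2 * M) - w y)) < 1"
      by (simp add: norm_divide)
  qed (rule \<zeta>1)
  then have "norm (w \<zeta>) \<le> norm \<zeta> * norm (of_real (2 * M) - w \<zeta>)"
    using nz[OF \<zeta>1] by (simp add: norm_divide field_simps)
  also have "\<dots> \<le> norm \<zeta> * (2 * M + norm (w \<zeta>))"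
    using norm_triangle_ineq4[of "of_real (2 * M)" "w \<zeta>"] \<open>M > 0\<close>
    by (intro mult_left_mono) auto
  finally have "norm (w \<zeta>) * (1 - norm \<zeta>) \<le> 2 * M * norm \<zeta>"
    by (simp add: algebra_simps)
  then have "(norm (w \<zeta>) * (1 - norm \<zeta>)) * R \<le> (2 * M * norm \<zeta>) * R"
    using \<open>R > 0\<close> by (intro mult_right_mono) auto
  moreover have *: "norm (z - z0) = norm \<zeta> * R" using \<open>R > 0\<close> by (simp add: n\<zeta>)
  ultimately have "norm (f z - f z0) * (R - norm (z - z0)) \<le> 2 * M * norm (z - z0)"
    unfolding w\<zeta>[symmetric] * by (simp add: algebra_simps)
  moreover have "R - norm (z - z0) > 0"
    using z by (simp add: dist_norm norm_minus_commute)
  ultimately show ?thesis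
    by (simp add: pos_le_divide_eq)
qed

text \<open>Cauchy's inequality on the circle of radius \<open>(R - r) / 2\<close> about
  \<open>z\<close>. This circle keeps a distance of at least \<open>(R - r) / 2\<close> from the
  boundary of the large disc, so the previous bound is available on it.\<close>

lemma Borel_Caratheodory_deriv:
  assumes holf: "f holomorphic_on ball z0 R"
    and M: "\<And>z. z \<in> ball z0 R \<Longrightarrow> Re (f z - f z0) < M"
    and r: "norm (z - z0) \<le> r" "r < R"
  shows "norm (deriv f z) \<le> 8 * M * R / (R - r)\<^sup>2"
proof -
  have "r \<ge> 0" using r(1) norm_ge_zero order_trans by blast
  then have "R > 0" using r by linarith
  have "M > 0" using M[of z0] \<open>R > 0\<close> by simp
  define d where "d = (R - r) / 2"
  have d: "d > 0" using r by (simp add: d_def)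
  have sub: "cball z d \<subseteq> ball z0 R"
  proof
    fix y assume "y \<in> cball z d"
    then have "dist z0 y \<le> r + d"
      using r dist_triangle[of z0 y z] by (simp add: dist_norm norm_minus_commute)
    also have "\<dots> < R" using r by (simp add: d_def field_simps)
    finally show "y \<in> ball z0 R" by simp
  qed
  have "norm ((deriv ^^ 1) (\<lambda>y. f y - f z0) z) \<le> fact 1 * (4 * M * R / (R - r)) / d ^ 1"
  proof (rule Cauchy_inequality)
    show "(\<lambda>y. f y - f z0) holomorphic_on ball z d"
      using sub by (intro holomorphic_intros holomorphic_on_subset[OF holf]) auto
    show "continuous_on (cball z d) (\<lambda>y. f y - f z0)"
      using sub by (intro continuous_intros holomorphic_on_imp_continuous_on holomorphic_on_subset[OF holf])
    fix y assume y: "norm (z - y) = d"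
    have yb: "y \<in> ball z0 R" using sub y by (auto simp: dist_norm)
    have ny: "norm (y - z0) \<le> r + d"
      using norm_triangle_ineq[of "y - z" "z - z0"] y r by (simp add: norm_minus_commute)
    have "norm (f y - f z0) \<le> 2 * M * norm (y - z0) / (R - norm (y - z0))"
      by (rule Borel_Caratheodory[OF holf \<open>R > 0\<close> M yb])
    also have "\<dots> \<le> 2 * M * R / (R - (r + d))"
      using ny yb \<open>M > 0\<close> r \<open>R > 0\<close>
      by (intro frac_le mult_left_mono) (auto simp: d_def dist_norm norm_minus_commute field_simps)
    also have "R - (r + d) = (R - r) / 2" by (simp add: d_def field_simps)
    finally show "norm (f y - f z0) \<le> 4 * M * R / (R - r)" by simp
  qed (rule d)
  also have "(deriv ^^ 1) (\<lambda>y. f y - f z0) z = deriv f z"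
  proof -
    have "f field_differentiable at z"
      using subsetD[OF sub, of z] d by (intro holomorphic_on_imp_differentiable_at[OF holf]) auto
    then show ?thesis by (simp add: deriv_diff)
  qed
  finally show ?thesis using r by (simp add: d_def power2_eq_square field_simps)
qed

text \<open>The growth \<open>exp (norm s powr \<rho>)\<close> is only of finite order, so the
  function is damped by \<open>exp (- e * m s)\<close>, where \<open>Re (m s)\<close> grows like
  \<open>exp (\<alpha> * |Im s|)\<close> and beats every power. The maximum principle on a tall
  rectangle bounds the damped function, and \<open>e\<close> then tends to 0.\<close>

lemma Phragmen_Lindelof_strip:
  fixes f :: "complex \<Rightarrow> complex" and a b \<rho> A B :: real
  assumes holf: "f holomorphic_on S" and S: "open S" "{s. a \<le> Re s \<and> Re s \<le> b} \<subseteq> S" and "a < b"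
    and growth: "\<And>s. a \<le> Re s \<Longrightarrow> Re s \<le> b \<Longrightarrow> norm (f s) \<le> A * exp (norm s powr \<rho>)"
    and bdry: "\<And>s. Re s = a \<or> Re s = b \<Longrightarrow> norm (f s) \<le> B"
    and s: "a \<le> Re s" "Re s \<le> b"
  shows "norm (f s) \<le> B"
proof -
  \<comment> \<open>The order \<open>\<rho>\<close> may be negative; \<open>q\<close> is a positive
    substitute that dominates it as soon as \<open>|Im s| >= 1\<close>.\<close>
  define q where "q = max \<rho> 1"
  define K where "K = \<bar>a\<bar> + \<bar>b\<bar> + 1"
  \<comment> \<open>With this frequency the argument of the cosine has real part at most
    \<open>pi / 4\<close> in absolute value on the strip, which keeps \<open>Re (m s)\<close>
    positive up to both edges.\<close>
  define \<alpha> where "\<alpha> = pi / (2 * (b - a))"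
  define mid where "mid = (a + b) / 2"
  have \<alpha>: "\<alpha> > 0" using \<open>a < b\<close> by (simp add: \<alpha>_def)
  have K: "K > 0" by (simp add: K_def)
  have B0: "B \<ge> 0" using order_trans[OF norm_ge_zero bdry[of "of_real a"]] by simp
  have A0: "A \<ge> 0"
  proof -
    have "0 \<le> A * exp (norm (of_real a :: complex) powr \<rho>)"
      using order_trans[OF norm_ge_zero growth[of "of_real a"]] \<open>a < b\<close> by simp
    then show ?thesis by (simp add: zero_le_mult_iff)
  qed
  define m where "m = (\<lambda>s. cos (of_real \<alpha> * (s - of_real mid)) :: complex)"
  have Re_m: "Re (m s) \<ge> exp (\<alpha> * \<bar>Im s\<bar>) / 4" if "a \<le> Re s" "Re s \<le> b" for s
  proof -
    have "Re (m s) = cos (\<alpha> * (Re s - mid)) * cosh (\<alpha> * Im s)"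
      by (simp add: m_def Re_cos cosh_def field_simps)
    moreover have "cos (\<alpha> * (Re s - mid)) \<ge> 1/2"
    proof -
      have "\<bar>Re s - mid\<bar> \<le> (b - a) / 2" using that by (simp add: mid_def abs_if field_simps)
      then have "\<bar>\<alpha> * (Re s - mid)\<bar> \<le> \<alpha> * ((b - a) / 2)"
        using \<alpha> by (simp add: abs_mult)
      also have "\<dots> = pi / 4"
      proof -
        have "b - a \<noteq> 0" using \<open>a < b\<close> by simp
        then show ?thesis unfolding \<alpha>_def by (simp add: divide_simps)
      qed
      also have "\<dots> \<le> pi / 3" by simp
      finally have "cos (pi / 3) \<le> cos \<bar>\<alpha> * (Re s - mid)\<bar>"
        by (intro cos_monotone_0_pi_le) auto
      then show ?thesis by (simp add: cos_60)
    qed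
    moreover have "cosh (\<alpha> * Im s) \<ge> exp (\<alpha> * \<bar>Im s\<bar>) / 2"
      using \<alpha> by (cases "Im s \<ge> 0") (auto simp: cosh_def abs_mult)
    ultimately show ?thesis
      using mult_mono[of "1/2" "cos (\<alpha> * (Re s - mid))" "exp (\<alpha> * \<bar>Im s\<bar>) / 2" "cosh (\<alpha> * Im s)"]
      by simp
  qed
  have main: "norm (f s) * exp (- e * Re (m s)) \<le> B" if e: "e > 0" for e
  proof -
    define fe where "fe = (\<lambda>s. f s * exp (- of_real e * m s))"
    have nfe: "norm (fe s) = norm (f s) * exp (- e * Re (m s))" for s
      by (simp add: fe_def norm_mult)
    have fe_le: "norm (fe s) \<le> norm (f s)" if "a \<le> Re s" "Re s \<le> b" for s
    proof -
      have "exp (- e * Re (m s)) \<le> 1"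
        using Re_m[OF that] e by (smt (verit) exp_gt_zero exp_le_one_iff mult_neg_pos mult_minus_left divide_pos_pos mult_pos_pos)
      then show ?thesis unfolding nfe by (simp add: mult_left_le)
    qed
    have "((\<lambda>y. A * exp ((y + K) powr q - e / 4 * exp (\<alpha> * y)) ) \<longlongrightarrow> 0) at_top"
    proof -
      have "filterlim (\<lambda>y. (y + K) powr q - e / 4 * exp (\<alpha> * y)) at_bot at_top"
      proof -
        have "q > 0" by (simp add: q_def)
        with e \<alpha> show ?thesis by real_asymp
      qed
      then have "((\<lambda>y. exp ((y + K) powr q - e / 4 * exp (\<alpha> * y))) \<longlongrightarrow> 0) at_top"
        by (rule filterlim_compose[OF exp_at_bot])
      from tendsto_mult_left[OF this, of A] show ?thesis by simp
    qed
    note lim0 = this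
    have small: "norm (fe s) \<le> A * exp ((\<bar>Im s\<bar> + K) powr q - e / 4 * exp (\<alpha> * \<bar>Im s\<bar>))"
      if "a \<le> Re s" "Re s \<le> b" and im: "\<bar>Im s\<bar> \<ge> 1" for s
    proof -
      have "norm s \<le> \<bar>Im s\<bar> + K" using cmod_le[of s] that by (auto simp: K_def)
      then have "norm s powr \<rho> \<le> (\<bar>Im s\<bar> + K) powr q"
      proof (cases "\<rho> \<ge> 0")
        case True
        then have "norm s powr \<rho> \<le> (\<bar>Im s\<bar> + K) powr \<rho>"
          using \<open>norm s \<le> _\<close> by (intro powr_mono2) auto
        also have "\<dots> \<le> (\<bar>Im s\<bar> + K) powr q"
          by (intro powr_mono) (auto simp: q_def K_def)
        finally show ?thesis .
      next
        case False
        have "norm s \<ge> 1" using abs_Im_le_cmod[of s] im by linarith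
        then have "norm s powr \<rho> \<le> norm s powr 0" using False by (intro powr_mono) auto
        also have "\<dots> \<le> 1" by (simp add: powr_def)
        also have "1 \<le> (\<bar>Im s\<bar> + K) powr q" using im by (intro ge_one_powr_ge_zero) (auto simp: K_def q_def)
        finally show ?thesis .
      qed
      then have "A * exp (norm s powr \<rho>) \<le> A * exp ((\<bar>Im s\<bar> + K) powr q)"
        using A0 by (intro mult_left_mono) auto
      with growth[OF that(1,2)] have "norm (f s) \<le> A * exp ((\<bar>Im s\<bar> + K) powr q)" by linarith
      moreover have "exp (- e * Re (m s)) \<le> exp (- e / 4 * exp (\<alpha> * \<bar>Im s\<bar>))"
        using Re_m[OF that(1,2)] e by (simp add: field_simps)
      ultimately have "norm (fe s) \<le> A * exp ((\<bar>Im s\<bar> + K) powr q) * exp (- e / 4 * exp (\<alpha> * \<bar>Im s\<bar>))"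
        unfolding nfe using A0 by (intro mult_mono) auto
      moreover have "exp ((\<bar>Im s\<bar> + K) powr q) * exp (- e / 4 * exp (\<alpha> * \<bar>Im s\<bar>)) = exp ((\<bar>Im s\<bar> + K) powr q - e / 4 * exp (\<alpha> * \<bar>Im s\<bar>))"
        by (simp only: exp_add[symmetric]) simp
      ultimately show ?thesis by (simp only: mult.assoc)
    qed
    \<comment> \<open>On the horizontal sides the damped function is merely small, not zero, so a
      strict margin \<open>B' > B\<close> is kept; it matters when \<open>B = 0\<close>.\<close>
    have "norm (fe s) \<le> B'" if B': "B' > B" for B'
    proof -
      have "eventually (\<lambda>y. A * exp ((y + K) powr q - e / 4 * exp (\<alpha> * y)) < B') at_top"
        using B' B0 by (intro order_tendstoD(2)[OF lim0]) auto
      then have "eventually (\<lambda>y. A * exp ((y + K) powr q - e / 4 * exp (\<alpha> * y)) < B' \<and> y > \<bar>Im s\<bar> + 1) at_top"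
        using eventually_gt_at_top by (rule eventually_conj)
      then obtain T where T: "A * exp ((T + K) powr q - e / 4 * exp (\<alpha> * T)) < B'" "T > \<bar>Im s\<bar> + 1"
        by (auto simp: eventually_at_top_linorder)
      define Rc where "Rc = cbox (Complex a (-T)) (Complex b T)"
      have in_Rc: "z \<in> Rc \<longleftrightarrow> a \<le> Re z \<and> Re z \<le> b \<and> \<bar>Im z\<bar> \<le> T" for z
        by (auto simp: Rc_def in_cbox_complex_iff)
      have RcS: "Rc \<subseteq> S" using S(2) by (auto simp: in_Rc)
      show ?thesis
      proof (rule maximum_modulus_frontier[of fe Rc])
        have hol: "fe holomorphic_on Rc"
          unfolding fe_def m_def by (intro holomorphic_intros holomorphic_on_subset[OF holf RcS])
        show "fe holomorphic_on interior Rc"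
          by (rule holomorphic_on_subset[OF hol interior_subset])
        show "continuous_on (closure Rc) fe"
          using hol by (simp add: Rc_def closure_cbox holomorphic_on_imp_continuous_on)
        show "bounded Rc" by (simp add: Rc_def bounded_cbox)
        show "s \<in> Rc" using s T(2) by (simp add: in_Rc)
        fix z assume "z \<in> frontier Rc"
        then have z: "z \<in> Rc" "z \<notin> box (Complex a (-T)) (Complex b T)"
          by (auto simp: Rc_def frontier_def closure_cbox interior_cbox)
        then have "Re z = a \<or> Re z = b \<or> \<bar>Im z\<bar> = T"
          by (auto simp: in_Rc in_box_complex_iff)
        then consider "Re z = a \<or> Re z = b" | "\<bar>Im z\<bar> = T" by blast
        then show "norm (fe z) \<le> B'"
        proof cases
          case 1
          then show ?thesis using fe_le[of z] bdry[of z] z(1) B' by (simp add: in_Rc)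
        next
          case 2
          have "T \<ge> 1" using T(2) abs_ge_zero[of "Im s"] by linarith
          with 2 show ?thesis using small[of z] T(1) z(1) by (simp add: in_Rc)
        qed
      qed
    qed
    then have "norm (fe s) \<le> B" by (rule dense_ge)
    then show ?thesis by (simp only: nfe)
  qed
  have "((\<lambda>e. norm (f s) * exp (- e * Re (m s))) \<longlongrightarrow> norm (f s) * exp (- 0 * Re (m s))) (at_right 0)"
    by (intro tendsto_intros)
  then have "norm (f s) * exp (- 0 * Re (m s)) \<le> B"
    by (rule tendsto_upperbound) (use main in \<open>auto simp: eventually_at_right_field intro!: exI[of _ 1]\<close>)
  then show ?thesis by simp
qed

section \<open>Growth of F and of its logarithmic derivative\<close>

lemma norm_of_nat_powr: "norm (of_nat (Suc n) powr s :: complex) = real (Suc n) powr Re s"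
  by (subst norm_powr_real_powr) (simp_all only: Reals_of_nat complex_Re_of_nat of_nat_0_le_iff)

lemma dirichlet_rep_bounded:
  assumes "dirichlet_rep a F" "\<sigma> > 1"
  obtains A where "A > 0" "\<And>s. Re s \<ge> \<sigma> \<Longrightarrow> norm (F s) \<le> A"
proof -
  define A where "A = (\<Sum>n. norm (a (Suc n) / of_nat (Suc n) powr of_real \<sigma>)) + 1"
  have sm: "summable (\<lambda>n. norm (a (Suc n) / of_nat (Suc n) powr (of_real \<sigma> :: complex)))"
    using assms unfolding dirichlet_rep_def by (metis Re_complex_of_real)
  show ?thesis
  proof (rule that)
    show "A > 0" unfolding A_def using suminf_nonneg[OF sm] by simp
    fix s assume s: "Re s \<ge> \<sigma>"
    have s1: "Re s > 1" using s assms by simp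
    have sm': "summable (\<lambda>n. norm (a (Suc n) / of_nat (Suc n) powr s))"
      and Fs: "F s = (\<Sum>n. a (Suc n) / of_nat (Suc n) powr s)"
      using assms s1 unfolding dirichlet_rep_def by auto
    have "norm (F s) \<le> (\<Sum>n. norm (a (Suc n) / of_nat (Suc n) powr s))"
      unfolding Fs by (rule summable_norm[OF sm'])
    also have "\<dots> \<le> (\<Sum>n. norm (a (Suc n) / of_nat (Suc n) powr (of_real \<sigma> :: complex)))"
    proof (rule suminf_le[OF _ sm' sm])
      fix n
      have "real (Suc n) powr \<sigma> \<le> real (Suc n) powr Re s"
        using s by (intro powr_mono) auto
      then show "norm (a (Suc n) / of_nat (Suc n) powr s) \<le> norm (a (Suc n) / of_nat (Suc n) powr (of_real \<sigma> :: complex))"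
        unfolding norm_divide norm_of_nat_powr by (intro divide_left_mono) auto
    qed
    finally show "norm (F s) \<le> A" by (simp add: A_def)
  qed
qed

text \<open>Far to the right the first nonzero coefficient dominates: compared with
  \<open>x powr (- R)\<close>, the tail is smaller by the factor
  \<open>(x / (x + 1)) powr R\<close>. Nothing in \<open>dirichlet_rep\<close> normalises
  \<open>a 1\<close>, hence the search for the least index. The result is the lower bound at the
  centres of the discs to which Borel-Caratheodory is applied.\<close>

lemma dirichlet_rep_lower_bound:
  assumes "dirichlet_rep a F" "Re s1 > 1" "F s1 \<noteq> 0"
  obtains R c where "R \<ge> 4" "c > 0" "\<And>s. Re s = R \<Longrightarrow> norm (F s) \<ge> c"
proof -
  have "\<exists>n. a (Suc n) \<noteq> 0"
  proof (rule ccontr)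
    assume "\<nexists>n. a (Suc n) \<noteq> 0"
    then have "F s1 = 0" using assms unfolding dirichlet_rep_def by simp
    with assms show False by simp
  qed
  define q where "q = (LEAST n. a (Suc n) \<noteq> 0)"
  have aq: "a (Suc q) \<noteq> 0" using LeastI_ex[OF \<open>\<exists>n. _\<close>] by (simp add: q_def)
  have az: "a (Suc n) = 0" if "n < q" for n using not_less_Least[of n "\<lambda>n. a (Suc n) \<noteq> 0"] that by (simp add: q_def)
  have sm2: "summable (\<lambda>n. norm (a (Suc n) / of_nat (Suc n) powr (2 :: complex)))"
    using assms(1)[unfolded dirichlet_rep_def, rule_format, of 2] by simp
  define A where "A = (\<Sum>n. norm (a (Suc n) / of_nat (Suc n) powr (2 :: complex)))"
  define x where "x = real (Suc q)"
  have x: "x \<ge> 1" by (simp add: x_def)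
  have "((\<lambda>R. A * (x + 1)\<^sup>2 * (x / (x + 1)) powr R) \<longlongrightarrow> 0) at_top"
  proof -
    have "((\<lambda>R. (x / (x + 1)) powr R) \<longlongrightarrow> 0) at_top" using x
      by real_asymp
    from tendsto_mult_left[OF this, of "A * (x + 1)\<^sup>2"] show ?thesis by simp
  qed
  then have "eventually (\<lambda>R. A * (x + 1)\<^sup>2 * (x / (x + 1)) powr R < norm (a (Suc q)) / 2) at_top"
    using aq by (intro order_tendstoD) auto
  then have "eventually (\<lambda>R. A * (x + 1)\<^sup>2 * (x / (x + 1)) powr R < norm (a (Suc q)) / 2 \<and> R \<ge> 4) at_top"
    using eventually_ge_at_top by (rule eventually_conj)
  then obtain R where R: "A * (x + 1)\<^sup>2 * (x / (x + 1)) powr R < norm (a (Suc q)) / 2" "R \<ge> 4"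
    by (auto simp: eventually_at_top_linorder)
  define c where "c = norm (a (Suc q)) / 2 * x powr (-R)"
  show ?thesis
  proof (rule that)
    show "R \<ge> 4" by fact
    show "c > 0" using aq x by (simp add: c_def)
    fix s assume s: "Re s = R"
    let ?f = "\<lambda>n. a (Suc n) / of_nat (Suc n) powr s"
    have sm: "summable (\<lambda>n. norm (?f n))" and Fs: "F s = (\<Sum>n. ?f n)"
      using assms s R(2) unfolding dirichlet_rep_def by auto
    have smf: "summable ?f" using sm by (rule summable_norm_cancel)
    have "F s = (\<Sum>n. ?f (n + Suc q)) + (\<Sum>n<Suc q. ?f n)"
      unfolding Fs by (rule suminf_split_initial_segment[OF smf])
    also have "(\<Sum>n<Suc q. ?f n) = ?f q"
      using az by (simp add: sum.neutral)
    finally have Fs2: "F s = (\<Sum>n. ?f (n + Suc q)) + ?f q" .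
    have smt: "summable (\<lambda>n. norm (?f (n + Suc q)))"
      using sm by (subst summable_iff_shift)
    have smt2: "summable (\<lambda>n. norm (a (Suc (n + Suc q)) / of_nat (Suc (n + Suc q)) powr (2 :: complex)))"
      using sm2 by (subst summable_iff_shift)
    have "norm (\<Sum>n. ?f (n + Suc q)) \<le> (\<Sum>n. norm (?f (n + Suc q)))"
      by (rule summable_norm[OF smt])
    also have "\<dots> \<le> (\<Sum>n. norm (a (Suc (n + Suc q)) / of_nat (Suc (n + Suc q)) powr (2 :: complex)) * (x + 1) powr (2 - R))"
    proof (intro suminf_le smt summable_mult2 smt2)
      fix n
      let ?N = "real (Suc (n + Suc q))"
      have N: "?N \<ge> x + 1" by (simp add: x_def)
      have "?N powr (2 - R) \<le> (x + 1) powr (2 - R)"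
        using N x R(2) by (intro powr_mono2') auto
      then have "norm (a (Suc (n + Suc q))) / ?N powr 2 * ?N powr (2 - R) \<le>
         norm (a (Suc (n + Suc q))) / ?N powr 2 * (x + 1) powr (2 - R)"
        by (intro mult_left_mono) auto
      moreover have "norm (a (Suc (n + Suc q))) / ?N powr 2 * ?N powr (2 - R) = norm (a (Suc (n + Suc q))) / ?N powr R"
        using N x by (simp add: powr_diff field_simps)
      ultimately show "norm (?f (n + Suc q)) \<le>
         norm (a (Suc (n + Suc q)) / of_nat (Suc (n + Suc q)) powr (2 :: complex)) * (x + 1) powr (2 - R)"
        unfolding norm_divide norm_of_nat_powr s by simp
    qed
    also have "\<dots> = (\<Sum>n. norm (a (Suc (n + Suc q)) / of_nat (Suc (n + Suc q)) powr (2 :: complex))) * (x + 1) powr (2 - R)"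
      by (rule suminf_mult2[symmetric, OF smt2])
    also have "\<dots> \<le> A * (x + 1) powr (2 - R)"
    proof (intro mult_right_mono)
      have "A = (\<Sum>n. norm (a (Suc (n + Suc q)) / of_nat (Suc (n + Suc q)) powr (2 :: complex))) + (\<Sum>n<Suc q. norm (a (Suc n) / of_nat (Suc n) powr (2 :: complex)))"
        unfolding A_def by (rule suminf_split_initial_segment[OF sm2])
      moreover have "(\<Sum>n<Suc q. norm (a (Suc n) / of_nat (Suc n) powr (2 :: complex))) \<ge> 0"
        by (intro sum_nonneg) auto
      ultimately show "(\<Sum>n. norm (a (Suc (n + Suc q)) / of_nat (Suc (n + Suc q)) powr (2 :: complex))) \<le> A" by linarith
    qed simp
    also have "\<dots> = A * (x + 1)\<^sup>2 * (x / (x + 1)) powr R * x powr (-R)"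
      using x by (simp add: powr_diff powr_divide powr_minus field_simps)
    also have "\<dots> \<le> norm (a (Suc q)) / 2 * x powr (-R)"
      using R(1) by (intro mult_right_mono) auto
    finally have tail: "norm (\<Sum>n. ?f (n + Suc q)) \<le> c" by (simp add: c_def)
    have "norm (?f q) = 2 * c"
      unfolding norm_divide norm_of_nat_powr s c_def x_def by (simp add: powr_minus field_simps)
    with tail norm_diff_ineq[of "?f q" "\<Sum>n. ?f (n + Suc q)"] show "norm (F s) \<ge> c"
      unfolding Fs2 by (simp add: add.commute)
  qed
qed

text \<open>For \<open>Re s = -1/2\<close> the reflected point \<open>cnj (1 - s)\<close> is
  \<open>s + 2\<close>, so these are the two Gamma products of the functional equation. The argument
  of each factor moves by \<open>2 * lam j\<close>, so the shift bound applies once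
  \<open>|Im s|\<close> is large, and induction over the factors multiplies the bounds.\<close>

lemma Gamma_factors_bound:
  fixes lam :: "nat \<Rightarrow> real" and mu :: "nat \<Rightarrow> complex"
  assumes "\<forall>j<r. lam j > 0 \<and> Re (mu j) \<ge> 0"
  shows "\<exists>C>0. \<exists>N T. \<forall>s. Re s = -1/2 \<and> \<bar>Im s\<bar> \<ge> T \<longrightarrow>
     (\<Prod>j<r. norm (Gamma (of_real (lam j) * (s + 2) + mu j)))
       \<le> C * (1 + norm s) ^ N * (\<Prod>j<r. norm (Gamma (of_real (lam j) * s + mu j)))"
  using assms
proof (induction r)
  case 0
  show ?case by (intro exI[of _ 1] conjI exI[of _ 0]) auto
next
  case (Suc r)
  have "\<forall>j<r. lam j > 0 \<and> Re (mu j) \<ge> 0" using Suc.prems by simp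
  from Suc.IH[OF this] obtain C N T where C: "C > 0" and IH: "\<And>s. Re s = -1/2 \<Longrightarrow> \<bar>Im s\<bar> \<ge> T \<Longrightarrow>
     (\<Prod>j<r. norm (Gamma (of_real (lam j) * (s + 2) + mu j)))
       \<le> C * (1 + norm s) ^ N * (\<Prod>j<r. norm (Gamma (of_real (lam j) * s + mu j)))"
    by blast
  define l where "l = lam r"
  define u where "u = mu r"
  have l: "l > 0" "Re u \<ge> 0" using Suc.prems by (auto simp: l_def u_def)
  define x where "x = - l / 2 + Re u"
  obtain C' N' where C': "C' > 0" and sh: "\<And>z. Re z = x \<Longrightarrow> 1 \<le> \<bar>Im z\<bar> \<Longrightarrow>
       norm (Gamma (z + of_real (2 * l))) \<le> C' * (1 + \<bar>Im z\<bar>) ^ N' * norm (Gamma z)"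
  proof (rule norm_Gamma_shift_bound[of x "2 * l"])
    show "0 < x + 2 * l" "0 \<le> 2 * l" using l by (simp_all add: x_def)
  qed blast
  define K where "K = 1 + l + \<bar>Im u\<bar>"
  have K: "K > 0" using l by (simp add: K_def)
  have step: "norm (Gamma (of_real l * (s + 2) + u)) \<le> C' * K ^ N' * (1 + norm s) ^ N' * norm (Gamma (of_real l * s + u))"
    if s: "Re s = -1/2" "\<bar>Im s\<bar> \<ge> (1 + \<bar>Im u\<bar>) / l" for s
  proof -
    let ?z = "of_real l * s + u"
    have "1 + \<bar>Im u\<bar> \<le> l * \<bar>Im s\<bar>" using s l by (simp add: field_simps)
    then have im: "1 \<le> \<bar>Im ?z\<bar>" using l by (simp add: abs_mult abs_if split: if_splits)
    have "norm (Gamma (?z + of_real (2 * l))) \<le> C' * (1 + \<bar>Im ?z\<bar>) ^ N' * norm (Gamma ?z)"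
      by (rule sh) (use s im in \<open>auto simp: x_def\<close>)
    also have "\<dots> \<le> C' * (K * (1 + norm s)) ^ N' * norm (Gamma ?z)"
    proof (intro mult_right_mono mult_left_mono power_mono)
      have "\<bar>Im ?z\<bar> \<le> l * \<bar>Im s\<bar> + \<bar>Im u\<bar>"
        using abs_triangle_ineq[of "l * Im s" "Im u"] l by (simp add: abs_mult)
      also have "l * \<bar>Im s\<bar> \<le> l * norm s" using l abs_Im_le_cmod by (intro mult_left_mono) auto
      finally have *: "\<bar>Im ?z\<bar> \<le> l * norm s + \<bar>Im u\<bar>" by simp
      have "K * (1 + norm s) = 1 + l + \<bar>Im u\<bar> + norm s + l * norm s + \<bar>Im u\<bar> * norm s"
        by (simp add: K_def algebra_simps)
      moreover have "\<bar>Im u\<bar> * norm s \<ge> 0" by simp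
      ultimately show "1 + \<bar>Im ?z\<bar> \<le> K * (1 + norm s)" using * l norm_ge_zero[of s] by linarith
    qed (use C' in auto)
    also have "?z + of_real (2 * l) = of_real l * (s + 2) + u" by (simp add: algebra_simps)
    finally show ?thesis by (simp only: power_mult_distrib mult.assoc)
  qed
  show ?case
  proof (intro exI conjI allI impI)
    show "C * C' * K ^ N' > 0" using C C' K by simp
    fix s assume s: "Re s = -1/2 \<and> \<bar>Im s\<bar> \<ge> max T ((1 + \<bar>Im u\<bar>) / l)"
    have "(\<Prod>j<Suc r. norm (Gamma (of_real (lam j) * (s + 2) + mu j))) =
      (\<Prod>j<r. norm (Gamma (of_real (lam j) * (s + 2) + mu j))) * norm (Gamma (of_real l * (s + 2) + u))"
      by (simp add: l_def u_def)
    also have "\<dots> \<le> (C * (1 + norm s) ^ N * (\<Prod>j<r. norm (Gamma (of_real (lam j) * s + mu j)))) *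
      (C' * K ^ N' * (1 + norm s) ^ N' * norm (Gamma (of_real l * s + u)))"
      using s by (intro mult_mono IH step mult_nonneg_nonneg prod_nonneg) (use C in auto)
    also have "\<dots> = C * C' * K ^ N' * (1 + norm s) ^ (N + N') * (\<Prod>j<Suc r. norm (Gamma (of_real (lam j) * s + mu j)))"
      by (simp add: l_def u_def power_add)
    finally show "(\<Prod>j<Suc r. norm (Gamma (of_real (lam j) * (s + 2) + mu j))) \<le>
      C * C' * K ^ N' * (1 + norm s) ^ (N + N') * (\<Prod>j<Suc r. norm (Gamma (of_real (lam j) * s + mu j)))" .
  qed
qed

text \<open>In absolute value the functional equation expresses \<open>F s\<close> by
  \<open>F (s + 2)\<close>, taken on the line of real part \<open>3/2\<close> where the Dirichlet
  series is bounded, times a quotient of Gamma products. Large \<open>|Im s|\<close> keeps both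
  points off the poles of the Gamma factors, where \<open>functional_eq\<close> says
  nothing.\<close>

lemma functional_eq_left_bound:
  assumes rep: "dirichlet_rep a F" and fe: "functional_eq F Q r lam mu eps"
  obtains C N T where "C > 0" "\<And>s. Re s = -1/2 \<Longrightarrow> \<bar>Im s\<bar> \<ge> T \<Longrightarrow> norm (F s) \<le> C * (1 + norm s) ^ N"
proof -
  from fe have Q: "Q > 0" and lm: "\<forall>j<r. lam j > 0 \<and> Re (mu j) \<ge> 0" and eps: "norm eps = 1"
    and feq: "\<And>s. s \<noteq> 0 \<Longrightarrow> s \<noteq> 1 \<Longrightarrow> (\<forall>j<r. of_real (lam j) * s + mu j \<notin> \<int>\<^sub>\<le>\<^sub>0) \<Longrightarrow>
          (\<forall>j<r. of_real (lam j) * cnj (1 - s) + mu j \<notin> \<int>\<^sub>\<le>\<^sub>0) \<Longrightarrow>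
        Phi_fun F Q r lam mu s = eps * cnj (Phi_fun F Q r lam mu (cnj (1 - s)))"
    unfolding functional_eq_def by blast+
  obtain C N T where C: "C > 0" and G: "\<And>s. Re s = -1/2 \<Longrightarrow> \<bar>Im s\<bar> \<ge> T \<Longrightarrow>
     (\<Prod>j<r. norm (Gamma (of_real (lam j) * (s + 2) + mu j)))
       \<le> C * (1 + norm s) ^ N * (\<Prod>j<r. norm (Gamma (of_real (lam j) * s + mu j)))"
    using Gamma_factors_bound[OF lm] by blast
  obtain A where A: "A > 0" "\<And>s. Re s \<ge> 3/2 \<Longrightarrow> norm (F s) \<le> A"
    using dirichlet_rep_bounded[OF rep, of "3/2"] by auto
  \<comment> \<open>A sum in place of a maximum: it dominates every summand and makes sense for
    \<open>r = 0\<close>.\<close>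
  define T' where "T' = (\<Sum>j<r. (1 + \<bar>Im (mu j)\<bar>) / lam j)"
  have T': "\<bar>Im (mu j)\<bar> < lam j * t" if "j < r" "t \<ge> T'" for j t
  proof -
    have "(1 + \<bar>Im (mu j)\<bar>) / lam j \<le> T'"
      unfolding T'_def using lm that by (intro member_le_sum) auto
    then have "(1 + \<bar>Im (mu j)\<bar>) / lam j \<le> t" using that by simp
    then show ?thesis using lm that by (simp add: field_simps)
  qed
  show ?thesis
  proof (rule that)
    show "Q powr 2 * A * C > 0" using Q A C by simp
    fix s assume s: "Re s = -1/2" "\<bar>Im s\<bar> \<ge> max T T'"
    have cs: "cnj (1 - s) = s + 2" using s by (simp add: complex_eq_iff)
    have np: "of_real (lam j) * w + mu j \<notin> \<int>\<^sub>\<le>\<^sub>0" if "j < r" "Im w = Im s" for j w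
    proof
      assume "of_real (lam j) * w + mu j \<in> \<int>\<^sub>\<le>\<^sub>0"
      then obtain n where "of_real (lam j) * w + mu j = of_int n" by (auto elim!: nonpos_Ints_cases)
      then have "Im (of_real (lam j) * w + mu j) = Im (of_int n)" by (rule arg_cong)
      then have "lam j * Im s = - Im (mu j)" using that by simp
      then have "lam j * \<bar>Im s\<bar> = \<bar>Im (mu j)\<bar>" using lm that
        by (metis abs_minus abs_mult abs_of_pos)
      moreover have "\<bar>Im (mu j)\<bar> < lam j * \<bar>Im s\<bar>" using T'[OF that(1)] s by simp
      ultimately show False by simp
    qed
    have "Phi_fun F Q r lam mu s = eps * cnj (Phi_fun F Q r lam mu (s + 2))"
    proof -
      have "s \<noteq> 0" "s \<noteq> 1" using s(1) by (auto simp: complex_eq_iff)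
      then show ?thesis using feq[of s] np unfolding cs by simp
    qed
    then have "norm (Phi_fun F Q r lam mu s) = norm (Phi_fun F Q r lam mu (s + 2))"
      using eps by (simp add: norm_mult)
    then have eq: "Q powr (-1/2) * (\<Prod>j<r. norm (Gamma (of_real (lam j) * s + mu j))) * norm (F s) =
      Q powr (3/2) * (\<Prod>j<r. norm (Gamma (of_real (lam j) * (s + 2) + mu j))) * norm (F (s + 2))"
      using Q s unfolding Phi_fun_def by (simp add: norm_mult prod_norm[symmetric] norm_powr_real_powr)
    define P where "P = (\<Prod>j<r. norm (Gamma (of_real (lam j) * s + mu j)))"
    have P: "P > 0" unfolding P_def using np by (intro prod_pos) (auto simp: Gamma_eq_zero_iff)
    have "Q powr (-1/2) * P * norm (F s) \<le> Q powr (3/2) * (C * (1 + norm s) ^ N * P) * A"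
    proof -
      have "(\<Prod>j<r. norm (Gamma (of_real (lam j) * (s + 2) + mu j))) \<le> C * (1 + norm s) ^ N * P"
        unfolding P_def using s by (intro G) auto
      then show ?thesis
        unfolding eq[folded P_def] using s Q C P
        by (intro mult_mono A(2) mult_nonneg_nonneg prod_nonneg) auto
    qed
    then have "Q powr (1/2) * (Q powr (-1/2) * P * norm (F s)) \<le> Q powr (1/2) * (Q powr (3/2) * (C * (1 + norm s) ^ N * P) * A)"
      by (intro mult_left_mono) auto
    moreover have "Q powr (1/2) * Q powr (-1/2) = 1" "Q powr (1/2) * Q powr (3/2) = Q powr 2"
      using Q by (simp_all add: powr_add[symmetric])
    ultimately have "P * norm (F s) \<le> P * (Q powr 2 * A * C * (1 + norm s) ^ N)"
    proof -
      assume *: "Q powr (1/2) * (Q powr (-1/2) * P * norm (F s)) \<le> Q powr (1/2) * (Q powr (3/2) * (C * (1 + norm s) ^ N * P) * A)"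
        and 1: "Q powr (1/2) * Q powr (-1/2) = 1" and 2: "Q powr (1/2) * Q powr (3/2) = Q powr 2"
      have 3: "Q powr (1/2) * (Q powr (-1/2) * P * norm (F s)) = (Q powr (1/2) * Q powr (-1/2)) * (P * norm (F s))"
        by (simp only: mult.assoc)
      have 4: "Q powr (1/2) * (Q powr (3/2) * (C * (1 + norm s) ^ N * P) * A) = (Q powr (1/2) * Q powr (3/2)) * (P * (A * C * (1 + norm s) ^ N))"
        by (simp only: mult_ac)
      show ?thesis using *[unfolded 3 4 1 2] by (simp add: mult_ac)
    qed
    then show "norm (F s) \<le> Q powr 2 * A * C * (1 + norm s) ^ N" using P by simp
  qed
qed


text \<open>Polynomial bounds hold on \<open>Re s = -1/2\<close> by the functional equation and from
  \<open>Re s = 3/2\<close> on by the Dirichlet series. Division by \<open>(s + 5) ^ N\<close> makes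
  them constant on the two edges, and the finite order of \<open>g\<close> admits Phragmen-Lindelof
  in between. The shift 5 keeps \<open>norm (s + 5)\<close> above 1 and comparable with
  \<open>1 + norm s\<close>.\<close>

lemma selberg_poly_growth:
  assumes rep: "dirichlet_rep a F" and fe: "functional_eq F Q r lam mu eps"
    and g: "entire_finite_order g" "\<And>s. s \<noteq> 1 \<Longrightarrow> g s = (s - 1) ^ m * F s"
  obtains C N where "C > 0" "\<And>s. Re s \<ge> -1/2 \<Longrightarrow> norm (g s) \<le> C * (1 + norm s) ^ N"
proof -
  obtain C1 N1 T where C1: "C1 > 0" and left: "\<And>s. Re s = -1/2 \<Longrightarrow> \<bar>Im s\<bar> \<ge> T \<Longrightarrow> norm (F s) \<le> C1 * (1 + norm s) ^ N1"
    by (rule functional_eq_left_bound[OF rep fe]) (rule that, assumption, blast)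
  obtain A where A: "A > 0" "\<And>s. Re s \<ge> 3/2 \<Longrightarrow> norm (F s) \<le> A"
    using dirichlet_rep_bounded[OF rep, of "3/2"] by auto
  have hol: "g holomorphic_on UNIV" using g(1) by (simp add: entire_finite_order_def)
  obtain A1 \<rho> where order: "\<And>s. norm (g s) \<le> A1 * exp (norm s powr \<rho>)"
    using g(1) by (auto simp: entire_finite_order_def)
  \<comment> \<open>The functional equation gave a bound for large \<open>|Im s|\<close>; what is
    left of the line is a compact segment.\<close>
  have "compact (g ` (\<lambda>t. Complex (-1/2) t) ` {-\<bar>T\<bar>..\<bar>T\<bar>})"
    by (intro compact_continuous_image continuous_on_subset[OF holomorphic_on_imp_continuous_on[OF hol]])
       (auto intro!: continuous_intros simp: Complex_eq)
  then have "bounded (g ` (\<lambda>t. Complex (-1/2) t) ` {-\<bar>T\<bar>..\<bar>T\<bar>})" by (rule compact_imp_bounded)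
  then obtain B0 where B0: "\<And>t. t \<in> {-\<bar>T\<bar>..\<bar>T\<bar>} \<Longrightarrow> norm (g (Complex (-1/2) t)) \<le> B0"
    unfolding bounded_iff by blast
  have m_le: "norm ((s - 1) ^ m) \<le> (1 + norm s) ^ m" for s :: complex
    unfolding norm_power using norm_triangle_ineq4[of s 1] by (intro power_mono) auto
  define N where "N = m + N1"
  define D where "D = C1 + A + \<bar>B0\<bar>"
  have D: "D > 0" using C1 A by (simp add: D_def)
  have pw: "1 \<le> (1 + norm s) ^ k" for s :: complex and k by (rule one_le_power) simp
  have bdry: "norm (g s) \<le> D * (1 + norm s) ^ N" if "Re s = -1/2 \<or> Re s \<ge> 3/2" for s
  proof -
    consider "Re s \<ge> 3/2" | "Re s = -1/2" "\<bar>Im s\<bar> \<ge> \<bar>T\<bar>" | "Re s = -1/2" "\<bar>Im s\<bar> \<le> \<bar>T\<bar>"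
      using \<open>Re s = -1/2 \<or> _\<close> by linarith
    then show ?thesis
    proof cases
      case 1
      have "norm (g s) = norm ((s - 1) ^ m) * norm (F s)" using g(2)[of s] 1 by (cases "s = 1") (auto simp: norm_mult)
      also have "\<dots> \<le> (1 + norm s) ^ m * A" using A 1 by (intro mult_mono m_le) auto
      also have "\<dots> \<le> (1 + norm s) ^ N * D"
        unfolding N_def using A C1 by (intro mult_mono power_increasing) (auto simp: D_def)
      finally show ?thesis by (simp add: mult.commute)
    next
      case 2
      have "norm (g s) = norm ((s - 1) ^ m) * norm (F s)" using g(2)[of s] 2 by (cases "s = 1") (auto simp: norm_mult)
      also have "\<dots> \<le> (1 + norm s) ^ m * (C1 * (1 + norm s) ^ N1)" using 2 by (intro mult_mono m_le left) auto
      also have "\<dots> = C1 * (1 + norm s) ^ N" by (simp add: N_def power_add)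
      also have "\<dots> \<le> D * (1 + norm s) ^ N" using A C1 by (intro mult_right_mono) (auto simp: D_def)
      finally show ?thesis .
    next
      case 3
      have "s = Complex (-1/2) (Im s)" using 3 by (simp add: complex_eq_iff)
      then have "norm (g s) \<le> B0" using B0[of "Im s"] 3(2) by (simp add: abs_le_iff)
      also have "\<dots> \<le> D * 1" using A C1 by (simp add: D_def)
      also have "\<dots> \<le> D * (1 + norm s) ^ N" using D pw by (intro mult_left_mono) auto
      finally show ?thesis .
    qed
  qed
  have s5: "1 + norm s \<le> 2 * norm (s + 5)" "1 \<le> norm (s + 5)" if "Re s \<ge> -1/2" for s
  proof -
    show 1: "1 \<le> norm (s + 5)" using complex_Re_le_cmod[of "s + 5"] that by simp
    have "(norm s)\<^sup>2 \<le> (norm (s + 5))\<^sup>2" unfolding cmod_power2 using that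
      by (simp add: power2_eq_square algebra_simps)
    then have "norm s \<le> norm (s + 5)" by (rule power2_le_imp_le) simp
    with 1 show "1 + norm s \<le> 2 * norm (s + 5)" by simp
  qed
  define f where "f = (\<lambda>s. g s / (s + 5) ^ N)"
  have strip: "norm (f s) \<le> D * 2 ^ N" if s: "-1/2 \<le> Re s" "Re s \<le> 3/2" for s
  proof (rule Phragmen_Lindelof_strip[of f "{s. Re s > -1}" "-1/2" "3/2" A1 \<rho>])
    show "f holomorphic_on {s. Re s > -1}"
    proof -
      have "s + 5 \<noteq> 0" if "Re s > -1" for s using that by (auto simp: complex_eq_iff)
      then show ?thesis
        unfolding f_def by (intro holomorphic_intros holomorphic_on_subset[OF hol]) auto
    qed
    show "open {s. Re s > -1}" by (rule open_halfspace_Re_gt)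
    show "norm (f s) \<le> A1 * exp (norm s powr \<rho>)" if "-1/2 \<le> Re s" for s
    proof -
      have "norm (f s) \<le> norm (g s)"
        unfolding f_def norm_divide norm_power using s5(2)[OF that] one_le_power[OF s5(2)[OF that], of N]
        by (simp add: divide_le_eq mult_left_le_imp_le mult_le_cancel_left1 norm_ge_zero)
      with order[of s] show ?thesis by linarith
    qed
    show "norm (f s) \<le> D * 2 ^ N" if "Re s = -1/2 \<or> Re s = 3/2" for s
    proof -
      have re: "Re s \<ge> -1/2" using that by auto
      have "norm (g s) \<le> D * (1 + norm s) ^ N" using that by (intro bdry) auto
      also have "\<dots> \<le> D * (2 * norm (s + 5)) ^ N" using D s5(1)[OF re] by (intro mult_left_mono power_mono) auto
      finally have "norm (g s) \<le> D * 2 ^ N * norm (s + 5) ^ N" by (simp add: power_mult_distrib mult.assoc)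
      moreover have "norm (s + 5) ^ N > 0" using s5(2)[OF re] by (intro zero_less_power) linarith
      ultimately show ?thesis unfolding f_def norm_divide norm_power by (simp add: divide_le_eq)
    qed
  qed (use s in auto)
  show thesis
  proof (rule that)
    show "D * 2 ^ N * 6 ^ N > 0" using D by simp
    fix s assume s: "Re s \<ge> -1/2"
    show "norm (g s) \<le> D * 2 ^ N * 6 ^ N * (1 + norm s) ^ N"
    proof (cases "Re s \<le> 3/2")
      case True
      have nz: "norm (s + 5) > 0" using s5(2)[OF s] by linarith
      have "norm (g s) = norm (f s) * norm (s + 5) ^ N"
        using nz unfolding f_def by (simp add: norm_divide norm_power)
      also have "\<dots> \<le> (D * 2 ^ N) * (6 * (1 + norm s)) ^ N"
      proof (intro mult_mono power_mono strip[OF s True])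
        show "norm (s + 5) \<le> 6 * (1 + norm s)"
        proof -
          have "norm (s + 5) \<le> norm s + 5" using norm_triangle_ineq[of s 5] by simp
          also have "\<dots> \<le> 6 * (1 + norm s)" by (simp add: algebra_simps)
          finally show ?thesis .
        qed
      qed (use D in auto)
      finally show ?thesis by (simp only: power_mult_distrib mult.assoc)
    next
      case False
      then have "norm (g s) \<le> D * (1 + norm s) ^ N" by (intro bdry) auto
      also have "\<dots> \<le> D * (2 ^ N * 6 ^ N) * (1 + norm s) ^ N"
        using D one_le_power[of "12::real" N] by (intro mult_right_mono) (auto simp: power_mult_distrib[symmetric])
      finally show ?thesis by (simp add: mult.assoc)
    qed
  qed
qed

lemma ln_poly_le_powr:
  fixes K :: real
  assumes "K > 0" "\<epsilon> > 0"
  obtains C where "C > 0" "\<And>y. y \<ge> 0 \<Longrightarrow> ln (K * (1 + y) ^ N) + 1 \<le> C * (1 + y) powr \<epsilon>"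
proof
  let ?C = "\<bar>ln K\<bar> + real N / \<epsilon> + 1"
  show "?C > 0" using assms by (simp add: add_nonneg_pos)
  fix y :: real assume y: "y \<ge> 0"
  have 1: "1 \<le> (1 + y) powr \<epsilon>" using y assms by (intro ge_one_powr_ge_zero) auto
  have "ln (K * (1 + y) ^ N) + 1 = ln K + real N * ln (1 + y) + 1"
    using assms y by (simp add: ln_mult ln_realpow)
  also have "\<dots> \<le> \<bar>ln K\<bar> * (1 + y) powr \<epsilon> + real N * ((1 + y) powr \<epsilon> / \<epsilon>) + (1 + y) powr \<epsilon>"
    using ln_powr_bound[of "1 + y" \<epsilon>] y assms 1 mult_left_mono[OF 1, of "\<bar>ln K\<bar>"]
    by (intro add_mono mult_left_mono) auto
  finally show "ln (K * (1 + y) ^ N) + 1 \<le> ?C * (1 + y) powr \<epsilon>" by (simp add: algebra_simps)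
qed

text \<open>Borel-Caratheodory for a logarithm of \<open>g0\<close> on the disc about
  \<open>Complex R (Im s)\<close> of radius \<open>R - 1/2\<close>, which touches the critical line
  from the right and contains no zeros. The real part of the logarithm is
  \<open>ln (norm (g0 z))\<close>: polynomial growth bounds it from above, and at the centre the
  leading Dirichlet coefficient bounds it from below. The derivative is therefore logarithmic in
  \<open>|Im s|\<close>, below any power.\<close>

lemma log_deriv_bound:
  assumes rep: "dirichlet_rep a F" and fe: "functional_eq F Q r lam mu eps"
    and g: "entire_finite_order g" "\<And>s. s \<noteq> 1 \<Longrightarrow> g s = (s - 1) ^ m * F s"
    and hol0: "g0 holomorphic_on UNIV" and g0: "\<And>s. g s = (s - 1) ^ k * g0 s"
    and nz: "\<And>s. Re s > 1/2 \<Longrightarrow> g0 s \<noteq> 0"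
    and \<sigma>: "\<sigma> > 1/2" and \<epsilon>: "\<epsilon> > 0"
  obtains C where "C > 0" "\<And>s. \<sigma> \<le> Re s \<Longrightarrow> Re s \<le> 3 \<Longrightarrow> norm (deriv g0 s / g0 s) \<le> C * (1 + \<bar>Im s\<bar>) powr \<epsilon>"
proof -
  obtain C N where C: "C > 0" and growth: "\<And>s. Re s \<ge> -1/2 \<Longrightarrow> norm (g s) \<le> C * (1 + norm s) ^ N"
    by (rule selberg_poly_growth[OF rep fe g(1) g(2)], assumption) (rule that, assumption, blast)
  have "F 2 \<noteq> 0" using g(2)[of 2] g0[of 2] nz[of 2] by auto
  then obtain R c where R: "R \<ge> 4" and c: "c > 0" and low: "\<And>s. Re s = R \<Longrightarrow> norm (F s) \<ge> c"
    using dirichlet_rep_lower_bound[OF rep, of 2] by auto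
  define P where "P = R - 1/2"
  define K where "K = C * (1 + 2 * R) ^ N * (1 + R) ^ k / c"
  have K: "K > 0" using C R c by (simp add: K_def)
  obtain C2 where C2: "C2 > 0" and lnb: "\<And>y. y \<ge> 0 \<Longrightarrow> ln (K * (1 + y) ^ (N + k)) + 1 \<le> C2 * (1 + y) powr \<epsilon>"
    by (rule ln_poly_le_powr[OF K \<epsilon>, of "N + k"]) (rule that, assumption, blast)
  define E where "E = 8 * P / (\<sigma> - 1/2)\<^sup>2"
  have E: "E > 0" using R \<sigma> by (simp add: E_def P_def)
  \<comment> \<open>For such \<open>s\<close> all points of the disc have distance at least 1 from
    the point 1, so dividing \<open>g\<close> by \<open>(s - 1) ^ k\<close> does not increase
    it.\<close>
  have far: "norm (deriv g0 s / g0 s) \<le> E * C2 * (1 + \<bar>Im s\<bar>) powr \<epsilon>"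
    if s: "\<sigma> \<le> Re s" "Re s \<le> 3" and im: "\<bar>Im s\<bar> \<ge> R + 1" for s
  proof -
    define z0 where "z0 = Complex R (Im s)"
    define M where "M = ln (K * (1 + \<bar>Im s\<bar>) ^ (N + k)) + 1"
    have ballp: "Re z > 1/2" "norm z \<le> 2 * R + \<bar>Im s\<bar>" "norm (z - 1) \<ge> 1" if "z \<in> ball z0 P" for z
    proof -
      have d: "norm (z - z0) < P" using that by (simp add: dist_norm norm_minus_commute)
      show "Re z > 1/2" using abs_Re_le_cmod[of "z - z0"] d by (simp add: z0_def P_def)
      have "norm z0 \<le> R + \<bar>Im s\<bar>" using cmod_le[of z0] R by (simp add: z0_def)
      then show "norm z \<le> 2 * R + \<bar>Im s\<bar>" using norm_triangle_ineq[of "z - z0" z0] d by (simp add: P_def)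
      have "\<bar>Im s\<bar> - \<bar>Im z\<bar> \<le> P" using abs_Im_le_cmod[of "z - z0"] d by (simp add: z0_def)
      then show "norm (z - 1) \<ge> 1" using abs_Im_le_cmod[of "z - 1"] im by (simp add: P_def)
    qed
    have P0: "P > 0" using R by (simp add: P_def)
    have nzb: "g0 z \<noteq> 0" if "z \<in> ball z0 P" for z using nz ballp(1)[OF that] by auto
    have holb: "g0 holomorphic_on ball z0 P" by (rule holomorphic_on_subset[OF hol0]) auto
    obtain l where l: "l holomorphic_on ball z0 P" "\<And>z. z \<in> ball z0 P \<Longrightarrow> g0 z = exp (l z)"
      using contractible_imp_holomorphic_log[OF holb convex_imp_contractible[OF convex_ball] nzb] by blast
    have up: "norm (g0 z) \<le> C * (1 + 2 * R) ^ N * (1 + \<bar>Im s\<bar>) ^ N" if z: "z \<in> ball z0 P" for z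
    proof -
      have "norm (g0 z) * 1 \<le> norm (g0 z) * norm (z - 1) ^ k"
        using one_le_power[OF ballp(3)[OF z]] by (intro mult_left_mono) auto
      also have "\<dots> = norm (g z)" by (simp add: g0 norm_mult norm_power)
      also have "\<dots> \<le> C * (1 + norm z) ^ N" using ballp(1)[OF z] by (intro growth) auto
      also have "\<dots> \<le> C * ((1 + 2 * R) * (1 + \<bar>Im s\<bar>)) ^ N"
      proof (intro mult_left_mono power_mono)
        have "0 \<le> 2 * R * \<bar>Im s\<bar>" using R by simp
        moreover have "(1 + 2 * R) * (1 + \<bar>Im s\<bar>) = 1 + 2 * R + \<bar>Im s\<bar> + 2 * R * \<bar>Im s\<bar>" by (simp add: algebra_simps)
        ultimately show "1 + norm z \<le> (1 + 2 * R) * (1 + \<bar>Im s\<bar>)" using ballp(2)[OF z] by linarith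
      qed (use C in auto)
      finally show ?thesis by (simp add: power_mult_distrib mult.assoc)
    qed
    have z0b: "z0 \<in> ball z0 P" using P0 by simp
    have lowz: "c / ((1 + R) ^ k * (1 + \<bar>Im s\<bar>) ^ k) \<le> norm (g0 z0)"
    proof -
      have "z0 \<noteq> 1" using R by (auto simp: z0_def complex_eq_iff)
      have "c * 1 \<le> norm (F z0) * norm (z0 - 1) ^ m"
        using one_le_power[OF ballp(3)[OF z0b]] c by (intro mult_mono low) (auto simp: z0_def)
      also have "\<dots> = norm (z0 - 1) ^ k * norm (g0 z0)"
        using g(2)[OF \<open>z0 \<noteq> 1\<close>] g0[of z0] by (metis norm_mult norm_power mult.commute)
      also have "\<dots> \<le> ((1 + R) * (1 + \<bar>Im s\<bar>)) ^ k * norm (g0 z0)"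
      proof (intro mult_right_mono power_mono)
        have "norm (z0 - 1) \<le> R + \<bar>Im s\<bar>" using cmod_le[of "z0 - 1"] R by (simp add: z0_def)
        moreover have "0 \<le> R * \<bar>Im s\<bar>" using R by simp
        moreover have "(1 + R) * (1 + \<bar>Im s\<bar>) = 1 + R + \<bar>Im s\<bar> + R * \<bar>Im s\<bar>" by (simp add: algebra_simps)
        ultimately show "norm (z0 - 1) \<le> (1 + R) * (1 + \<bar>Im s\<bar>)" by linarith
      qed auto
      finally have "c \<le> ((1 + R) ^ k * (1 + \<bar>Im s\<bar>) ^ k) * norm (g0 z0)" by (simp add: power_mult_distrib)
      moreover have "(1 + R) ^ k * (1 + \<bar>Im s\<bar>) ^ k > 0" using R by (intro mult_pos_pos zero_less_power) auto
      ultimately show ?thesis by (simp add: divide_le_eq mult.commute)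
    qed
    have re_l: "Re (l z) = ln (norm (g0 z))" if "z \<in> ball z0 P" for z
      using l(2)[OF that] by simp
    have less: "Re (l z - l z0) < M" if z: "z \<in> ball z0 P" for z
    proof -
      let ?y = "1 + \<bar>Im s\<bar>"
      have y: "?y > 0" "1 + R > 0" "1 + 2 * R > 0" using R by auto
      have "Re (l z) \<le> ln (C * (1 + 2 * R) ^ N * ?y ^ N)"
        unfolding re_l[OF z] using up[OF z] nzb[OF z] by (intro ln_mono) auto
      moreover have "ln (c / ((1 + R) ^ k * ?y ^ k)) \<le> Re (l z0)"
        unfolding re_l[OF z0b] using lowz c y nzb[OF z0b] by (intro ln_mono divide_pos_pos mult_pos_pos zero_less_power) auto
      moreover have "ln (C * (1 + 2 * R) ^ N * ?y ^ N) - ln (c / ((1 + R) ^ k * ?y ^ k)) = M - 1"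
      proof -
        have "ln (C * (1 + 2 * R) ^ N * ?y ^ N) - ln (c / ((1 + R) ^ k * ?y ^ k)) =
          ln ((C * (1 + 2 * R) ^ N * ?y ^ N) / (c / ((1 + R) ^ k * ?y ^ k)))"
          using C c y by (intro ln_divide_pos[symmetric] divide_pos_pos mult_pos_pos zero_less_power) auto
        also have "(C * (1 + 2 * R) ^ N * ?y ^ N) / (c / ((1 + R) ^ k * ?y ^ k)) = K * ?y ^ (N + k)"
          by (simp add: K_def power_add)
        finally show ?thesis by (simp add: M_def)
      qed
      ultimately show ?thesis by simp
    qed
    have "s - z0 = of_real (Re s - R)" by (simp add: z0_def complex_eq_iff)
    then have "norm (s - z0) = \<bar>Re s - R\<bar>" by (metis norm_of_real)
    then have ns: "norm (s - z0) \<le> R - \<sigma>" using s R by simp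
    have "norm (deriv l s) \<le> 8 * M * P / (P - (R - \<sigma>))\<^sup>2"
      by (rule Borel_Caratheodory_deriv[OF l(1) less ns]) (use \<sigma> in \<open>auto simp: P_def\<close>)
    also have "P - (R - \<sigma>) = \<sigma> - 1/2" by (simp add: P_def)
    also have "8 * M * P / (\<sigma> - 1/2)\<^sup>2 = E * M" by (simp add: E_def)
    also have "\<dots> \<le> E * (C2 * (1 + \<bar>Im s\<bar>) powr \<epsilon>)"
      unfolding M_def using E by (intro mult_left_mono lnb) auto
    also have "deriv l s = deriv g0 s / g0 s"
    proof -
      have sb: "s \<in> ball z0 P" using ns \<sigma> by (simp add: dist_norm norm_minus_commute P_def)
      have "(l has_field_derivative deriv l s) (at s)"
        using l(1) sb by (intro holomorphic_derivI[OF l(1)]) auto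
      then have "((\<lambda>z. exp (l z)) has_field_derivative exp (l s) * deriv l s) (at s)"
        by (rule DERIV_fun_exp)
      then have "(g0 has_field_derivative exp (l s) * deriv l s) (at s)"
        by (rule DERIV_cong_ev[THEN iffD1, rotated 3])
           (use sb l(2) in \<open>auto intro!: eventually_nhds_in_open[THEN eventually_mono, of "ball z0 P"]\<close>)
      then have "deriv g0 s = exp (l s) * deriv l s" by (rule DERIV_imp_deriv)
      then show ?thesis using l(2)[OF sb] by simp
    qed
    finally show ?thesis by (simp add: mult.assoc)
  qed
  \<comment> \<open>Near the real axis the disc could contain 1; there the quotient is continuous on
    a compact box.\<close>
  define Bx where "Bx = cbox (Complex \<sigma> (-(R + 1))) (Complex 3 (R + 1))"
  have "continuous_on Bx (\<lambda>s. deriv g0 s / g0 s)"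
    using nz \<sigma> holomorphic_on_imp_continuous_on[OF hol0] holomorphic_on_imp_continuous_on[OF holomorphic_deriv[OF hol0]]
    by (intro continuous_intros) (auto intro: continuous_on_subset simp: Bx_def in_cbox_complex_iff)
  then have "bounded ((\<lambda>s. deriv g0 s / g0 s) ` Bx)"
    by (intro compact_imp_bounded compact_continuous_image) (auto simp: Bx_def)
  then obtain B where B: "\<And>s. s \<in> Bx \<Longrightarrow> norm (deriv g0 s / g0 s) \<le> B"
    by (auto simp: bounded_iff)
  show ?thesis
  proof (rule that)
    show "E * C2 + \<bar>B\<bar> > 0" using E C2 by (simp add: add_pos_nonneg)
    fix s assume s: "\<sigma> \<le> Re s" "Re s \<le> 3"
    have 1: "1 \<le> (1 + \<bar>Im s\<bar>) powr \<epsilon>" using \<epsilon> by (intro ge_one_powr_ge_zero) auto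
    show "norm (deriv g0 s / g0 s) \<le> (E * C2 + \<bar>B\<bar>) * (1 + \<bar>Im s\<bar>) powr \<epsilon>"
    proof (cases "\<bar>Im s\<bar> \<ge> R + 1")
      case True
      have "norm (deriv g0 s / g0 s) \<le> E * C2 * (1 + \<bar>Im s\<bar>) powr \<epsilon>" by (rule far[OF s True])
      also have "\<dots> \<le> (E * C2 + \<bar>B\<bar>) * (1 + \<bar>Im s\<bar>) powr \<epsilon>" by (intro mult_right_mono) auto
      finally show ?thesis .
    next
      case False
      then have "norm (deriv g0 s / g0 s) \<le> B" using s by (intro B) (auto simp: Bx_def in_cbox_complex_iff)
      also have "\<dots> \<le> (E * C2 + \<bar>B\<bar>) * 1" using E C2 by (simp add: add_increasing)
      also have "\<dots> \<le> (E * C2 + \<bar>B\<bar>) * (1 + \<bar>Im s\<bar>) powr \<epsilon>" using E C2 1 by (intro mult_left_mono) auto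
      finally show ?thesis .
    qed
  qed
qed

section \<open>A Plancherel inequality for Laplace transforms\<close>

lemma integrable_lborel_pair_mult:
  fixes f g :: "real \<Rightarrow> real"
  assumes "integrable lborel f" "integrable lborel g"
  shows "integrable (lborel \<Otimes>\<^sub>M lborel) (\<lambda>(x, y). f x * g y)"
proof (rule lborel_pair.Fubini_integrable)
  have [measurable]: "f \<in> borel_measurable borel" "g \<in> borel_measurable borel"
    using assms borel_measurable_integrable by force+
  show "(\<lambda>(x, y). f x * g y) \<in> borel_measurable (lborel \<Otimes>\<^sub>M lborel)" by measurable
  have "(\<lambda>x. \<integral>y. norm (case (x, y) of (x, y) \<Rightarrow> f x * g y) \<partial>lborel) = (\<lambda>x. \<bar>f x\<bar> * (\<integral>y. \<bar>g y\<bar> \<partial>lborel))"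
    by (simp add: abs_mult)
  then show "integrable lborel (\<lambda>x. \<integral>y. norm (case (x, y) of (x, y) \<Rightarrow> f x * g y) \<partial>lborel)"
    using assms by (simp add: integrable_abs)
  show "AE x in lborel. integrable lborel (\<lambda>y. case (x, y) of (x, y) \<Rightarrow> f x * g y)"
    using assms by auto
qed

lemma integrable_lborel_pair_bound:
  fixes h :: "real \<Rightarrow> real \<Rightarrow> complex"
  assumes [measurable]: "case_prod h \<in> borel_measurable (borel \<Otimes>\<^sub>M borel)"
    and f: "integrable lborel f" "integrable lborel g"
    and le: "\<And>x y. norm (h x y) \<le> f x * g y"
  shows "integrable (lborel \<Otimes>\<^sub>M lborel) (case_prod h)"
proof (rule Bochner_Integration.integrable_bound[OF integrable_lborel_pair_mult[OF f]])
  show "case_prod h \<in> borel_measurable (lborel \<Otimes>\<^sub>M lborel)" by measurable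
  show "AE x in lborel \<Otimes>\<^sub>M lborel. norm (case_prod h x) \<le> norm (case x of (x, y) \<Rightarrow> f x * g y)"
    by (rule AE_I2) (use le in \<open>auto intro: order_trans[OF _ abs_ge_self]\<close>)
qed

lemma borel_measurable_lborel_integral_param:
  fixes f :: "real \<Rightarrow> real \<Rightarrow> complex"
  assumes "case_prod f \<in> borel_measurable (borel \<Otimes>\<^sub>M borel)"
  shows "(\<lambda>x. \<integral>y. f x y \<partial>lborel) \<in> borel_measurable borel"
proof (rule lborel.borel_measurable_lebesgue_integral)
  have "borel_measurable (borel \<Otimes>\<^sub>M lborel) = (borel_measurable (borel \<Otimes>\<^sub>M borel) :: (real \<times> real \<Rightarrow> complex) set)"
    by (intro measurable_cong_sets sets_pair_measure_cong) auto
  then show "case_prod f \<in> borel_measurable (borel \<Otimes>\<^sub>M lborel)" using assms by simp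
qed

section \<open>Gaussian Fourier analysis on the real line\<close>

lemma normal_density_0: "\<kappa> > 0 \<Longrightarrow> normal_density 0 \<kappa> y = exp (- y\<^sup>2 / (2 * \<kappa>\<^sup>2)) / (sqrt (2 * pi) * \<kappa>)"
  by (simp add: normal_density_def real_sqrt_mult)

lemma gaussian_integrable:
  assumes "\<kappa> > 0"
  shows "integrable lborel (\<lambda>t. exp (- (\<kappa> * t)\<^sup>2 / 2) :: real)"
proof -
  have "integrable lborel (\<lambda>x. sqrt (2 * pi) * std_normal_density (0 + \<kappa> * x))"
    by (intro integrable_mult_right lborel_integrable_real_affine integrable_normal_density) (use assms in auto)
  then show ?thesis by (simp add: normal_density_def)
qed

text \<open>The characteristic function of the standard normal law, rescaled. The value is written
  as a normal density because its total mass 1 is what the quadratic form argument uses.\<close>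

lemma gaussian_fourier:
  assumes \<kappa>: "\<kappa> > 0"
  shows "(\<integral>t. iexp (y * t) * of_real (exp (- (\<kappa> * t)\<^sup>2 / 2)) \<partial>lborel) = of_real (2 * pi * normal_density 0 \<kappa> y)"
proof -
  define f where "f = (\<lambda>x. iexp ((y / \<kappa>) * x) * of_real (exp (- x\<^sup>2 / 2)))"
  have "char std_normal_distribution (y / \<kappa>) = (\<integral>x. std_normal_density x *\<^sub>R iexp ((y / \<kappa>) * x) \<partial>lborel)"
    unfolding char_def by (subst integral_density) auto
  also have "\<dots> = (\<integral>x. of_real (1 / sqrt (2 * pi)) * f x \<partial>lborel)"
    by (intro Bochner_Integration.integral_cong) (auto simp: f_def std_normal_density_def scaleR_conv_of_real)
  also have "\<dots> = of_real (1 / sqrt (2 * pi)) * (\<integral>x. f x \<partial>lborel)"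
    by simp
  finally have "(\<integral>x. f x \<partial>lborel) = of_real (sqrt (2 * pi) * exp (- (y / \<kappa>)\<^sup>2 / 2))"
    by (simp add: char_std_normal_distribution field_simps)
  moreover have "(\<integral>x. f x \<partial>lborel) = \<bar>\<kappa>\<bar> *\<^sub>R (\<integral>x. f (0 + \<kappa> * x) \<partial>lborel)"
    by (rule lborel_integral_real_affine) (use \<kappa> in auto)
  ultimately have "of_real \<kappa> * (\<integral>x. f (\<kappa> * x) \<partial>lborel) = of_real (sqrt (2 * pi) * exp (- (y / \<kappa>)\<^sup>2 / 2))"
    using \<kappa> by (simp add: scaleR_conv_of_real)
  then have "(\<integral>x. f (\<kappa> * x) \<partial>lborel) = of_real (sqrt (2 * pi) * exp (- (y / \<kappa>)\<^sup>2 / 2) / \<kappa>)"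
    using \<kappa> by (simp add: field_simps)
  also have "sqrt (2 * pi) * exp (- (y / \<kappa>)\<^sup>2 / 2) / \<kappa> = 2 * pi * normal_density 0 \<kappa> y"
  proof -
    have "2 * pi * (e / (q * \<kappa>)) = q * e / \<kappa>" if "q * q = 2 * pi" "q > 0" for e q
      using that \<kappa> by (subst that(1)[symmetric]) (simp add: field_simps)
    from this[of "sqrt (2 * pi)"] show ?thesis using \<kappa> by (simp add: normal_density_0 power_divide)
  qed
  also have "(\<lambda>x. f (\<kappa> * x)) = (\<lambda>t. iexp (y * t) * of_real (exp (- (\<kappa> * t)\<^sup>2 / 2)))"
    using \<kappa> by (simp add: f_def fun_eq_iff)
  finally show ?thesis .
qed

text \<open>With a Gaussian weight, expanding the square leaves a quadratic form whose kernel is a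
  probability density in \<open>t - t'\<close>.\<close>
lemma fourier_weighted_L2_bound:
  fixes a :: "real \<Rightarrow> complex"
  assumes a: "integrable lborel a" and a2: "integrable lborel (\<lambda>t. (norm (a t))\<^sup>2)" and \<tau>: "\<tau> > 0"
  shows "(\<integral>\<^sup>+u. ennreal ((norm (\<integral>t. a t * iexp (u * t) \<partial>lborel))\<^sup>2 * exp (- (\<tau> * u)\<^sup>2 / 2)) \<partial>lborel)
      \<le> ennreal (2 * pi * (\<integral>t. (norm (a t))\<^sup>2 \<partial>lborel))"
proof -
  have [measurable]: "a \<in> borel_measurable borel" using a borel_measurable_integrable by force
  define A where "A = (\<lambda>u. \<integral>t. a t * iexp (u * t) \<partial>lborel)"
  define w where "w = (\<lambda>u. exp (- (\<tau> * u)\<^sup>2 / 2) :: real)"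
  define I where "I = (\<integral>t. norm (a t) \<partial>lborel)"
  have [measurable]: "w \<in> borel_measurable borel" unfolding w_def by measurable
  have [measurable]: "A \<in> borel_measurable borel"
    unfolding A_def by (rule borel_measurable_lborel_integral_param) measurable
  have [measurable]: "(\<lambda>x. cnj (a x)) \<in> borel_measurable borel"
    by (rule measurable_compose[OF \<open>a \<in> borel_measurable borel\<close>]) (intro borel_measurable_continuous_onI continuous_intros)
  have wi: "integrable lborel w" unfolding w_def by (rule gaussian_integrable[OF \<tau>])
  have w0: "w u \<ge> 0" for u by (simp add: w_def)
  have int_t: "integrable lborel (\<lambda>t. a t * iexp (u * t))" for u
    by (rule Bochner_Integration.integrable_bound[OF a]) (auto simp: norm_mult)
  have AI: "norm (A u) \<le> I" for u
  proof -
    have "norm (A u) \<le> (\<integral>t. norm (a t * iexp (u * t)) \<partial>lborel)" unfolding A_def by simp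
    then show ?thesis by (simp add: norm_mult I_def)
  qed
  have na: "integrable lborel (\<lambda>t. norm (a t))" using a by simp
  define N where "N = (\<lambda>t t'. normal_density 0 \<tau> (t - t'))"
  have N0: "N t t' \<ge> 0" for t t' unfolding N_def by (rule normal_density_nonneg)
  have Nsym: "N t t' = N t' t" for t t' unfolding N_def normal_density_def by (simp add: power2_commute)
  have [measurable]: "case_prod N \<in> borel_measurable (borel \<Otimes>\<^sub>M borel)" unfolding N_def by measurable
  \<comment> \<open>Integrating over \<open>u\<close> first turns the Gaussian weight into the
    kernel \<open>2 * pi * N t t'\<close>.\<close>
  have inner: "(\<integral>u. of_real (w u) * A u * iexp (- (u * t')) \<partial>lborel) = (\<integral>t. a t * of_real (2 * pi * N t t') \<partial>lborel)" for t'
  proof -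
    have "(\<integral>u. of_real (w u) * A u * iexp (- (u * t')) \<partial>lborel) =
      (\<integral>u. \<integral>t. of_real (w u) * iexp (- (u * t')) * (a t * iexp (u * t)) \<partial>lborel \<partial>lborel)"
    proof (intro Bochner_Integration.integral_cong refl)
      fix u
      have "of_real (w u) * A u * iexp (- (u * t')) = (of_real (w u) * iexp (- (u * t'))) * A u"
        by (simp only: mult_ac)
      then show "of_real (w u) * A u * iexp (- (u * t')) = (\<integral>t. of_real (w u) * iexp (- (u * t')) * (a t * iexp (u * t)) \<partial>lborel)"
        unfolding A_def by (simp only: integral_mult_right_zero)
    qed
    also have "\<dots> = (\<integral>t. \<integral>u. of_real (w u) * iexp (- (u * t')) * (a t * iexp (u * t)) \<partial>lborel \<partial>lborel)"
      by (rule lborel_pair.Fubini_integral[symmetric], rule integrable_lborel_pair_bound[OF _ wi na])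
         (auto simp: norm_mult w0)
    also have "\<dots> = (\<integral>t. a t * of_real (2 * pi * N t t') \<partial>lborel)"
    proof (intro Bochner_Integration.integral_cong refl)
      fix t
      have "(\<integral>u. of_real (w u) * iexp (- (u * t')) * (a t * iexp (u * t)) \<partial>lborel) =
        (\<integral>u. a t * (iexp ((t - t') * u) * of_real (exp (- (\<tau> * u)\<^sup>2 / 2))) \<partial>lborel)"
      proof (intro Bochner_Integration.integral_cong refl)
        fix u
        have "iexp (- (u * t')) * iexp (u * t) = iexp ((t - t') * u)"
          by (simp add: exp_add[symmetric] algebra_simps)
        moreover have "of_real (w u) * iexp (- (u * t')) * (a t * iexp (u * t)) =
           a t * ((iexp (- (u * t')) * iexp (u * t)) * of_real (w u))"
          by (simp only: mult_ac)
        ultimately show "of_real (w u) * iexp (- (u * t')) * (a t * iexp (u * t)) =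
           a t * (iexp ((t - t') * u) * of_real (exp (- (\<tau> * u)\<^sup>2 / 2)))"
          by (simp only: w_def)
      qed
      also have "\<dots> = a t * of_real (2 * pi * N t t')"
        unfolding N_def by (subst gaussian_fourier[OF \<tau>, symmetric]) simp
      finally show "(\<integral>u. of_real (w u) * iexp (- (u * t')) * (a t * iexp (u * t)) \<partial>lborel) = a t * of_real (2 * pi * N t t')" .
    qed
    finally show ?thesis .
  qed
  have wA: "integrable lborel (\<lambda>u. w u * I)" using wi by simp
  have eq: "(\<integral>u. of_real ((norm (A u))\<^sup>2 * w u) \<partial>lborel) = (\<integral>t'. cnj (a t') * (\<integral>t. a t * of_real (2 * pi * N t t') \<partial>lborel) \<partial>lborel)"
  proof -
    have cnjA: "cnj (A u) = (\<integral>t'. cnj (a t') * iexp (- (u * t')) \<partial>lborel)" for u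
    proof -
      have "cnj (A u) = (\<integral>t'. cnj (a t' * iexp (u * t')) \<partial>lborel)"
        unfolding A_def by (rule integral_bounded_linear[OF bounded_linear_cnj int_t, symmetric])
      also have "(\<lambda>t'. cnj (a t' * iexp (u * t'))) = (\<lambda>t'. cnj (a t') * iexp (- (u * t')))"
        by (simp add: fun_eq_iff exp_cnj)
      finally show ?thesis .
    qed
    have int_t': "integrable lborel (\<lambda>t. cnj (a t) * iexp (- (u * t)))" for u
      by (rule Bochner_Integration.integrable_bound[OF a]) (auto simp: norm_mult)
    have "(\<integral>u. of_real ((norm (A u))\<^sup>2 * w u) \<partial>lborel) =
      (\<integral>u. \<integral>t'. of_real (w u) * A u * (cnj (a t') * iexp (- (u * t'))) \<partial>lborel \<partial>lborel)"
    proof (intro Bochner_Integration.integral_cong refl)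
      fix u
      have "of_real ((norm (A u))\<^sup>2 * w u) = of_real (w u) * A u * cnj (A u)"
        using complex_norm_square[of "A u"] by (simp add: mult_ac)
      then show "of_real ((norm (A u))\<^sup>2 * w u) = (\<integral>t'. of_real (w u) * A u * (cnj (a t') * iexp (- (u * t'))) \<partial>lborel)"
        using int_t'[of u] by (simp add: cnjA)
    qed
    also have "\<dots> = (\<integral>t'. \<integral>u. of_real (w u) * A u * (cnj (a t') * iexp (- (u * t'))) \<partial>lborel \<partial>lborel)"
      by (rule lborel_pair.Fubini_integral[symmetric], rule integrable_lborel_pair_bound[OF _ wA na])
         (auto simp: norm_mult w0 intro!: mult_right_mono mult_left_mono AI)
    also have "\<dots> = (\<integral>t'. cnj (a t') * (\<integral>u. of_real (w u) * A u * iexp (- (u * t')) \<partial>lborel) \<partial>lborel)"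
    proof (intro Bochner_Integration.integral_cong refl)
      fix t'
      have "(\<lambda>u. of_real (w u) * A u * (cnj (a t') * iexp (- (u * t')))) =
        (\<lambda>u. cnj (a t') * (of_real (w u) * A u * iexp (- (u * t'))))" by (simp add: fun_eq_iff mult_ac)
      then show "(\<integral>u. of_real (w u) * A u * (cnj (a t') * iexp (- (u * t'))) \<partial>lborel) =
        cnj (a t') * (\<integral>u. of_real (w u) * A u * iexp (- (u * t')) \<partial>lborel)" by simp
    qed
    finally show ?thesis by (simp only: inner)
  qed
  have norm_conv: "(\<integral>\<^sup>+t'. ennreal (N t t') \<partial>lborel) = 1" for t
  proof -
    have "(\<integral>\<^sup>+t'. ennreal (N t t') \<partial>lborel) = (\<integral>\<^sup>+x. ennreal (normal_density 0 \<tau> x) \<partial>lborel)"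
      by (subst (2) nn_integral_real_affine[where c = "-1" and t = t]) (auto simp: N_def)
    also have "\<dots> = ennreal (\<integral>x. normal_density 0 \<tau> x \<partial>lborel)"
      using \<tau> by (intro nn_integral_eq_integral) auto
    finally show ?thesis using \<tau> by simp
  qed
  let ?J = "\<integral>\<^sup>+t. ennreal ((norm (a t))\<^sup>2) \<partial>lborel"
  have J: "?J = ennreal (\<integral>t. (norm (a t))\<^sup>2 \<partial>lborel)"
    by (rule nn_integral_eq_integral[OF a2]) auto
  \<comment> \<open>Schur's test: after \<open>|a(t) a(t')|\<close> is bounded by half the sum of
    the two squares, each summand involves \<open>a\<close> in one variable only, and
    \<open>N\<close> has mass 1 in the other.\<close>
  have half: "(\<integral>\<^sup>+t'. \<integral>\<^sup>+t. ennreal ((norm (a t'))\<^sup>2 / 2 * N t t') \<partial>lborel \<partial>lborel) = ?J / 2"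
  proof -
    have "(\<integral>\<^sup>+t. ennreal ((norm (a t'))\<^sup>2 / 2 * N t t') \<partial>lborel) = ennreal ((norm (a t'))\<^sup>2 / 2)" for t'
    proof -
      have "(\<integral>\<^sup>+t. ennreal ((norm (a t'))\<^sup>2 / 2 * N t t') \<partial>lborel) = (\<integral>\<^sup>+t. ennreal ((norm (a t'))\<^sup>2 / 2) * ennreal (N t' t) \<partial>lborel)"
      proof (intro nn_integral_cong)
        fix t show "ennreal ((norm (a t'))\<^sup>2 / 2 * N t t') = ennreal ((norm (a t'))\<^sup>2 / 2) * ennreal (N t' t)"
          unfolding Nsym[of t t'] by (rule ennreal_mult) (auto simp: N0)
      qed
      also have "\<dots> = ennreal ((norm (a t'))\<^sup>2 / 2) * (\<integral>\<^sup>+t. ennreal (N t' t) \<partial>lborel)"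
        by (intro nn_integral_cmult) (simp add: N_def)
      finally show ?thesis by (simp add: norm_conv)
    qed
    then have "(\<integral>\<^sup>+t'. \<integral>\<^sup>+t. ennreal ((norm (a t'))\<^sup>2 / 2 * N t t') \<partial>lborel \<partial>lborel) = (\<integral>\<^sup>+t'. ennreal ((norm (a t'))\<^sup>2) / 2 \<partial>lborel)"
      by (simp add: ennreal_divide_numeral)
    then show ?thesis by (simp add: nn_integral_divide)
  qed
  have half': "(\<integral>\<^sup>+t'. \<integral>\<^sup>+t. ennreal ((norm (a t))\<^sup>2 / 2 * N t t') \<partial>lborel \<partial>lborel) = ?J / 2"
  proof -
    have "(\<integral>\<^sup>+t'. \<integral>\<^sup>+t. ennreal ((norm (a t))\<^sup>2 / 2 * N t t') \<partial>lborel \<partial>lborel) = (\<integral>\<^sup>+t. \<integral>\<^sup>+t'. ennreal ((norm (a t))\<^sup>2 / 2 * N t t') \<partial>lborel \<partial>lborel)"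
      unfolding N_def by (rule lborel_pair.Fubini') measurable
    also have "\<dots> = (\<integral>\<^sup>+t. \<integral>\<^sup>+t'. ennreal ((norm (a t))\<^sup>2 / 2 * N t' t) \<partial>lborel \<partial>lborel)" by (simp only: Nsym)
    finally show ?thesis by (simp only: half)
  qed
  have "(\<integral>\<^sup>+u. ennreal ((norm (A u))\<^sup>2 * w u) \<partial>lborel) = ennreal (\<integral>u. (norm (A u))\<^sup>2 * w u \<partial>lborel)"
  proof (rule nn_integral_eq_integral)
    have "integrable lborel (\<lambda>u. I\<^sup>2 * w u)" using wi by simp
    then show "integrable lborel (\<lambda>u. (norm (A u))\<^sup>2 * w u)"
    proof (rule Bochner_Integration.integrable_bound)
      have n: "norm (y * w u) = y * w u" if "y \<ge> 0" for y u using that w0 by (simp add: abs_mult)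
      have le: "(norm (A u))\<^sup>2 * w u \<le> I\<^sup>2 * w u" for u by (intro mult_right_mono power_mono AI) (auto simp: w0)
      show "AE u in lborel. norm ((norm (A u))\<^sup>2 * w u) \<le> norm (I\<^sup>2 * w u)"
        by (simp only: n zero_le_power2 le) simp
    qed measurable
  qed (simp add: w0)
  also have "\<dots> \<le> ennreal (norm (\<integral>u. complex_of_real ((norm (A u))\<^sup>2 * w u) \<partial>lborel))"
    by (intro ennreal_leI) (simp only: integral_complex_of_real norm_of_real abs_ge_self)
  also have "\<dots> \<le> (\<integral>\<^sup>+t'. ennreal (norm (cnj (a t') * (\<integral>t. a t * of_real (2 * pi * N t t') \<partial>lborel))) \<partial>lborel)"
    unfolding eq
  proof (rule integral_norm_bound_ennreal)
    obtain B where B: "\<And>t t'. N t t' \<le> B"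
      using \<tau> by (auto simp: N_def normal_density_0 intro!: that[of "1 / (sqrt (2 * pi) * \<tau>)"] divide_right_mono)
    have "integrable lborel (\<lambda>t'. norm (a t') * (2 * pi * B * I))" using na by simp
    then show "integrable lborel (\<lambda>t'. cnj (a t') * (\<integral>t. a t * of_real (2 * pi * N t t') \<partial>lborel))"
    proof (rule Bochner_Integration.integrable_bound)
      show "(\<lambda>t'. cnj (a t') * (\<integral>t. a t * of_real (2 * pi * N t t') \<partial>lborel)) \<in> borel_measurable lborel"
        unfolding N_def measurable_lborel2 by (intro borel_measurable_times borel_measurable_lborel_integral_param) measurable
      have le: "norm (\<integral>t. a t * of_real (2 * pi * N t t') \<partial>lborel) \<le> 2 * pi * B * I" for t'
      proof -
        have "norm (\<integral>t. a t * of_real (2 * pi * N t t') \<partial>lborel) \<le> (\<integral>t. norm (a t) * (2 * pi * B) \<partial>lborel)"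
        proof -
          have ptw: "norm (a t * of_real (2 * pi * N t t')) \<le> norm (a t) * (2 * pi * B)" for t
            unfolding norm_mult norm_of_real using N0[of t t'] B[of t t'] by (intro mult_left_mono) (auto simp: abs_mult)
          have i2: "integrable lborel (\<lambda>t. norm (a t) * (2 * pi * B))" using na by simp
          have "integrable lborel (\<lambda>t. a t * of_real (2 * pi * N t t'))"
            by (rule Bochner_Integration.integrable_bound[OF i2])
               (use ptw in \<open>auto simp: N_def intro: order_trans[OF _ abs_ge_self]\<close>)
          then have "(\<integral>t. norm (a t * of_real (2 * pi * N t t')) \<partial>lborel) \<le> (\<integral>t. norm (a t) * (2 * pi * B) \<partial>lborel)"
            using i2 ptw by (intro integral_mono integrable_norm) auto
          then show ?thesis by (rule order_trans[OF integral_norm_bound])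
        qed
        then show ?thesis by (simp add: I_def mult_ac)
      qed
      show "AE t' in lborel. norm (cnj (a t') * (\<integral>t. a t * of_real (2 * pi * N t t') \<partial>lborel)) \<le> norm (norm (a t') * (2 * pi * B * I))"
      proof (rule AE_I2)
        fix t'
        have "norm (cnj (a t') * (\<integral>t. a t * of_real (2 * pi * N t t') \<partial>lborel)) \<le> norm (a t') * (2 * pi * B * I)"
          unfolding norm_mult complex_mod_cnj by (rule mult_left_mono[OF le]) simp
        then show "norm (cnj (a t') * (\<integral>t. a t * of_real (2 * pi * N t t') \<partial>lborel)) \<le> norm (norm (a t') * (2 * pi * B * I))"
          unfolding real_norm_def by (rule order_trans[OF _ abs_ge_self])
      qed
    qed
  qed
  also have "\<dots> \<le> (\<integral>\<^sup>+t'. \<integral>\<^sup>+t. ennreal (2 * pi) * (ennreal ((norm (a t'))\<^sup>2 / 2 * N t t') + ennreal ((norm (a t))\<^sup>2 / 2 * N t t')) \<partial>lborel \<partial>lborel)"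
  proof (intro nn_integral_mono)
    fix t'
    have "ennreal (norm (cnj (a t') * (\<integral>t. a t * of_real (2 * pi * N t t') \<partial>lborel))) =
       ennreal (norm (\<integral>t. cnj (a t') * (a t * of_real (2 * pi * N t t')) \<partial>lborel))" by simp
    also have "\<dots> \<le> (\<integral>\<^sup>+t. ennreal (norm (cnj (a t') * (a t * of_real (2 * pi * N t t')))) \<partial>lborel)"
    proof (cases "integrable lborel (\<lambda>t. cnj (a t') * (a t * of_real (2 * pi * N t t')))")
      case True then show ?thesis by (rule integral_norm_bound_ennreal)
    next
      \<comment> \<open>A Bochner integral that does not exist is 0 by definition.\<close>
      case False then show ?thesis by (subst not_integrable_integral_eq) simp_all
    qed
    also have "\<dots> \<le> (\<integral>\<^sup>+t. ennreal (2 * pi) * (ennreal ((norm (a t'))\<^sup>2 / 2 * N t t') + ennreal ((norm (a t))\<^sup>2 / 2 * N t t')) \<partial>lborel)"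
    proof (intro nn_integral_mono)
      fix t
      have "norm (a t') * norm (a t) \<le> (norm (a t'))\<^sup>2 / 2 + (norm (a t))\<^sup>2 / 2"
        using sum_squares_bound[of "norm (a t')" "norm (a t)"] by simp
      then have "norm (a t') * norm (a t) * N t t' \<le> ((norm (a t'))\<^sup>2 / 2 + (norm (a t))\<^sup>2 / 2) * N t t'"
        by (rule mult_right_mono[OF _ N0])
      then have "2 * pi * (norm (a t') * norm (a t) * N t t') \<le> 2 * pi * ((norm (a t'))\<^sup>2 / 2 * N t t' + (norm (a t))\<^sup>2 / 2 * N t t')"
        by (intro mult_left_mono) (auto simp: distrib_right)
      moreover have "norm (cnj (a t') * (a t * of_real (2 * pi * N t t'))) = 2 * pi * (norm (a t') * norm (a t) * N t t')"
        using N0[of t t'] by (simp add: norm_mult)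
      ultimately show "ennreal (norm (cnj (a t') * (a t * of_real (2 * pi * N t t')))) \<le>
         ennreal (2 * pi) * (ennreal ((norm (a t'))\<^sup>2 / 2 * N t t') + ennreal ((norm (a t))\<^sup>2 / 2 * N t t'))"
        using N0[of t t'] by (simp add: ennreal_plus[symmetric] ennreal_mult[symmetric] ennreal_leI del: ennreal_plus)
    qed
    finally show "ennreal (norm (cnj (a t') * (\<integral>t. a t * of_real (2 * pi * N t t') \<partial>lborel))) \<le> \<dots>" .
  qed
  also have "\<dots> = ennreal (2 * pi) * (?J / 2 + ?J / 2)"
  proof -
    let ?f = "\<lambda>t' t. ennreal ((norm (a t'))\<^sup>2 / 2 * N t t')" and ?g = "\<lambda>t' t. ennreal ((norm (a t))\<^sup>2 / 2 * N t t')"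
    have inner_meas: "?f t' \<in> borel_measurable lborel" "?g t' \<in> borel_measurable lborel" for t'
      unfolding N_def by measurable
    have outer_meas: "(\<lambda>t'. \<integral>\<^sup>+t. ?f t' t \<partial>lborel) \<in> borel_measurable lborel" "(\<lambda>t'. \<integral>\<^sup>+t. ?g t' t \<partial>lborel) \<in> borel_measurable lborel"
      unfolding N_def by measurable
    have "(\<integral>\<^sup>+t'. \<integral>\<^sup>+t. ennreal (2 * pi) * (?f t' t + ?g t' t) \<partial>lborel \<partial>lborel) =
       (\<integral>\<^sup>+t'. ennreal (2 * pi) * ((\<integral>\<^sup>+t. ?f t' t \<partial>lborel) + (\<integral>\<^sup>+t. ?g t' t \<partial>lborel)) \<partial>lborel)"
      using inner_meas by (intro nn_integral_cong) (simp add: nn_integral_cmult nn_integral_add)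
    also have "\<dots> = ennreal (2 * pi) * ((\<integral>\<^sup>+t'. \<integral>\<^sup>+t. ?f t' t \<partial>lborel \<partial>lborel) + (\<integral>\<^sup>+t'. \<integral>\<^sup>+t. ?g t' t \<partial>lborel \<partial>lborel))"
      using outer_meas by (simp add: nn_integral_cmult nn_integral_add)
    finally show ?thesis by (simp only: half half')
  qed
  also have "\<dots> = ennreal (2 * pi) * ennreal (\<integral>t. (norm (a t))\<^sup>2 \<partial>lborel)"
    by (simp add: J ennreal_divide_numeral ennreal_plus[symmetric] integral_nonneg_AE del: ennreal_plus)
  also have "\<dots> = ennreal (2 * pi * (\<integral>t. (norm (a t))\<^sup>2 \<partial>lborel))"
    by (simp add: ennreal_mult)
  finally show ?thesis unfolding A_def w_def .
qed

lemma integrable_inverse_one_plus_square: "integrable lborel (\<lambda>x::real. inverse (1 + x\<^sup>2))"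
  using integrable_inverse_1_plus_square by (simp add: set_integrable_def)

text \<open>The decay gives convergent vertical integrals and horizontal sides that vanish in the
  limit. Cauchy's theorem enters through a primitive \<open>P\<close> on the convex half-plane: a
  truncated vertical integral is a difference of values of \<open>P\<close>, and the two truncations
  differ by increments of \<open>P\<close> along the horizontal sides.\<close>

lemma vertical_line_shift:
  fixes \<Phi> :: "complex \<Rightarrow> complex"
  assumes hol: "\<Phi> holomorphic_on {s. Re s > c0}" and c: "c0 < \<sigma>" "\<sigma> \<le> c"
    and bound: "\<And>s. \<sigma> \<le> Re s \<Longrightarrow> Re s \<le> c \<Longrightarrow> norm (\<Phi> s) \<le> K * inverse (1 + (Im s)\<^sup>2)"
  shows "(\<integral>t. \<Phi> (Complex \<sigma> t) \<partial>lborel) = (\<integral>t. \<Phi> (Complex c t) \<partial>lborel)"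
proof -
  define U where "U = {s. Re s > c0}"
  have U: "open U" "convex U" unfolding U_def by (auto intro: open_halfspace_Re_gt convex_halfspace_Re_gt)
  obtain P where P: "\<And>s. s \<in> U \<Longrightarrow> (P has_field_derivative \<Phi> s) (at s)"
  proof -
    obtain P where *: "\<And>s. s \<in> U \<Longrightarrow> (P has_field_derivative \<Phi> s) (at s within U)"
      using holomorphic_convex_primitive'[OF U(2) U(1) hol[folded U_def]] by blast
    show ?thesis
    proof (rule that)
      fix s assume "s \<in> U"
      then show "(P has_field_derivative \<Phi> s) (at s)" using *[of s] at_within_open[OF _ U(1), of s] by simp
    qed
  qed
  have int: "integrable lborel (\<lambda>t. \<Phi> (Complex x t))" if "\<sigma> \<le> x" "x \<le> c" for x
  proof (rule Bochner_Integration.integrable_bound)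
    show "integrable lborel (\<lambda>t::real. K * inverse (1 + t\<^sup>2))" using integrable_inverse_one_plus_square by simp
    have "continuous_on UNIV (\<lambda>t. \<Phi> (Complex x t))"
      using that c by (intro continuous_on_compose2[OF holomorphic_on_imp_continuous_on[OF hol]]) (auto intro!: continuous_intros simp: Complex_eq)
    then show "(\<lambda>t. \<Phi> (Complex x t)) \<in> borel_measurable lborel" by (simp add: borel_measurable_continuous_onI)
    show "AE t in lborel. norm (\<Phi> (Complex x t)) \<le> norm (K * inverse (1 + t\<^sup>2))"
      by (rule AE_I2) (use bound[of "Complex x _"] that in \<open>auto intro: order_trans[OF _ abs_ge_self]\<close>)
  qed
  define L where "L = (\<lambda>x T. \<integral>t\<in>{-T..T}. \<Phi> (Complex x t) \<partial>lborel)"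
  have lim: "((L x) \<longlongrightarrow> (\<integral>t. \<Phi> (Complex x t) \<partial>lborel)) at_top" if "\<sigma> \<le> x" "x \<le> c" for x
    unfolding L_def set_lebesgue_integral_def
  proof (rule integral_dominated_convergence_at_top)
    show "integrable lborel (\<lambda>t. norm (\<Phi> (Complex x t)))" using int[OF that] by simp
    show "\<And>T. (\<lambda>t. indicat_real {-T..T} t *\<^sub>R \<Phi> (Complex x t)) \<in> borel_measurable lborel"
      "(\<lambda>t. \<Phi> (Complex x t)) \<in> borel_measurable lborel"
      using borel_measurable_integrable[OF int[OF that]] by auto
    show "\<forall>\<^sub>F T in at_top. AE t in lborel. norm (indicat_real {-T..T} t *\<^sub>R \<Phi> (Complex x t)) \<le> norm (\<Phi> (Complex x t))"
      by (intro always_eventually allI AE_I2) (simp add: indicator_def)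
    show "AE t in lborel. ((\<lambda>T. indicat_real {-T..T} t *\<^sub>R \<Phi> (Complex x t)) \<longlongrightarrow> \<Phi> (Complex x t)) at_top"
    proof (rule AE_I2)
      fix t :: real
      have "eventually (\<lambda>T. indicat_real {-T..T} t *\<^sub>R \<Phi> (Complex x t) = \<Phi> (Complex x t)) at_top"
        by (rule eventually_mono[OF eventually_ge_at_top[of "\<bar>t\<bar>"]]) (auto simp: indicator_def)
      then show "((\<lambda>T. indicat_real {-T..T} t *\<^sub>R \<Phi> (Complex x t)) \<longlongrightarrow> \<Phi> (Complex x t)) at_top"
        by (rule tendsto_eventually)
    qed
  qed
  have FTC: "L x T = (P (Complex x T) - P (Complex x (-T))) / \<i>" if "\<sigma> \<le> x" "x \<le> c" "T \<ge> 0" for x T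
  proof -
    have "L x T = (P (Complex x T) / \<i>) - (P (Complex x (-T)) / \<i>)"
      unfolding L_def set_lebesgue_integral_def
    proof (rule integral_FTC_Icc)
      show "- T \<le> T" using that by simp
      show "continuous_on {-T..T} (\<lambda>t. \<Phi> (Complex x t))"
        using that c by (intro continuous_on_compose2[OF holomorphic_on_imp_continuous_on[OF hol]]) (auto intro!: continuous_intros simp: Complex_eq)
      fix t
      have "((\<lambda>t. P (Complex x t)) has_vector_derivative \<i> * \<Phi> (Complex x t)) (at t)"
      proof -
        have "((\<lambda>t. Complex x t) has_vector_derivative \<i>) (at t)"
          unfolding Complex_eq by (auto intro!: derivative_eq_intros)
        moreover have "(P has_field_derivative \<Phi> (Complex x t)) (at (Complex x t))"
          using that c by (intro P) (auto simp: U_def)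
        ultimately show ?thesis using field_vector_diff_chain_at by (fastforce simp: o_def)
      qed
      then have "((\<lambda>t. P (Complex x t) / \<i>) has_vector_derivative (\<i> * \<Phi> (Complex x t)) / \<i>) (at t)"
        by (rule has_vector_derivative_divide)
      then show "((\<lambda>t. P (Complex x t) / \<i>) has_vector_derivative \<Phi> (Complex x t)) (at t within {-T..T})"
        by (simp add: has_vector_derivative_at_within)
    qed
    then show ?thesis by (simp only: diff_divide_distrib)
  qed
  have hor: "norm (P (Complex c t) - P (Complex \<sigma> t)) \<le> K * inverse (1 + t\<^sup>2) * (c - \<sigma>)" for t
  proof -
    define S where "S = closed_segment (Complex \<sigma> t) (Complex c t)"
    have S: "Im s = t" "\<sigma> \<le> Re s" "Re s \<le> c" if "s \<in> S" for s
    proof -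
      from that obtain u where u: "0 \<le> u" "u \<le> 1" "s = (1 - u) *\<^sub>R Complex \<sigma> t + u *\<^sub>R Complex c t"
        by (auto simp: S_def in_segment)
      have "Im s = (1 - u) * t + u * t" "Re s = (1 - u) * \<sigma> + u * c" unfolding u(3) by simp_all
      then have "Im s = t" "Re s = \<sigma> + u * (c - \<sigma>)" "Re s = c - (1 - u) * (c - \<sigma>)" by (simp_all add: algebra_simps)
      moreover have "0 \<le> u * (c - \<sigma>)" "0 \<le> (1 - u) * (c - \<sigma>)" using u c by auto
      ultimately show "Im s = t" "\<sigma> \<le> Re s" "Re s \<le> c" by linarith+
    qed
    have cv: "convex S" and mem: "Complex c t \<in> S" "Complex \<sigma> t \<in> S" by (simp_all add: S_def)
    have d: "(P has_field_derivative \<Phi> s) (at s within S)" if s: "s \<in> S" for s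
      using S[OF s] c by (intro has_field_derivative_at_within[OF P]) (auto simp: U_def)
    have b: "norm (\<Phi> s) \<le> K * inverse (1 + t\<^sup>2)" if s: "s \<in> S" for s
      using bound[OF S(2)[OF s] S(3)[OF s]] unfolding S(1)[OF s] .
    have "norm (P (Complex c t) - P (Complex \<sigma> t)) \<le> (K * inverse (1 + t\<^sup>2)) * norm (Complex c t - Complex \<sigma> t)"
      by (rule field_differentiable_bound[where f = P and f' = \<Phi> and S = S, OF cv d b mem])
    moreover have "Complex c t - Complex \<sigma> t = of_real (c - \<sigma>)" by (simp add: complex_eq_iff)
    moreover have "norm (complex_of_real (c - \<sigma>)) = c - \<sigma>" using c by (simp only: norm_of_real)
    ultimately show ?thesis by (simp only:)
  qed
  have "((\<lambda>T. L c T - L \<sigma> T) \<longlongrightarrow> 0) at_top"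
  proof (rule Lim_null_comparison)
    show "eventually (\<lambda>T. norm (L c T - L \<sigma> T) \<le> 2 * (K * inverse (1 + T\<^sup>2) * (c - \<sigma>))) at_top"
    proof (rule eventually_mono[OF eventually_ge_at_top[of 0]])
      fix T :: real assume T: "0 \<le> T"
      have "L c T - L \<sigma> T = ((P (Complex c T) - P (Complex \<sigma> T)) - (P (Complex c (-T)) - P (Complex \<sigma> (-T)))) / \<i>"
        using c T by (simp add: FTC algebra_simps)
      then have "norm (L c T - L \<sigma> T) = norm ((P (Complex c T) - P (Complex \<sigma> T)) - (P (Complex c (-T)) - P (Complex \<sigma> (-T))))"
        by (simp only: norm_divide norm_ii div_by_1)
      also have "\<dots> \<le> norm (P (Complex c T) - P (Complex \<sigma> T)) + norm (P (Complex c (-T)) - P (Complex \<sigma> (-T)))"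
        by (rule norm_triangle_ineq4)
      also have "\<dots> \<le> 2 * (K * inverse (1 + T\<^sup>2) * (c - \<sigma>))" using hor[of T] hor[of "-T"] by simp
      finally show "norm (L c T - L \<sigma> T) \<le> 2 * (K * inverse (1 + T\<^sup>2) * (c - \<sigma>))" .
    qed
    show "((\<lambda>T. 2 * (K * inverse (1 + T\<^sup>2) * (c - \<sigma>))) \<longlongrightarrow> 0) at_top"
      by real_asymp
  qed
  moreover have "((\<lambda>T. L c T - L \<sigma> T) \<longlongrightarrow> (\<integral>t. \<Phi> (Complex c t) \<partial>lborel) - (\<integral>t. \<Phi> (Complex \<sigma> t) \<partial>lborel)) at_top"
    using c by (intro tendsto_diff lim) auto
  ultimately show ?thesis
    using tendsto_unique trivial_limit_at_top_linorder by fastforce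
qed


text \<open>Absolutely convergent Fubini: for fixed \<open>v\<close> the \<open>t\<close>-integral
  of the damped exponential is the normal density at \<open>u - v\<close>. The damping is
  \<open>exp (\<kappa>\<^sup>2 / 2 * s\<^sup>2)\<close>, an entire function of \<open>s\<close>,
  rather than a Gaussian in \<open>t\<close> alone, so that the line of integration can be moved
  afterwards.\<close>

lemma gaussian_smoothing_inversion:
  fixes D :: "real \<Rightarrow> complex"
  assumes D[measurable]: "D \<in> borel_measurable borel"
    and int: "integrable lborel (\<lambda>v. norm (D v) * exp (- c * v))" and \<kappa>: "\<kappa> > 0"
  shows "(\<integral>v. D v * of_real (normal_density 0 \<kappa> (u - v)) \<partial>lborel) =
     (\<integral>t. (\<integral>v. D v * exp (- Complex c t * of_real v) \<partial>lborel) *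
        exp (Complex c t * of_real u + of_real (\<kappa>\<^sup>2 / 2) * (Complex c t)\<^sup>2) \<partial>lborel) / of_real (2 * pi)"
proof -
  define E where "E = (\<lambda>y t. exp (Complex c t * of_real y + of_real (\<kappa>\<^sup>2 / 2) * (Complex c t)\<^sup>2))"
  have E_eq: "E y t = of_real (exp (c * y + \<kappa>\<^sup>2 * c\<^sup>2 / 2)) * (iexp ((y + \<kappa>\<^sup>2 * c) * t) * of_real (exp (- (\<kappa> * t)\<^sup>2 / 2)))" for y t
  proof -
    have "Complex c t * of_real y + of_real (\<kappa>\<^sup>2 / 2) * (Complex c t)\<^sup>2 =
       of_real (c * y + \<kappa>\<^sup>2 * c\<^sup>2 / 2) + (\<i> * of_real ((y + \<kappa>\<^sup>2 * c) * t) + of_real (- (\<kappa> * t)\<^sup>2 / 2))"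
      by (simp add: complex_eq_iff power2_eq_square field_simps)
    then show ?thesis unfolding E_def by (simp only: exp_add exp_of_real)
  qed
  have nE: "norm (E y t) = exp (c * y + \<kappa>\<^sup>2 * c\<^sup>2 / 2) * exp (- (\<kappa> * t)\<^sup>2 / 2)" for y t
    unfolding E_eq norm_mult by simp
  have inner: "(\<integral>t. E y t \<partial>lborel) = of_real (2 * pi * normal_density 0 \<kappa> y)" for y
  proof -
    have "(\<integral>t. E y t \<partial>lborel) = of_real (exp (c * y + \<kappa>\<^sup>2 * c\<^sup>2 / 2)) * of_real (2 * pi * normal_density 0 \<kappa> (y + \<kappa>\<^sup>2 * c))"
      unfolding E_eq by (simp only: integral_mult_right_zero gaussian_fourier[OF \<kappa>])
    also have "\<dots> = of_real (2 * pi * normal_density 0 \<kappa> y)"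
    proof -
      \<comment> \<open>Completing the square: the contribution of the real part \<open>c\<close>
        cancels, so the value does not depend on the line.\<close>
      have "- (y + \<kappa>\<^sup>2 * c)\<^sup>2 / (2 * \<kappa>\<^sup>2) = - y\<^sup>2 / (2 * \<kappa>\<^sup>2) - (c * y + \<kappa>\<^sup>2 * c\<^sup>2 / 2)"
        using \<kappa> by (simp add: field_simps power2_eq_square)
      then have "exp (- (y + \<kappa>\<^sup>2 * c)\<^sup>2 / (2 * \<kappa>\<^sup>2)) = exp (- y\<^sup>2 / (2 * \<kappa>\<^sup>2)) / exp (c * y + \<kappa>\<^sup>2 * c\<^sup>2 / 2)"
        by (simp only: exp_diff)
      then have "exp (c * y + \<kappa>\<^sup>2 * c\<^sup>2 / 2) * (2 * pi * normal_density 0 \<kappa> (y + \<kappa>\<^sup>2 * c)) = 2 * pi * normal_density 0 \<kappa> y"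
        unfolding normal_density_0[OF \<kappa>] by (simp only:) simp
      then show ?thesis by (simp only: of_real_mult[symmetric])
    qed
    finally show ?thesis .
  qed
  have shift: "exp (- Complex c t * of_real v) * E u t = E (u - v) t" for t v
    unfolding E_def by (simp add: exp_add[symmetric] algebra_simps)
  have measE: "(\<lambda>(t, v). D v * E (u - v) t) \<in> borel_measurable (borel \<Otimes>\<^sub>M borel)"
    unfolding E_eq by measurable
  have "(\<integral>t. (\<integral>v. D v * exp (- Complex c t * of_real v) \<partial>lborel) * E u t \<partial>lborel) = (\<integral>t. (\<integral>v. D v * E (u - v) t \<partial>lborel) \<partial>lborel)"
  proof (intro Bochner_Integration.integral_cong refl)
    fix t
    have "(\<integral>v. D v * exp (- Complex c t * of_real v) \<partial>lborel) * E u t = (\<integral>v. D v * exp (- Complex c t * of_real v) * E u t \<partial>lborel)"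
      by (rule integral_mult_left_zero[symmetric])
    then show "(\<integral>v. D v * exp (- Complex c t * of_real v) \<partial>lborel) * E u t = (\<integral>v. D v * E (u - v) t \<partial>lborel)"
      by (simp only: mult.assoc shift)
  qed
  also have "\<dots> = (\<integral>v. \<integral>t. D v * E (u - v) t \<partial>lborel \<partial>lborel)"
  proof (rule lborel_pair.Fubini_integral[symmetric], rule integrable_lborel_pair_bound[OF measE])
    show "integrable lborel (\<lambda>t. exp (- (\<kappa> * t)\<^sup>2 / 2))" by (rule gaussian_integrable[OF \<kappa>])
    show "integrable lborel (\<lambda>v. exp (c * u + \<kappa>\<^sup>2 * c\<^sup>2 / 2) * (norm (D v) * exp (- c * v)))" using int by simp
    fix t v
    have "exp (c * (u - v) + \<kappa>\<^sup>2 * c\<^sup>2 / 2) = exp (c * u + \<kappa>\<^sup>2 * c\<^sup>2 / 2) * exp (- c * v)"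
      by (simp add: exp_add[symmetric] algebra_simps)
    then show "norm (D v * E (u - v) t) \<le> exp (- (\<kappa> * t)\<^sup>2 / 2) * (exp (c * u + \<kappa>\<^sup>2 * c\<^sup>2 / 2) * (norm (D v) * exp (- c * v)))"
      unfolding norm_mult nE by (simp only: mult_ac order_refl)
  qed
  also have "\<dots> = (\<integral>v. D v * of_real (normal_density 0 \<kappa> (u - v)) * of_real (2 * pi) \<partial>lborel)"
    by (simp only: integral_mult_right_zero inner of_real_mult mult_ac)
  also have "\<dots> = (\<integral>v. D v * of_real (normal_density 0 \<kappa> (u - v)) \<partial>lborel) * of_real (2 * pi)"
    by (rule integral_mult_left_zero)
  finally show ?thesis unfolding E_def by simp
qed

text \<open>The quadratic Taylor term of \<open>exp\<close> at
  \<open>(\<kappa> * y)\<^sup>2 / 2\<close> supplies \<open>\<kappa> ^ 4 * y ^ 4 / 8\<close>, enough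
  to dominate \<open>(1 + |y|) * (1 + y\<^sup>2)\<close>; hence the fourth power of
  \<open>\<kappa>\<close>.\<close>

lemma poly_gaussian_bound:
  fixes \<kappa> y :: real
  assumes "0 < \<kappa>" "\<kappa> \<le> 1"
  shows "(1 + \<bar>y\<bar>) * exp (- (\<kappa> * y)\<^sup>2 / 2) \<le> 32 / \<kappa> ^ 4 * inverse (1 + y\<^sup>2)"
proof -
  define x where "x = (\<kappa> * y)\<^sup>2 / 2"
  have x: "x \<ge> 0" by (simp add: x_def)
  have k4: "0 < \<kappa> ^ 4" "\<kappa> ^ 4 \<le> 1" using assms by (auto simp: power_le_one)
  have "\<kappa> ^ 4 / 8 * (1 + y ^ 4) \<le> 1 + x + x\<^sup>2 / 2"
  proof -
    have "x\<^sup>2 / 2 = \<kappa> ^ 4 * y ^ 4 / 8" by (simp add: x_def power_mult_distrib power_divide flip: power_mult)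
    then show ?thesis using k4 x by (simp add: algebra_simps)
  qed
  also have "\<dots> \<le> exp x" by (rule exp_lower_Taylor_quadratic[OF x])
  finally have e: "\<kappa> ^ 4 * (1 + y ^ 4) \<le> 8 * exp x" by simp
  have "(1 + \<bar>y\<bar>) * (1 + y\<^sup>2) \<le> 4 * (1 + y ^ 4)"
  proof -
    have "1 + \<bar>y\<bar> \<le> 2 * (1 + y\<^sup>2)"
    proof -
      have "2 * \<bar>y\<bar> \<le> y\<^sup>2 + 1" using sum_squares_bound[of "\<bar>y\<bar>" 1] by simp
      moreover have "1 + z \<le> 2 * (1 + w)" if "2 * z \<le> w + 1" "0 \<le> w" for z w :: real
        using that by (simp add: field_simps)
      ultimately show ?thesis using zero_le_power2[of y] by blast
    qed
    then have "(1 + \<bar>y\<bar>) * (1 + y\<^sup>2) \<le> 2 * (1 + y\<^sup>2) * (1 + y\<^sup>2)" by (intro mult_right_mono) auto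
    also have "\<dots> \<le> 4 * (1 + y ^ 4)"
      using sum_squares_bound[of 1 "y\<^sup>2"] by (simp add: algebra_simps power2_eq_square power4_eq_xxxx)
    finally show ?thesis .
  qed
  then have "\<kappa> ^ 4 * ((1 + \<bar>y\<bar>) * (1 + y\<^sup>2)) \<le> 4 * (\<kappa> ^ 4 * (1 + y ^ 4))" using k4 by simp
  also have "\<dots> \<le> 32 * exp x" using e by simp
  finally have "\<kappa> ^ 4 * ((1 + \<bar>y\<bar>) * (1 + y\<^sup>2)) * exp (- x) \<le> 32"
    by (simp add: exp_minus field_simps)
  moreover have "1 + y\<^sup>2 > 0" by (simp add: add_pos_nonneg)
  moreover have "z * e \<le> 32 / p * inverse r" if "p * (z * r) * e \<le> 32" "r > 0" "p > 0" for p r z e :: real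
    using that by (simp add: field_simps)
  ultimately have "(1 + \<bar>y\<bar>) * exp (- x) \<le> 32 / \<kappa> ^ 4 * inverse (1 + y\<^sup>2)"
    using k4(1) by blast
  then show ?thesis by (simp add: x_def)
qed

lemma integrable_exp_abs_normal: "integrable lborel (\<lambda>z. exp (3 * \<bar>z\<bar>) * std_normal_density z)"
proof -
  have "integrable lborel (\<lambda>z. exp (9 / 2) * normal_density 3 1 z + exp (9 / 2) * normal_density (-3) 1 z)"
    by (intro Bochner_Integration.integrable_add integrable_mult_right integrable_normal_density) auto
  then show ?thesis
  proof (rule Bochner_Integration.integrable_bound)
    \<comment> \<open>Completing the square: the factor \<open>exp (3 * z)\<close> moves the mean of
      the density to 3 at the price of \<open>exp (9 / 2)\<close>.\<close>
    have e: "exp (3 * z) * std_normal_density z = exp (9 / 2) * normal_density 3 1 z"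
      "exp (- 3 * z) * std_normal_density z = exp (9 / 2) * normal_density (-3) 1 z" for z
      by (simp_all add: normal_density_def exp_add[symmetric] power2_eq_square field_simps)
    show "AE z in lborel. norm (exp (3 * \<bar>z\<bar>) * std_normal_density z) \<le> norm (exp (9 / 2) * normal_density 3 1 z + exp (9 / 2) * normal_density (-3) 1 z)"
    proof (rule AE_I2)
      fix z :: real
      have "exp (3 * \<bar>z\<bar>) \<le> exp (3 * z) + exp (- 3 * z)" by (cases "z \<ge> 0") auto
      then have "exp (3 * \<bar>z\<bar>) * std_normal_density z \<le> exp (3 * z) * std_normal_density z + exp (- 3 * z) * std_normal_density z"
        by (subst distrib_right[symmetric]) (intro mult_right_mono normal_density_nonneg)
      then show "norm (exp (3 * \<bar>z\<bar>) * std_normal_density z) \<le> norm (exp (9 / 2) * normal_density 3 1 z + exp (9 / 2) * normal_density (-3) 1 z)"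
        unfolding e by (simp add: normal_density_nonneg)
    qed
  qed measurable
qed

text \<open>After the substitution \<open>v = u + \<kappa> * z\<close> the weight no longer depends
  on \<open>\<kappa>\<close>, and since \<open>\<kappa>\<close> is at most 1 the growth bound gives
  a majorant independent of \<open>n\<close>: dominated convergence.\<close>

lemma gaussian_smoothing_tendsto:
  fixes D :: "real \<Rightarrow> complex"
  assumes D[measurable]: "D \<in> borel_measurable borel" and growth: "\<And>v. norm (D v) \<le> C * exp (3 * \<bar>v\<bar>)"
    and cont: "isCont D u"
  shows "(\<lambda>n. \<integral>v. D v * of_real (normal_density 0 (1 / real (Suc n)) (u - v)) \<partial>lborel) \<longlonglongrightarrow> D u"
proof -
  have C: "C \<ge> 0" using order_trans[OF norm_ge_zero growth[of 0]] by simp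
  have eq: "(\<integral>v. D v * of_real (normal_density 0 \<kappa> (u - v)) \<partial>lborel) = (\<integral>z. D (u + \<kappa> * z) * of_real (std_normal_density z) \<partial>lborel)"
    if \<kappa>: "\<kappa> > 0" for \<kappa>
  proof -
    have "(\<integral>v. D v * of_real (normal_density 0 \<kappa> (u - v)) \<partial>lborel) =
      \<bar>\<kappa>\<bar> *\<^sub>R (\<integral>z. D (u + \<kappa> * z) * of_real (normal_density 0 \<kappa> (u - (u + \<kappa> * z))) \<partial>lborel)"
      by (rule lborel_integral_real_affine) (use \<kappa> in auto)
    also have "\<dots> = (\<integral>z. \<bar>\<kappa>\<bar> *\<^sub>R (D (u + \<kappa> * z) * of_real (normal_density 0 \<kappa> (u - (u + \<kappa> * z)))) \<partial>lborel)"
      by (rule integral_scaleR_right[symmetric])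
    also have "\<dots> = (\<integral>z. D (u + \<kappa> * z) * of_real (std_normal_density z) \<partial>lborel)"
    proof (intro Bochner_Integration.integral_cong refl)
      fix z
      have "\<kappa> * normal_density 0 \<kappa> (u - (u + \<kappa> * z)) = std_normal_density z"
        using \<kappa> by (simp add: normal_density_0 std_normal_density_def power_mult_distrib)
      then show "\<bar>\<kappa>\<bar> *\<^sub>R (D (u + \<kappa> * z) * of_real (normal_density 0 \<kappa> (u - (u + \<kappa> * z)))) = D (u + \<kappa> * z) * of_real (std_normal_density z)"
        using \<kappa> by (metis abs_of_pos mult.left_commute of_real_mult scaleR_conv_of_real)
    qed
    finally show ?thesis .
  qed
  have "(\<lambda>n. \<integral>z. D (u + (1 / real (Suc n)) * z) * of_real (std_normal_density z) \<partial>lborel) \<longlonglongrightarrow> (\<integral>z. D u * of_real (std_normal_density z) \<partial>lborel)"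
  proof (rule integral_dominated_convergence)
    show "integrable lborel (\<lambda>z. C * exp (3 * \<bar>u\<bar>) * (exp (3 * \<bar>z\<bar>) * std_normal_density z))"
      using integrable_exp_abs_normal by simp
    show "AE z in lborel. (\<lambda>n. D (u + (1 / real (Suc n)) * z) * of_real (std_normal_density z)) \<longlonglongrightarrow> D u * of_real (std_normal_density z)"
    proof (intro AE_I2 tendsto_mult tendsto_const)
      fix z
      have "(\<lambda>n. u + (1 / real (Suc n)) * z) \<longlonglongrightarrow> u" by real_asymp
      then show "(\<lambda>n. D (u + (1 / real (Suc n)) * z)) \<longlonglongrightarrow> D u"
        by (rule isCont_tendsto_compose[OF cont])
    qed
    fix n
    show "AE z in lborel. norm (D (u + (1 / real (Suc n)) * z) * of_real (std_normal_density z)) \<le> C * exp (3 * \<bar>u\<bar>) * (exp (3 * \<bar>z\<bar>) * std_normal_density z)"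
    proof (rule AE_I2)
      fix z :: real
      have k: "0 \<le> 1 / real (Suc n)" "1 / real (Suc n) \<le> 1" by auto
      have "\<bar>u + (1 / real (Suc n)) * z\<bar> \<le> \<bar>u\<bar> + \<bar>(1 / real (Suc n)) * z\<bar>" by (rule abs_triangle_ineq)
      also have "\<bar>(1 / real (Suc n)) * z\<bar> \<le> \<bar>z\<bar>"
        using mult_right_mono[OF k(2), of "\<bar>z\<bar>"] k(1) by (simp add: abs_mult)
      finally have "exp (3 * \<bar>u + (1 / real (Suc n)) * z\<bar>) \<le> exp (3 * \<bar>u\<bar>) * exp (3 * \<bar>z\<bar>)"
        by (simp add: exp_add[symmetric])
      then have "C * exp (3 * \<bar>u + (1 / real (Suc n)) * z\<bar>) \<le> C * (exp (3 * \<bar>u\<bar>) * exp (3 * \<bar>z\<bar>))"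
        using C by (rule mult_left_mono)
      then have "norm (D (u + (1 / real (Suc n)) * z)) \<le> C * (exp (3 * \<bar>u\<bar>) * exp (3 * \<bar>z\<bar>))"
        using growth order_trans by blast
      then have "norm (D (u + (1 / real (Suc n)) * z)) * std_normal_density z \<le> C * (exp (3 * \<bar>u\<bar>) * exp (3 * \<bar>z\<bar>)) * std_normal_density z"
        by (rule mult_right_mono[OF _ normal_density_nonneg])
      then show "norm (D (u + (1 / real (Suc n)) * z) * of_real (std_normal_density z)) \<le> C * exp (3 * \<bar>u\<bar>) * (exp (3 * \<bar>z\<bar>) * std_normal_density z)"
        by (simp add: norm_mult normal_density_nonneg mult.assoc)
    qed
  qed measurable
  also have "(\<integral>z. D u * of_real (std_normal_density z) \<partial>lborel) = D u"
    by (simp del: of_real_1)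
  finally show ?thesis by (subst eq) simp_all
qed

text \<open>Nothing is known a priori about the integrability of \<open>D(u) e\<^sup>-\<^sup>\<sigma>\<^sup>u\<close>, so \<open>D\<close> is first smoothed by a
  Gaussian of width \<open>\<kappa>\<close>, whose transform decays fast enough to shift the line of integration from
  3 to \<open>\<sigma>\<close>; Fatou's lemma then removes the smoothing.\<close>
lemma laplace_mean_square:
  fixes D :: "real \<Rightarrow> complex" and H :: "complex \<Rightarrow> complex"
  assumes D[measurable]: "D \<in> borel_measurable borel"
    and growth: "\<And>v. norm (D v) \<le> C * exp (3 * \<bar>v\<bar>)"
    and int: "integrable lborel (\<lambda>v. norm (D v) * exp (- 3 * v))"
    and S: "countable S" "\<And>u. u \<notin> S \<Longrightarrow> isCont D u"
    and hol: "H holomorphic_on {s. Re s > c0}" and \<sigma>: "0 \<le> \<sigma>" "c0 < \<sigma>" "\<sigma> \<le> 3"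
    and H: "\<And>t. H (Complex 3 t) = (\<integral>v. D v * exp (- Complex 3 t * of_real v) \<partial>lborel)"
    and strip: "\<And>s. \<sigma> \<le> Re s \<Longrightarrow> Re s \<le> 3 \<Longrightarrow> norm (H s) \<le> K * (1 + \<bar>Im s\<bar>)"
    and int2: "integrable lborel (\<lambda>t. (norm (H (Complex \<sigma> t)))\<^sup>2)" and \<tau>: "\<tau> > 0"
  shows "(\<integral>\<^sup>+u. ennreal ((norm (D u))\<^sup>2 * exp (- 2 * \<sigma> * u) * exp (- (\<tau> * u)\<^sup>2 / 2)) \<partial>lborel)
     \<le> ennreal ((\<integral>t. (norm (H (Complex \<sigma> t)))\<^sup>2 \<partial>lborel) / (2 * pi))"
proof -
  define b where "b = (\<lambda>\<kappa> u. \<integral>v. D v * of_real (normal_density 0 \<kappa> (u - v)) \<partial>lborel)"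
  define I where "I = (\<integral>t. (norm (H (Complex \<sigma> t)))\<^sup>2 \<partial>lborel)"
  have K: "K \<ge> 0" using order_trans[OF norm_ge_zero strip[of 3]] \<sigma> by simp
  have [measurable]: "b \<kappa> \<in> borel_measurable borel" for \<kappa>
    unfolding b_def by (rule borel_measurable_lborel_integral_param) measurable
  \<comment> \<open>Plancherel for the smoothed function;
    \<open>exp (\<kappa>\<^sup>2 * \<sigma>\<^sup>2)\<close> is the square of the largest value of
    the damping factor on \<open>Re s = \<sigma>\<close> and tends to 1 with
    \<open>\<kappa>\<close>.\<close>
  have smooth: "(\<integral>\<^sup>+u. ennreal ((norm (b \<kappa> u))\<^sup>2 * exp (- 2 * \<sigma> * u) * exp (- (\<tau> * u)\<^sup>2 / 2)) \<partial>lborel)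
     \<le> ennreal (exp (\<kappa>\<^sup>2 * \<sigma>\<^sup>2) * (I / (2 * pi)))" if \<kappa>: "0 < \<kappa>" "\<kappa> \<le> 1" for \<kappa>
  proof -
    define q where "q = (\<lambda>s. exp (of_real (\<kappa>\<^sup>2 / 2) * s\<^sup>2) :: complex)"
    have nq: "norm (q s) = exp (\<kappa>\<^sup>2 * (Re s)\<^sup>2 / 2) * exp (- (\<kappa> * Im s)\<^sup>2 / 2)" for s
      by (simp add: q_def exp_add[symmetric] power2_eq_square algebra_simps diff_divide_distrib)
    define a where "a = (\<lambda>t. H (Complex \<sigma> t) * q (Complex \<sigma> t))"
    have contH: "continuous_on UNIV (\<lambda>t. H (Complex \<sigma> t))"
      using \<sigma> by (intro continuous_on_compose2[OF holomorphic_on_imp_continuous_on[OF hol]]) (auto intro!: continuous_intros simp: Complex_eq)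
    have [measurable]: "a \<in> borel_measurable borel"
    proof (rule borel_measurable_continuous_onI)
      show "continuous_on UNIV a"
        unfolding a_def q_def Complex_eq by (intro continuous_intros contH[unfolded Complex_eq])
    qed
    have qb: "norm (H s * q s) \<le> (K * exp (\<kappa>\<^sup>2 * 9 / 2) * (32 / \<kappa> ^ 4)) * inverse (1 + (Im s)\<^sup>2)" if s: "\<sigma> \<le> Re s" "Re s \<le> 3" for s
    proof -
      have "norm (H s * q s) \<le> (K * (1 + \<bar>Im s\<bar>)) * (exp (\<kappa>\<^sup>2 * 9 / 2) * exp (- (\<kappa> * Im s)\<^sup>2 / 2))"
        unfolding norm_mult nq
      proof (intro mult_mono strip[OF s])
        have "(Re s)\<^sup>2 \<le> 3\<^sup>2" using s \<sigma> by (intro power_mono) auto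
        then show "exp (\<kappa>\<^sup>2 * (Re s)\<^sup>2 / 2) \<le> exp (\<kappa>\<^sup>2 * 9 / 2)" by (auto intro!: divide_right_mono mult_left_mono)
      qed (use K in auto)
      also have "\<dots> = (K * exp (\<kappa>\<^sup>2 * 9 / 2)) * ((1 + \<bar>Im s\<bar>) * exp (- (\<kappa> * Im s)\<^sup>2 / 2))" by (simp only: mult_ac)
      also have "\<dots> \<le> (K * exp (\<kappa>\<^sup>2 * 9 / 2)) * (32 / \<kappa> ^ 4 * inverse (1 + (Im s)\<^sup>2))"
        using K by (intro mult_left_mono poly_gaussian_bound \<kappa>) auto
      finally show ?thesis by (simp only: mult.assoc)
    qed
    have ai: "integrable lborel a"
    proof (rule Bochner_Integration.integrable_bound)
      show "integrable lborel (\<lambda>t::real. (K * exp (\<kappa>\<^sup>2 * 9 / 2) * (32 / \<kappa> ^ 4)) * inverse (1 + t\<^sup>2))"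
        using integrable_inverse_one_plus_square by (rule integrable_mult_right)
      show "AE t in lborel. norm (a t) \<le> norm ((K * exp (\<kappa>\<^sup>2 * 9 / 2) * (32 / \<kappa> ^ 4)) * inverse (1 + t\<^sup>2))"
      proof (rule AE_I2)
        fix t :: real
        show "norm (a t) \<le> norm ((K * exp (\<kappa>\<^sup>2 * 9 / 2) * (32 / \<kappa> ^ 4)) * inverse (1 + t\<^sup>2))"
          using qb[of "Complex \<sigma> t"] \<sigma> unfolding a_def real_norm_def by (intro order_trans[OF _ abs_ge_self]) simp
      qed
    qed simp
    have a2_le: "(norm (a t))\<^sup>2 \<le> exp (\<kappa>\<^sup>2 * \<sigma>\<^sup>2) * (norm (H (Complex \<sigma> t)))\<^sup>2" for t
    proof -
      have "norm (q (Complex \<sigma> t)) \<le> exp (\<kappa>\<^sup>2 * \<sigma>\<^sup>2 / 2) * 1" unfolding nq by simp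
      then have "(norm (q (Complex \<sigma> t)))\<^sup>2 \<le> (exp (\<kappa>\<^sup>2 * \<sigma>\<^sup>2 / 2))\<^sup>2" by (intro power_mono) auto
      also have "\<dots> = exp (\<kappa>\<^sup>2 * \<sigma>\<^sup>2)" by (simp add: power2_eq_square exp_add[symmetric])
      finally have "(norm (H (Complex \<sigma> t)))\<^sup>2 * (norm (q (Complex \<sigma> t)))\<^sup>2 \<le> (norm (H (Complex \<sigma> t)))\<^sup>2 * exp (\<kappa>\<^sup>2 * \<sigma>\<^sup>2)"
        by (rule mult_left_mono) simp
      then show ?thesis by (simp add: a_def norm_mult power_mult_distrib mult.commute)
    qed
    have int2': "integrable lborel (\<lambda>t. exp (\<kappa>\<^sup>2 * \<sigma>\<^sup>2) * (norm (H (Complex \<sigma> t)))\<^sup>2)" using int2 by (rule integrable_mult_right)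
    have a2i: "integrable lborel (\<lambda>t. (norm (a t))\<^sup>2)"
      by (rule Bochner_Integration.integrable_bound[OF int2']) (use a2_le in \<open>auto simp: abs_mult\<close>)
    \<comment> \<open>The inversion formula on \<open>Re s = 3\<close>, moved to
      \<open>Re s = \<sigma>\<close>, exhibits the weighted smoothing as a Fourier integral of
      \<open>a\<close>.\<close>
    have b_eq: "b \<kappa> u * of_real (exp (- \<sigma> * u)) = (\<integral>t. a t * iexp (u * t) \<partial>lborel) / of_real (2 * pi)" for u
    proof -
      define \<Phi> where "\<Phi> = (\<lambda>s. H s * exp (s * of_real u + of_real (\<kappa>\<^sup>2 / 2) * s\<^sup>2))"
      have \<Phi>q: "\<Phi> s = exp (s * of_real u) * (H s * q s)" for s by (simp add: \<Phi>_def q_def exp_add mult_ac)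
      have "b \<kappa> u = (\<integral>t. \<Phi> (Complex 3 t) \<partial>lborel) / of_real (2 * pi)"
        unfolding b_def \<Phi>_def H by (rule gaussian_smoothing_inversion[OF D int \<kappa>(1)])
      also have "(\<integral>t. \<Phi> (Complex 3 t) \<partial>lborel) = (\<integral>t. \<Phi> (Complex \<sigma> t) \<partial>lborel)"
      proof (rule vertical_line_shift[symmetric])
        show "\<Phi> holomorphic_on {s. Re s > c0}" unfolding \<Phi>_def by (intro holomorphic_intros hol)
        fix s assume s: "\<sigma> \<le> Re s" "Re s \<le> 3"
        have "norm (\<Phi> s) = exp (Re s * u) * norm (H s * q s)" unfolding \<Phi>q norm_mult[of "exp _"] by simp
        also have "\<dots> \<le> exp (3 * \<bar>u\<bar>) * ((K * exp (\<kappa>\<^sup>2 * 9 / 2) * (32 / \<kappa> ^ 4)) * inverse (1 + (Im s)\<^sup>2))"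
        proof (intro mult_mono qb[OF s])
          have "Re s * u \<le> \<bar>Re s\<bar> * \<bar>u\<bar>" by (metis abs_ge_self abs_mult)
          also have "\<dots> \<le> 3 * \<bar>u\<bar>" using s \<sigma> by (intro mult_right_mono) auto
          finally show "exp (Re s * u) \<le> exp (3 * \<bar>u\<bar>)" by simp
        qed auto
        finally show "norm (\<Phi> s) \<le> (exp (3 * \<bar>u\<bar>) * (K * exp (\<kappa>\<^sup>2 * 9 / 2) * (32 / \<kappa> ^ 4))) * inverse (1 + (Im s)\<^sup>2)"
          by (simp only: mult.assoc)
      qed (use \<sigma> in auto)
      also have "(\<lambda>t. \<Phi> (Complex \<sigma> t)) = (\<lambda>t. of_real (exp (\<sigma> * u)) * (a t * iexp (u * t)))"
      proof
        fix t
        have "exp (Complex \<sigma> t * of_real u) = of_real (exp (\<sigma> * u)) * iexp (u * t)"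
          unfolding exp_of_real[symmetric] exp_add[symmetric] by (intro arg_cong[where f = exp]) (simp add: complex_eq_iff)
        then show "\<Phi> (Complex \<sigma> t) = of_real (exp (\<sigma> * u)) * (a t * iexp (u * t))"
          unfolding \<Phi>q a_def by (simp only: mult_ac)
      qed
      finally have "b \<kappa> u = of_real (exp (\<sigma> * u)) * (\<integral>t. a t * iexp (u * t) \<partial>lborel) / of_real (2 * pi)"
        by (simp only: integral_mult_right_zero)
      moreover have "of_real (exp (\<sigma> * u)) * of_real (exp (- \<sigma> * u)) = (1 :: complex)"
        by (simp add: of_real_mult[symmetric] exp_add[symmetric] del: of_real_mult)
      ultimately show ?thesis by (simp add: mult_ac)
    qed
    have "(\<integral>\<^sup>+u. ennreal ((norm (b \<kappa> u))\<^sup>2 * exp (- 2 * \<sigma> * u) * exp (- (\<tau> * u)\<^sup>2 / 2)) \<partial>lborel) =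
       (\<integral>\<^sup>+u. ennreal (1 / (2 * pi)\<^sup>2) * ennreal ((norm (\<integral>t. a t * iexp (u * t) \<partial>lborel))\<^sup>2 * exp (- (\<tau> * u)\<^sup>2 / 2)) \<partial>lborel)"
    proof (intro nn_integral_cong)
      fix u
      have "exp (- 2 * \<sigma> * u) = (exp (- \<sigma> * u))\<^sup>2" by (simp add: power2_eq_square exp_add[symmetric])
      then have "(norm (b \<kappa> u))\<^sup>2 * exp (- 2 * \<sigma> * u) = (norm (b \<kappa> u * of_real (exp (- \<sigma> * u))))\<^sup>2"
        by (simp add: norm_mult power_mult_distrib)
      also have "\<dots> = 1 / (2 * pi)\<^sup>2 * (norm (\<integral>t. a t * iexp (u * t) \<partial>lborel))\<^sup>2"
        unfolding b_eq by (simp add: norm_divide power_divide)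
      finally have "(norm (b \<kappa> u))\<^sup>2 * exp (- 2 * \<sigma> * u) * exp (- (\<tau> * u)\<^sup>2 / 2) =
        (1 / (2 * pi)\<^sup>2) * ((norm (\<integral>t. a t * iexp (u * t) \<partial>lborel))\<^sup>2 * exp (- (\<tau> * u)\<^sup>2 / 2))" by (simp only: mult.assoc)
      then show "ennreal ((norm (b \<kappa> u))\<^sup>2 * exp (- 2 * \<sigma> * u) * exp (- (\<tau> * u)\<^sup>2 / 2)) =
         ennreal (1 / (2 * pi)\<^sup>2) * ennreal ((norm (\<integral>t. a t * iexp (u * t) \<partial>lborel))\<^sup>2 * exp (- (\<tau> * u)\<^sup>2 / 2))"
        by (simp only: ennreal_mult[symmetric] zero_le_divide_1_iff zero_le_power2 mult_nonneg_nonneg exp_ge_zero)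
    qed
    also have "\<dots> = ennreal (1 / (2 * pi)\<^sup>2) * (\<integral>\<^sup>+u. ennreal ((norm (\<integral>t. a t * iexp (u * t) \<partial>lborel))\<^sup>2 * exp (- (\<tau> * u)\<^sup>2 / 2)) \<partial>lborel)"
    proof (rule nn_integral_cmult)
      have [measurable]: "(\<lambda>u. \<integral>t. a t * iexp (u * t) \<partial>lborel) \<in> borel_measurable borel"
        by (rule borel_measurable_lborel_integral_param) measurable
      show "(\<lambda>u. ennreal ((norm (\<integral>t. a t * iexp (u * t) \<partial>lborel))\<^sup>2 * exp (- (\<tau> * u)\<^sup>2 / 2))) \<in> borel_measurable lborel"
        by measurable
    qed
    also have "\<dots> \<le> ennreal (1 / (2 * pi)\<^sup>2) * ennreal (2 * pi * (\<integral>t. (norm (a t))\<^sup>2 \<partial>lborel))"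
      by (intro mult_left_mono fourier_weighted_L2_bound ai a2i \<tau>) simp
    also have "\<dots> = ennreal ((1 / (2 * pi)\<^sup>2) * (2 * pi * (\<integral>t. (norm (a t))\<^sup>2 \<partial>lborel)))"
      by (rule ennreal_mult[symmetric]) (auto intro!: mult_nonneg_nonneg integral_nonneg_AE)
    also have "\<dots> \<le> ennreal (exp (\<kappa>\<^sup>2 * \<sigma>\<^sup>2) * (I / (2 * pi)))"
    proof (rule ennreal_leI)
      have "(\<integral>t. (norm (a t))\<^sup>2 \<partial>lborel) \<le> (\<integral>t. exp (\<kappa>\<^sup>2 * \<sigma>\<^sup>2) * (norm (H (Complex \<sigma> t)))\<^sup>2 \<partial>lborel)"
        by (intro integral_mono a2i int2' a2_le)
      also have "\<dots> = exp (\<kappa>\<^sup>2 * \<sigma>\<^sup>2) * I" unfolding I_def by (rule integral_mult_right_zero)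
      finally have "(\<integral>t. (norm (a t))\<^sup>2 \<partial>lborel) / (2 * pi) \<le> exp (\<kappa>\<^sup>2 * \<sigma>\<^sup>2) * I / (2 * pi)"
        by (rule divide_right_mono) simp
      moreover have "(1 / (2 * pi)\<^sup>2) * (2 * pi * J) = J / (2 * pi)" for J by (simp add: power2_eq_square)
      ultimately show "(1 / (2 * pi)\<^sup>2) * (2 * pi * (\<integral>t. (norm (a t))\<^sup>2 \<partial>lborel)) \<le> exp (\<kappa>\<^sup>2 * \<sigma>\<^sup>2) * (I / (2 * pi))"
        by (simp only: times_divide_eq_right)
    qed
    finally show ?thesis .
  qed
  define f where "f = (\<lambda>n u. ennreal ((norm (b (1 / real (Suc n)) u))\<^sup>2 * exp (- 2 * \<sigma> * u) * exp (- (\<tau> * u)\<^sup>2 / 2)))"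
  have f_lim: "(\<lambda>n. f n u) \<longlonglongrightarrow> ennreal ((norm (D u))\<^sup>2 * exp (- 2 * \<sigma> * u) * exp (- (\<tau> * u)\<^sup>2 / 2))" if "u \<notin> S" for u
    unfolding f_def b_def by (intro tendsto_ennrealI tendsto_mult tendsto_const tendsto_power tendsto_norm gaussian_smoothing_tendsto[OF D growth S(2)[OF that]])
  have "(\<integral>\<^sup>+u. ennreal ((norm (D u))\<^sup>2 * exp (- 2 * \<sigma> * u) * exp (- (\<tau> * u)\<^sup>2 / 2)) \<partial>lborel) = (\<integral>\<^sup>+u. liminf (\<lambda>n. f n u) \<partial>lborel)"
  proof (rule nn_integral_cong_AE)
    have "AE u in lborel. u \<notin> S"
      using countable_imp_null_set_lborel[OF S(1)] by (rule AE_not_in)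
    then show "AE u in lborel. ennreal ((norm (D u))\<^sup>2 * exp (- 2 * \<sigma> * u) * exp (- (\<tau> * u)\<^sup>2 / 2)) = liminf (\<lambda>n. f n u)"
    proof eventually_elim
      case (elim u)
      show ?case using lim_imp_Liminf[OF _ f_lim[OF elim]] by simp
    qed
  qed
  also have "\<dots> \<le> liminf (\<lambda>n. \<integral>\<^sup>+u. f n u \<partial>lborel)"
    by (rule nn_integral_liminf) (simp add: f_def)
  also have "\<dots> \<le> liminf (\<lambda>n. ennreal (exp ((1 / real (Suc n))\<^sup>2 * \<sigma>\<^sup>2) * (I / (2 * pi))))"
    unfolding f_def by (intro Liminf_mono always_eventually allI smooth) auto
  also have "\<dots> = ennreal (I / (2 * pi))"
  proof (rule lim_imp_Liminf)
    have "(\<lambda>n. exp ((1 / real (Suc n))\<^sup>2 * \<sigma>\<^sup>2)) \<longlonglongrightarrow> 1" by real_asymp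
    from tendsto_mult[OF this tendsto_const[of "I / (2 * pi)"]]
    show "(\<lambda>n. ennreal (exp ((1 / real (Suc n))\<^sup>2 * \<sigma>\<^sup>2) * (I / (2 * pi)))) \<longlonglongrightarrow> ennreal (I / (2 * pi))"
      by (intro tendsto_ennrealI) simp
  qed simp
  finally show ?thesis unfolding I_def .
qed

section \<open>The Laplace transform of the summatory function\<close>

lemma set_integrable_lborel_nonneg:
  fixes f :: "real \<Rightarrow> real"
  assumes f: "f \<in> borel_measurable borel" and A: "A \<in> sets borel"
    and "f integrable_on A" "\<And>x. x \<in> A \<Longrightarrow> 0 \<le> f x"
  shows "set_integrable lborel A f"
proof -
  have "set_integrable lebesgue A f"
    using assms by (intro nonnegative_absolutely_integrable_1) auto
  moreover have "(\<lambda>x. indicat_real A x *\<^sub>R f x) \<in> borel_measurable lborel"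
    using f A by simp
  ultimately show ?thesis
    unfolding set_integrable_def by (simp add: integrable_completion)
qed

lemma integrable_one_plus_abs_powr:
  assumes "e > 0"
  shows "integrable lborel (\<lambda>t::real. (1 + \<bar>t\<bar>) powr (- 1 - e))"
proof -
  have "(\<lambda>x::real. x powr (- 1 - e)) integrable_on {1..}"
    using has_integral_powr_to_inf[of "- 1 - e" 1] assms by (auto simp: integrable_on_def)
  then have "set_integrable lborel {1..} (\<lambda>x::real. x powr (- 1 - e))"
    by (intro set_integrable_lborel_nonneg) auto
  then have i: "integrable lborel (\<lambda>x. indicat_real {1..} x * x powr (- 1 - e))"
    by (simp add: set_integrable_def)
  have 1: "integrable lborel (\<lambda>x. indicat_real {1..} (1 + 1 * x) * (1 + 1 * x) powr (- 1 - e))"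
    by (rule lborel_integrable_real_affine[OF i]) simp
  have 2: "integrable lborel (\<lambda>x. indicat_real {1..} (1 + (-1) * x) * (1 + (-1) * x) powr (- 1 - e))"
    by (rule lborel_integrable_real_affine[OF i]) simp
  show ?thesis
  proof (rule Bochner_Integration.integrable_bound[OF Bochner_Integration.integrable_add[OF 1 2]])
    show "AE t in lborel. norm ((1 + \<bar>t\<bar>) powr (- 1 - e)) \<le> norm (indicat_real {1..} (1 + 1 * t) * (1 + 1 * t) powr (- 1 - e) +
       indicat_real {1..} (1 + (-1) * t) * (1 + (-1) * t) powr (- 1 - e))"
      by (rule AE_I2) (auto simp: indicator_def abs_if)
  qed measurable
qed

text \<open>The terms of the convergent Dirichlet series of \<open>- F'/F\<close> at
  \<open>3/2\<close> are bounded. Crude as it is, this puts \<open>psiF \<Lambda> x\<close> below a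
  constant times \<open>x powr (5/2)\<close>, which makes the transforms on \<open>Re s = 3\<close>
  converge absolutely.\<close>

lemma log_deriv_coeffs_growth:
  assumes "log_deriv_coeffs F \<Lambda>"
  obtains M where "M > 0" "\<And>n. norm (\<Lambda> (Suc n)) \<le> M * real (Suc n) powr (3/2)"
proof -
  have "summable (\<lambda>n. \<Lambda> (Suc n) / of_nat (Suc n) powr (of_real (3/2) :: complex))"
    using assms[unfolded log_deriv_coeffs_def, rule_format, of "of_real (3/2)"]
    by (auto simp: sums_iff simp del: of_real_divide)
  then have "(\<lambda>n. \<Lambda> (Suc n) / of_nat (Suc n) powr (of_real (3/2) :: complex)) \<longlonglongrightarrow> 0"
    by (rule summable_LIMSEQ_zero)
  then have "Bseq (\<lambda>n. \<Lambda> (Suc n) / of_nat (Suc n) powr (of_real (3/2) :: complex))"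
    by (intro convergent_imp_Bseq convergentI)
  then obtain M where M: "M > 0" "\<And>n. norm (\<Lambda> (Suc n) / of_nat (Suc n) powr (of_real (3/2) :: complex)) \<le> M"
    by (auto elim: BseqE)
  show ?thesis
  proof (rule that[OF M(1)])
    fix n
    have "norm (\<Lambda> (Suc n)) / real (Suc n) powr (3/2) \<le> M"
      using M(2)[of n] unfolding norm_divide norm_of_nat_powr by simp
    moreover have "real (Suc n) powr (3/2) > 0" by simp
    ultimately show "norm (\<Lambda> (Suc n)) \<le> M * real (Suc n) powr (3/2)" by (simp only: pos_divide_le_eq)
  qed
qed

lemma psiF_measurable [measurable]: "psiF \<Lambda> \<in> borel_measurable borel"
proof -
  have "(\<lambda>x::real. (\<lambda>k::int. \<Sum>n\<in>{1..nat k}. \<Lambda> n) \<lfloor>x\<rfloor>) \<in> borel_measurable borel"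
    by (rule measurable_compose[OF measurable_real_floor]) simp
  then show ?thesis by (simp add: psiF_def[abs_def])
qed

lemma psiF_growth:
  assumes M: "\<And>n. norm (\<Lambda> (Suc n)) \<le> M * real (Suc n) powr (3/2)" and x: "x \<ge> 1"
  shows "norm (psiF \<Lambda> x) \<le> M * x powr (5/2)"
proof -
  have M0: "M \<ge> 0" using order_trans[OF norm_ge_zero M[of 0]] by simp
  have "norm (psiF \<Lambda> x) \<le> (\<Sum>n\<in>{1..nat \<lfloor>x\<rfloor>}. norm (\<Lambda> n))"
    unfolding psiF_def by (rule norm_sum)
  also have "\<dots> \<le> (\<Sum>n\<in>{1..nat \<lfloor>x\<rfloor>}. M * x powr (3/2))"
  proof (rule sum_mono)
    fix n assume n: "n \<in> {1..nat \<lfloor>x\<rfloor>}"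
    then have nx: "real n \<le> x" using x by (auto simp: le_nat_floor le_floor_iff nat_le_iff) linarith
    have "norm (\<Lambda> n) \<le> M * real n powr (3/2)" using M[of "n - 1"] n by simp
    also have "\<dots> \<le> M * x powr (3/2)" using nx M0 by (intro mult_left_mono powr_mono2) auto
    finally show "norm (\<Lambda> n) \<le> M * x powr (3/2)" .
  qed
  also have "\<dots> = real (nat \<lfloor>x\<rfloor>) * (M * x powr (3/2))" by simp
  also have "\<dots> \<le> x * (M * x powr (3/2))" using x M0 by (intro mult_right_mono) auto
  also have "\<dots> = M * x powr (5/2)" using x by (simp add: powr_mult_base)
  finally show ?thesis .
qed

lemma psiF_less_1: "x < 1 \<Longrightarrow> psiF \<Lambda> x = 0"
  by (simp add: psiF_def floor_less_iff not_le[symmetric])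

text \<open>In the variable \<open>u = log x\<close>, cut off at \<open>u = 0\<close>: the transform of the cut-off main term \<open>M e\<^sup>u\<close> is
  \<open>M / (s - 1)\<close>, which cancels the pole of \<open>F'/F\<close>.\<close>
definition logpsi :: "(nat \<Rightarrow> complex) \<Rightarrow> real \<Rightarrow> real \<Rightarrow> complex" where
  "logpsi \<Lambda> M u = (if u \<ge> 0 then psiF \<Lambda> (exp u) - of_real (M * exp u) else 0)"

lemma logpsi_measurable [measurable]: "logpsi \<Lambda> M \<in> borel_measurable borel"
  unfolding logpsi_def[abs_def] by measurable

lemma logpsi_growth:
  assumes "\<And>n. norm (\<Lambda> (Suc n)) \<le> K * real (Suc n) powr (3/2)"
  shows "norm (logpsi \<Lambda> M u) \<le> (K + \<bar>M\<bar>) * indicat_real {0..} u * exp (5/2 * u)"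
proof (cases "u \<ge> 0")
  case True
  have K0: "K \<ge> 0" using order_trans[OF norm_ge_zero assms[of 0]] by simp
  have "norm (logpsi \<Lambda> M u) \<le> norm (psiF \<Lambda> (exp u)) + norm (complex_of_real (M * exp u))"
    using True unfolding logpsi_def by (simp only: if_True norm_triangle_ineq4)
  also have "\<dots> \<le> K * exp u powr (5/2) + \<bar>M\<bar> * exp u"
    using True psiF_growth[OF assms, of "exp u"] by (simp add: abs_mult norm_mult)
  also have "exp u powr (5/2) = exp (5/2 * u)" by (simp add: powr_def)
  also have "\<bar>M\<bar> * exp u \<le> \<bar>M\<bar> * exp (5/2 * u)" using True by (intro mult_left_mono) auto
  finally show ?thesis using True by (simp add: algebra_simps)
qed (simp add: logpsi_def)

lemma isCont_logpsi:
  assumes "exp u \<notin> \<int>"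
  shows "isCont (logpsi \<Lambda> M) u"
proof -
  \<comment> \<open>\<open>exp 0 = 1\<close> is an integer, so the jump of the cut-off at
    \<open>u = 0\<close> is excluded as well.\<close>
  have u0: "u \<noteq> 0" using assms by auto
  have "eventually (\<lambda>v. \<lfloor>exp v\<rfloor> = \<lfloor>exp u\<rfloor>) (nhds u)"
  proof -
    have "(exp \<longlongrightarrow> exp u) (nhds u)" by (intro tendsto_intros filterlim_ident)
    then show ?thesis using assms by (rule eventually_floor_eq)
  qed
  moreover have "eventually (\<lambda>v. (v \<ge> 0) = (u \<ge> 0)) (nhds u)"
  proof (cases "u > 0")
    case True
    then have "eventually (\<lambda>v. v > 0) (nhds u)" by (intro eventually_nhds_in_open[of "{0<..}" u, simplified]) auto
    then show ?thesis by eventually_elim (use True in auto)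
  next
    case False
    then have "eventually (\<lambda>v. v < 0) (nhds u)" using u0 by (intro eventually_nhds_in_open[of "{..<0}" u, simplified]) auto
    then show ?thesis by eventually_elim (use False u0 in auto)
  qed
  ultimately have ev: "eventually (\<lambda>v. logpsi \<Lambda> M v = (if u \<ge> 0 then psiF \<Lambda> (exp u) - of_real (M * exp v) else 0)) (nhds u)"
    by eventually_elim (simp add: logpsi_def psiF_def)
  have "isCont (\<lambda>v. if u \<ge> 0 then psiF \<Lambda> (exp u) - of_real (M * exp v) else 0 :: complex) u"
    by (cases "u \<ge> 0") (auto intro!: continuous_intros)
  then show ?thesis using isCont_cong[OF ev] by simp
qed

lemma set_integrable_exp_half_line:
  assumes "c > 0"
  shows "set_integrable lborel {a..} (\<lambda>v. exp (- c * v) :: real)"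
  using has_integral_exp_minus_to_infinity[OF assms, of a]
  by (intro set_integrable_lborel_nonneg) (auto simp: integrable_on_def)

lemma integral_cexp_half_line:
  assumes s: "Re s > 0"
  shows "integrable lborel (\<lambda>v. indicat_real {a..} v *\<^sub>R exp (- s * of_real v))"
    and "(\<integral>v. indicat_real {a..} v *\<^sub>R exp (- s * of_real v) \<partial>lborel) = exp (- s * of_real a) / s"
proof -
  have i: "integrable lborel (\<lambda>v. indicat_real {a..} v * exp (- Re s * v))"
    using set_integrable_exp_half_line[OF s, of a] by (simp add: set_integrable_def)
  show int: "integrable lborel (\<lambda>v. indicat_real {a..} v *\<^sub>R exp (- s * of_real v))"
    by (rule Bochner_Integration.integrable_bound[OF i]) (auto simp: indicator_def)
  define L where "L = (\<lambda>T. \<integral>v. indicat_real {a..T} v *\<^sub>R exp (- s * of_real v) \<partial>lborel)"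
  have "(L \<longlongrightarrow> (\<integral>v. indicat_real {a..} v *\<^sub>R exp (- s * of_real v) \<partial>lborel)) at_top"
    unfolding L_def
  proof (rule integral_dominated_convergence_at_top[OF _ _ i])
    show "\<forall>\<^sub>F T in at_top. AE v in lborel. norm (indicat_real {a..T} v *\<^sub>R exp (- s * of_real v)) \<le> indicat_real {a..} v * exp (- Re s * v)"
      by (intro always_eventually allI AE_I2) (auto simp: indicator_def)
    show "AE v in lborel. ((\<lambda>T. indicat_real {a..T} v *\<^sub>R exp (- s * of_real v)) \<longlongrightarrow> indicat_real {a..} v *\<^sub>R exp (- s * of_real v)) at_top"
    proof (rule AE_I2)
      fix v
      have "eventually (\<lambda>T. indicat_real {a..T} v *\<^sub>R exp (- s * of_real v) = indicat_real {a..} v *\<^sub>R exp (- s * of_real v)) at_top"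
        by (rule eventually_mono[OF eventually_ge_at_top[of v]]) (auto simp: indicator_def)
      then show "((\<lambda>T. indicat_real {a..T} v *\<^sub>R exp (- s * of_real v)) \<longlongrightarrow> indicat_real {a..} v *\<^sub>R exp (- s * of_real v)) at_top"
        by (rule tendsto_eventually)
    qed
  qed measurable
  moreover have "(L \<longlongrightarrow> exp (- s * of_real a) / s) at_top"
  proof -
    have "eventually (\<lambda>T. L T = exp (- s * of_real a) / s - exp (- s * of_real T) / s) at_top"
    proof (rule eventually_mono[OF eventually_ge_at_top[of a]])
      fix T assume T: "a \<le> T"
      have "L T = (- exp (- s * of_real T) / s) - (- exp (- s * of_real a) / s)"
        unfolding L_def
      proof (rule integral_FTC_Icc[OF T])
        show "continuous_on {a..T} (\<lambda>v. exp (- s * of_real v))" by (intro continuous_intros)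
        fix v
        have "((\<lambda>z. - exp (- s * z) / s) has_field_derivative exp (- s * of_real v)) (at (of_real v))"
          using s by (auto intro!: derivative_eq_intros)
        then show "((\<lambda>v. - exp (- s * of_real v) / s) has_vector_derivative exp (- s * of_real v)) (at v within {a..T})"
          by (rule has_vector_derivative_at_within[OF has_vector_derivative_real_field])
      qed
      then show "L T = exp (- s * of_real a) / s - exp (- s * of_real T) / s" by simp
    qed
    moreover have "((\<lambda>T. exp (- s * of_real a) / s - exp (- s * of_real T) / s) \<longlongrightarrow> exp (- s * of_real a) / s - 0 / s) at_top"
    proof (intro tendsto_diff tendsto_const tendsto_divide)
      have "((\<lambda>T. norm (exp (- s * of_real T))) \<longlongrightarrow> 0) at_top"
        using s by simp real_asymp
      then show "((\<lambda>T. exp (- s * complex_of_real T)) \<longlongrightarrow> 0) at_top" by (rule tendsto_norm_zero_cancel)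
    qed (use s in auto)
    ultimately show ?thesis by (simp add: tendsto_cong)
  qed
  ultimately show "(\<integral>v. indicat_real {a..} v *\<^sub>R exp (- s * of_real v) \<partial>lborel) = exp (- s * of_real a) / s"
    using tendsto_unique[OF trivial_limit_at_top_linorder] by blast
qed

lemma integrable_logpsi:
  assumes "\<And>n. norm (\<Lambda> (Suc n)) \<le> K * real (Suc n) powr (3/2)"
  shows "integrable lborel (\<lambda>v. norm (logpsi \<Lambda> M v) * exp (- 3 * v))"
proof -
  have "integrable lborel (\<lambda>v. (K + \<bar>M\<bar>) * (indicat_real {0..} v * exp (- (1/2) * v)))"
    using set_integrable_exp_half_line[of "1/2" 0] by (simp add: set_integrable_def)
  then show ?thesis
  proof (rule Bochner_Integration.integrable_bound)
    show "AE v in lborel. norm (norm (logpsi \<Lambda> M v) * exp (- 3 * v)) \<le> norm ((K + \<bar>M\<bar>) * (indicat_real {0..} v * exp (- (1/2) * v)))"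
    proof (rule AE_I2)
      fix v :: real
      have "norm (logpsi \<Lambda> M v) * exp (- 3 * v) \<le> ((K + \<bar>M\<bar>) * indicat_real {0..} v * exp (5/2 * v)) * exp (- 3 * v)"
        by (intro mult_right_mono logpsi_growth assms) auto
      also have "\<dots> = (K + \<bar>M\<bar>) * (indicat_real {0..} v * (exp (5/2 * v) * exp (- 3 * v)))" by (simp only: mult.assoc)
      also have "exp (5/2 * v) * exp (- 3 * v) = exp (- (1/2) * v)" by (simp add: exp_add[symmetric])
      finally show "norm (norm (logpsi \<Lambda> M v) * exp (- 3 * v)) \<le> norm ((K + \<bar>M\<bar>) * (indicat_real {0..} v * exp (- (1/2) * v)))"
        unfolding real_norm_def abs_of_nonneg[OF mult_nonneg_nonneg[OF norm_ge_zero exp_ge_zero]]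
        by (rule order_trans[OF _ abs_ge_self])
    qed
  qed measurable
qed

text \<open>\<open>psiF \<Lambda> (exp v)\<close> is a sum of steps of height
  \<open>\<Lambda> n\<close> switched on at \<open>v = ln n\<close>, and such a step has transform
  \<open>\<Lambda> n * n powr (- s) / s\<close>. On \<open>Re s = 3\<close> the L1 norms of the
  steps are at most of order \<open>n powr (- 3/2)\<close>, so termwise integration is
  legitimate.\<close>

lemma laplace_logpsi:
  assumes ld: "log_deriv_coeffs F \<Lambda>" and s: "Re s = 3"
  shows "(\<integral>v. logpsi \<Lambda> M v * exp (- s * of_real v) \<partial>lborel) = - (deriv F s / F s) / s - of_real M / (s - 1)"
proof -
  obtain K where K: "K > 0" "\<And>n. norm (\<Lambda> (Suc n)) \<le> K * real (Suc n) powr (3/2)"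
    using log_deriv_coeffs_growth[OF ld] by blast
  define f where "f = (\<lambda>n v. \<Lambda> (Suc n) * (indicat_real {ln (real (Suc n))..} v *\<^sub>R exp (- s * of_real v)))"
  have s0: "Re s > 0" "Re (s - 1) > 0" using s by auto
  have fi: "integrable lborel (f n)" for n
    unfolding f_def by (intro integrable_mult_right integral_cexp_half_line(1) s0)
  have If: "(\<integral>v. f n v \<partial>lborel) = \<Lambda> (Suc n) / of_nat (Suc n) powr s / s" for n
  proof -
    have "(\<integral>v. f n v \<partial>lborel) = \<Lambda> (Suc n) * (exp (- s * of_real (ln (real (Suc n)))) / s)"
      unfolding f_def by (simp only: integral_mult_right_zero integral_cexp_half_line(2)[OF s0(1)])
    also have "exp (- s * of_real (ln (real (Suc n)))) = 1 / of_nat (Suc n) powr s"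
    proof -
      have "Ln (of_nat (Suc n)) = of_real (ln (real (Suc n)))"
        using Ln_of_real[of "real (Suc n)"] by (simp only: of_real_of_nat_eq of_nat_0_less_iff zero_less_Suc)
      moreover have "complex_of_nat (Suc n) \<noteq> 0" by (simp only: of_nat_eq_0_iff nat.distinct not_False_eq_True)
      ultimately show ?thesis by (simp only: powr_def if_False mult_minus_left exp_minus inverse_eq_divide)
    qed
    finally show ?thesis by simp
  qed
  have nf: "norm (f n v) = norm (\<Lambda> (Suc n)) * (indicat_real {ln (real (Suc n))..} v * exp (- 3 * v))" for n v
    using s by (simp add: f_def norm_mult)
  have Inf: "(\<integral>v. norm (f n v) \<partial>lborel) \<le> K * real (Suc n) powr (- 3/2)" for n
  proof -
    have "complex_of_real (\<integral>v. indicat_real {ln (real (Suc n))..} v * exp (- 3 * v) \<partial>lborel) =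
       (\<integral>v. complex_of_real (indicat_real {ln (real (Suc n))..} v * exp (- 3 * v)) \<partial>lborel)" by (rule integral_complex_of_real[symmetric])
    also have "\<dots> = (\<integral>v. indicat_real {ln (real (Suc n))..} v *\<^sub>R exp (- 3 * complex_of_real v) \<partial>lborel)"
      by (intro Bochner_Integration.integral_cong) (auto simp: scaleR_conv_of_real exp_of_real[symmetric])
    also have "\<dots> = exp (- 3 * of_real (ln (real (Suc n)))) / 3"
      by (rule integral_cexp_half_line(2)) simp
    also have "\<dots> = of_real (exp (- 3 * ln (real (Suc n))) / 3)" by (simp add: exp_of_real[symmetric])
    finally have e: "(\<integral>v. indicat_real {ln (real (Suc n))..} v * exp (- 3 * v) \<partial>lborel) = exp (- 3 * ln (real (Suc n))) / 3"
      by (simp only: of_real_eq_iff)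
    have "(\<integral>v. norm (f n v) \<partial>lborel) = norm (\<Lambda> (Suc n)) * (exp (- 3 * ln (real (Suc n))) / 3)"
      unfolding nf by (simp only: integral_mult_right_zero e)
    also have "exp (- 3 * ln (real (Suc n))) = real (Suc n) powr (- 3)" by (simp add: powr_def)
    also have "norm (\<Lambda> (Suc n)) * (real (Suc n) powr (- 3) / 3) \<le> (K * real (Suc n) powr (3/2)) * (real (Suc n) powr (- 3))"
      using K(1) by (intro mult_mono K) auto
    also have "\<dots> = K * real (Suc n) powr (- 3/2)" by (simp add: mult.assoc powr_add[symmetric])
    finally show ?thesis .
  qed
  have sm: "summable (\<lambda>n. \<integral>v. norm (f n v) \<partial>lborel)"
  proof (rule summable_comparison_test')
    have "summable (\<lambda>n. real n powr (- 3/2))" by (simp add: summable_real_powr_iff)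
    then have "summable (\<lambda>n. real (Suc n) powr (- 3/2))" by (subst summable_Suc_iff)
    then show "summable (\<lambda>n. K * real (Suc n) powr (- 3/2))" by (rule summable_mult)
    fix n show "norm (\<integral>v. norm (f n v) \<partial>lborel) \<le> K * real (Suc n) powr (- 3/2)"
      using Inf[of n] by (simp add: integral_nonneg_AE)
  qed
  have pt: "(\<lambda>n. f n v) sums (psiF \<Lambda> (exp v) * exp (- s * of_real v))" for v
  proof -
    let ?N = "nat \<lfloor>exp v\<rfloor>"
    have ind: "(ln (real (Suc n)) \<le> v) \<longleftrightarrow> n < ?N" for n
    proof -
      have "(ln (real (Suc n)) \<le> v) \<longleftrightarrow> real (Suc n) \<le> exp v"
        by (metis exp_le_cancel_iff exp_ln of_nat_0_less_iff zero_less_Suc)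
      also have "\<dots> \<longleftrightarrow> Suc n \<le> ?N" by (simp add: le_nat_floor le_floor_iff nat_le_iff) linarith
      finally show ?thesis by (simp only: Suc_le_eq)
    qed
    have "(\<lambda>n. f n v) sums (\<Sum>n<?N. f n v)"
      by (rule sums_finite) (auto simp: f_def indicator_def ind simp del: of_nat_Suc)
    also have "(\<Sum>n<?N. f n v) = (\<Sum>n<?N. \<Lambda> (Suc n) * exp (- s * of_real v))"
      by (intro sum.cong) (auto simp: f_def indicator_def ind simp del: of_nat_Suc)
    also have "\<dots> = (\<Sum>n<?N. \<Lambda> (Suc n)) * exp (- s * of_real v)" by (rule sum_distrib_right[symmetric])
    also have "(\<Sum>n<?N. \<Lambda> (Suc n)) = psiF \<Lambda> (exp v)"
      unfolding psiF_def by (rule sum.reindex_bij_witness[of _ "\<lambda>n. n - 1" Suc]) auto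
    finally show ?thesis .
  qed
  have AEs: "AE v in lborel. summable (\<lambda>n. norm (f n v))"
  proof (rule AE_I2)
    fix v
    have "norm (f n v) = 0" if "n \<notin> {..<nat \<lceil>exp v\<rceil>}" for n
    proof -
      have "exp v < real (Suc n)" using that by (simp add: nat_le_iff ceiling_le_iff) linarith
      then have "v < ln (real (Suc n))" by (metis ln_exp ln_less_cancel_iff exp_gt_zero of_nat_0_less_iff zero_less_Suc)
      then show ?thesis by (simp add: f_def)
    qed
    then show "summable (\<lambda>n. norm (f n v))" by (intro summable_finite[of "{..<nat \<lceil>exp v\<rceil>}"]) auto
  qed
  have "(\<lambda>n. \<integral>v. f n v \<partial>lborel) sums (\<integral>v. (\<Sum>n. f n v) \<partial>lborel)"
    by (rule sums_integral[OF fi AEs sm])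
  moreover have "(\<lambda>n. \<integral>v. f n v \<partial>lborel) sums (- (deriv F s / F s) / s)"
    unfolding If using ld s unfolding log_deriv_coeffs_def by (intro sums_divide) auto
  ultimately have "(\<integral>v. (\<Sum>n. f n v) \<partial>lborel) = - (deriv F s / F s) / s"
    by (rule sums_unique2)
  moreover have "(\<Sum>n. f n v) = psiF \<Lambda> (exp v) * exp (- s * of_real v)" for v
    using pt[of v] by (simp add: sums_iff)
  ultimately have I1: "(\<integral>v. psiF \<Lambda> (exp v) * exp (- s * of_real v) \<partial>lborel) = - (deriv F s / F s) / s"
    by (simp only:)
  have int1: "integrable lborel (\<lambda>v. psiF \<Lambda> (exp v) * exp (- s * of_real v))"
    using integrable_suminf[OF fi AEs sm] pt by (simp add: sums_iff)
  define h where "h = (\<lambda>v. of_real M * (indicat_real {0..} v *\<^sub>R exp (- (s - 1) * of_real v)))"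
  have int2: "integrable lborel h"
    unfolding h_def by (intro integrable_mult_right integral_cexp_half_line(1) s0)
  have I2: "(\<integral>v. h v \<partial>lborel) = of_real M / (s - 1)"
    unfolding h_def by (simp only: integral_mult_right_zero integral_cexp_half_line(2)[OF s0(2)]) simp
  have "logpsi \<Lambda> M v * exp (- s * of_real v) = psiF \<Lambda> (exp v) * exp (- s * of_real v) - h v" for v
  proof (cases "v \<ge> 0")
    case True
    have "exp (- (s - 1) * of_real v) = of_real (exp v) * exp (- s * of_real v)"
      unfolding exp_of_real[symmetric] exp_add[symmetric] by (simp add: algebra_simps)
    then show ?thesis using True by (simp add: logpsi_def h_def algebra_simps)
  next
    case False
    then show ?thesis by (simp add: logpsi_def h_def psiF_less_1)
  qed
  then have "(\<integral>v. logpsi \<Lambda> M v * exp (- s * of_real v) \<partial>lborel) = (\<integral>v. psiF \<Lambda> (exp v) * exp (- s * of_real v) - h v \<partial>lborel)"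
    by simp
  also have "\<dots> = (\<integral>v. psiF \<Lambda> (exp v) * exp (- s * of_real v) \<partial>lborel) - (\<integral>v. h v \<partial>lborel)"
    by (rule Bochner_Integration.integral_diff[OF int1 int2])
  finally show ?thesis by (simp only: I1 I2)
qed

section \<open>Mean squares of multiplicative increments under GRH\<close>

lemma norm_cexp_minus_1_le:
  fixes s :: complex
  assumes "lam \<ge> 0" "Re s \<ge> 0"
  shows "norm (exp (of_real lam * s) - 1) \<le> norm s * lam * exp (lam * Re s)"
proof -
  define S where "S = closed_segment 0 (of_real lam * s)"
  have re: "Re z \<le> lam * Re s" if "z \<in> S" for z
  proof -
    from that obtain u where u: "0 \<le> u" "u \<le> 1" "z = u *\<^sub>R (of_real lam * s)"
      by (auto simp: S_def in_segment)
    have "Re z = u * (lam * Re s)" using u by simp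
    also have "\<dots> \<le> 1 * (lam * Re s)" using u assms by (intro mult_right_mono) auto
    finally show ?thesis by simp
  qed
  have cv: "convex S" and mem: "of_real lam * s \<in> S" "0 \<in> S" by (simp_all add: S_def)
  have d: "(exp has_field_derivative exp z) (at z within S)" for z
    by (rule DERIV_exp[THEN has_field_derivative_at_within])
  have b: "norm (exp z) \<le> exp (lam * Re s)" if "z \<in> S" for z using re[OF that] by simp
  have "norm (exp (of_real lam * s) - exp 0) \<le> exp (lam * Re s) * norm (of_real lam * s - 0)"
    by (rule field_differentiable_bound[where f = exp and f' = exp and S = S, OF cv d b mem])
  then show ?thesis using assms by (simp add: norm_mult mult_ac)
qed

text \<open>Interpolates between the bounds \<open>a\<close> and 2; the exponent just below 1 makes the integral over the
  line converge.\<close>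
lemma min_square_le_powr:
  fixes a :: real
  assumes "a \<ge> 0" "0 < \<epsilon>" "\<epsilon> < 1" "y \<ge> 0" "y \<le> a" "y \<le> 2"
  shows "y\<^sup>2 \<le> 4 * a powr (1 - \<epsilon>)"
proof (cases "a \<le> 1")
  case True
  show ?thesis
  proof (cases "a = 0")
    case True then show ?thesis using assms by simp
  next
    case False
    have "y\<^sup>2 \<le> a\<^sup>2" using assms by (intro power_mono) auto
    also have "\<dots> = a powr 2" using False assms by (simp add: powr_realpow)
    also have "\<dots> \<le> a powr (1 - \<epsilon>)" using assms True False by (intro powr_mono') auto
    also have "\<dots> \<le> 4 * a powr (1 - \<epsilon>)" by simp
    finally show ?thesis .
  qed
next
  case False
  have "y\<^sup>2 \<le> 2\<^sup>2" using assms by (intro power_mono) auto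
  also have "\<dots> \<le> 4 * a powr (1 - \<epsilon>)" using False assms by (simp add: ge_one_powr_ge_zero)
  finally show ?thesis .
qed

text \<open>Away from 1 the function \<open>F\<close> is \<open>g0\<close> times the integer power
  \<open>k - m\<close> of \<open>s - 1\<close>, possibly a negative one. The coefficient
  \<open>k - m\<close> decides which main term has to be subtracted from
  \<open>psiF\<close>.\<close>

lemma log_deriv_factor:
  fixes F g0 :: "complex \<Rightarrow> complex"
  assumes g: "\<And>s. s \<noteq> 1 \<Longrightarrow> (s - 1) ^ k * g0 s = (s - 1) ^ m * F s"
    and hol0: "g0 holomorphic_on UNIV" and s: "s \<noteq> 1" "g0 s \<noteq> 0"
  shows "deriv F s / F s = of_real (real k - real m) / (s - 1) + deriv g0 s / g0 s"
proof -
  define G where "G = (\<lambda>z. (z - 1) ^ k * g0 z / (z - 1) ^ m)"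
  have eq: "F z = G z" if "z \<noteq> 1" for z using g[OF that] that by (simp add: G_def)
  have d0: "(g0 has_field_derivative deriv g0 s) (at s)" by (rule holomorphic_derivI[OF hol0]) auto
  have pw: "((\<lambda>z. (z - 1) ^ n) has_field_derivative (of_nat n * (s - 1) ^ n / (s - 1))) (at s)" for n
  proof -
    have "of_nat n * (s - 1) ^ n / (s - 1) = of_nat n * (s - 1) ^ (n - 1)" using s by (cases n) auto
    then show ?thesis by (auto intro!: derivative_eq_intros)
  qed
  define w where "w = s - 1"
  have w: "w \<noteq> 0" using s by (simp add: w_def)
  define E where "E = ((of_nat k * w ^ k / w * g0 s + deriv g0 s * w ^ k) * w ^ m - w ^ k * g0 s * (of_nat m * w ^ m / w)) / (w ^ m * w ^ m)"
  have dG: "(G has_field_derivative E) (at s)"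
    unfolding G_def E_def w_def
    by (rule DERIV_cong[OF DERIV_divide[OF DERIV_mult[OF pw d0] pw]]) (use s in \<open>auto simp: mult_ac\<close>)
  have "eventually (\<lambda>z. F z = G z) (nhds s)"
  proof (rule eventually_mono)
    show "eventually (\<lambda>z. z \<in> - {1}) (nhds s)" using s by (intro eventually_nhds_in_open open_Compl) auto
  qed (auto intro: eq)
  then have "deriv F s = deriv G s" by (rule deriv_cong_ev) simp
  also have "\<dots> = E" by (rule DERIV_imp_deriv[OF dG])
  finally have "deriv F s / F s = E / (w ^ k * g0 s / w ^ m)" using eq[OF s(1)] by (simp add: G_def w_def)
  also have "\<dots> = of_nat k / w - of_nat m / w + deriv g0 s / g0 s"
    using w s(2) unfolding E_def by (simp add: field_simps)
  finally show ?thesis by (simp add: w_def diff_divide_distrib)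
qed

text \<open>The substitution \<open>x = exp u\<close> turns a multiplicative increment into
  \<open>D u\<close>, a difference of \<open>logpsi\<close> at distance
  \<open>l = ln (1 + \<delta>)\<close>, whose transform is \<open>(exp (l * s) - 1) * L s\<close>.
  Apart from a power of \<open>1 + \<delta>\<close>, the squares of the two factors on
  \<open>Re s = 1/2 + \<epsilon>\<close> are at most of order
  \<open>(\<delta> * norm s) powr (1 - \<epsilon>)\<close> and
  \<open>(1 + |Im s|) powr (\<epsilon> / 2 - 2)\<close>; the product is integrable and leaves
  \<open>\<delta> powr (1 - \<epsilon>)\<close>.\<close>

lemma selberg_mean_square:
  fixes F g g0 :: "complex \<Rightarrow> complex"
  assumes rep: "dirichlet_rep a F" and fe: "functional_eq F Q r lam mu eps"
    and g: "entire_finite_order g" "\<And>s. s \<noteq> 1 \<Longrightarrow> g s = (s - 1) ^ m * F s"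
    and hol0: "g0 holomorphic_on UNIV" and g0: "\<And>s. g s = (s - 1) ^ k * g0 s"
    and nz: "\<And>s. Re s > 1/2 \<Longrightarrow> g0 s \<noteq> 0"
    and ld: "log_deriv_coeffs F \<Lambda>" and \<epsilon>: "0 < \<epsilon>" "\<epsilon> \<le> 1/4"
  obtains C where "C > 0" "\<And>\<delta> X. \<delta> > 0 \<Longrightarrow> X \<ge> 1 \<Longrightarrow>
     (\<integral>\<^sup>+x. ennreal (indicat_real {1..X} x * (norm (psiF \<Lambda> (x + \<delta> * x) - psiF \<Lambda> x - of_real ((real m - real k) * \<delta> * x)))\<^sup>2) \<partial>lborel)
     \<le> ennreal (C * X powr (2 + 2 * \<epsilon>) * \<delta> powr (1 - \<epsilon>) * (1 + \<delta>) powr (1 + 2 * \<epsilon>))"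
proof -
  define M where "M = real m - real k"
  define \<sigma> where "\<sigma> = 1/2 + \<epsilon>"
  have \<sigma>: "1/2 < \<sigma>" "\<sigma> \<le> 3/4" using \<epsilon> by (auto simp: \<sigma>_def)
  \<comment> \<open>The exponent \<open>\<epsilon> / 4\<close> doubles on squaring and leaves a
    decay of exponent \<open>1 + \<epsilon> / 2\<close> on the line.\<close>
  obtain C1 where C1: "C1 > 0" and ldb: "\<And>s. \<sigma> \<le> Re s \<Longrightarrow> Re s \<le> 3 \<Longrightarrow> norm (deriv g0 s / g0 s) \<le> C1 * (1 + \<bar>Im s\<bar>) powr (\<epsilon> / 4)"
  proof (rule log_deriv_bound[OF rep fe g(1) g(2) hol0 g0 nz, of \<sigma> "\<epsilon> / 4"])
    show "\<sigma> > 1/2" "\<epsilon> / 4 > 0" using \<sigma> \<epsilon> by auto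
  qed blast+
  obtain K where K: "K > 0" "\<And>n. norm (\<Lambda> (Suc n)) \<le> K * real (Suc n) powr (3/2)"
    using log_deriv_coeffs_growth[OF ld] by blast
  \<comment> \<open>The transform of \<open>logpsi \<Lambda> M\<close>: the polar parts
    \<open>M / (s * (s - 1))\<close> and \<open>- M / (s - 1)\<close> combine to
    \<open>- M / s\<close>, so no pole at 1 remains.\<close>
  define L where "L = (\<lambda>s. - (of_real M + deriv g0 s / g0 s) / s)"
  define C2 where "C2 = \<bar>M\<bar> + C1"
  have C2: "C2 > 0" using C1 by (simp add: C2_def)
  have s_low: "(1 + \<bar>Im s\<bar>) / 3 \<le> norm s" if "Re s \<ge> 1/2" for s
    using complex_Re_le_cmod[of s] abs_Im_le_cmod[of s] that by simp
  have Lb: "norm (L s) \<le> C2 * (1 + \<bar>Im s\<bar>) powr (\<epsilon> / 4) / norm s" if s: "\<sigma> \<le> Re s" "Re s \<le> 3" for s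
  proof -
    have 1: "1 \<le> (1 + \<bar>Im s\<bar>) powr (\<epsilon> / 4)" using \<epsilon> by (intro ge_one_powr_ge_zero) auto
    have "norm (of_real M + deriv g0 s / g0 s) \<le> norm (complex_of_real M) + norm (deriv g0 s / g0 s)" by (rule norm_triangle_ineq)
    also have "\<dots> \<le> \<bar>M\<bar> * (1 + \<bar>Im s\<bar>) powr (\<epsilon> / 4) + C1 * (1 + \<bar>Im s\<bar>) powr (\<epsilon> / 4)"
      using ldb[OF s] mult_left_mono[OF 1, of "\<bar>M\<bar>"] by simp
    also have "\<dots> = C2 * (1 + \<bar>Im s\<bar>) powr (\<epsilon> / 4)" by (simp add: C2_def algebra_simps)
    finally have "norm (of_real M + deriv g0 s / g0 s) / norm s \<le> C2 * (1 + \<bar>Im s\<bar>) powr (\<epsilon> / 4) / norm s" by (rule divide_right_mono) simp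
    then show ?thesis by (simp only: L_def norm_divide norm_minus_cancel)
  qed
  have holL: "L holomorphic_on {s. Re s > 1/2}"
  proof -
    have "deriv g0 holomorphic_on UNIV" by (rule holomorphic_deriv[OF hol0]) simp
    then show ?thesis unfolding L_def
      by (intro holomorphic_intros holomorphic_on_subset[OF hol0] holomorphic_on_subset[of "deriv g0" UNIV]) (auto simp: nz)
  qed
  have L3: "(\<integral>v. logpsi \<Lambda> M v * exp (- s * of_real v) \<partial>lborel) = L s" if s: "Re s = 3" for s
  proof -
    have s1: "s \<noteq> 1" "s \<noteq> 0" using s by auto
    have "deriv F s / F s = of_real (real k - real m) / (s - 1) + deriv g0 s / g0 s"
      by (rule log_deriv_factor[OF _ hol0]) (use g(2) g0 s1 nz s in auto)
    then have "- (deriv F s / F s) / s - of_real M / (s - 1) = - (of_real (- M) / (s - 1) + deriv g0 s / g0 s) / s - of_real M / (s - 1)"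
      by (simp add: M_def)
    also have "\<dots> = L s"
    proof -
      have "- (- x / w + y) / (w + 1) - x / w = - (x + y) / (w + 1)" if "w \<noteq> 0" "w + 1 \<noteq> 0" for x y w :: complex
      proof -
        have "- (- z + y) / (w + 1) - z = - (z * w + y) / (w + 1)" for z using that(2) by (simp add: field_simps)
        from this[of "x / w"] show ?thesis using that(1) by simp
      qed
      from this[of "s - 1" "of_real M" "deriv g0 s / g0 s"] s1 show ?thesis by (simp add: L_def)
    qed
    finally show ?thesis using laplace_logpsi[OF ld s] by simp
  qed
  define J where "J = (\<integral>t. (1 + \<bar>t::real\<bar>) powr (- 1 - \<epsilon> / 2) \<partial>lborel)"
  define C3 where "C3 = 4 * C2\<^sup>2 * 3 powr (1 + \<epsilon>)"
  define C where "C = 2 * (C3 * J / (2 * pi)) + 1"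
  have J0: "J \<ge> 0" unfolding J_def by (intro integral_nonneg_AE AE_I2) auto
  have C0: "C > 0" using C2 J0 by (simp add: C_def C3_def add_nonneg_pos)
  show ?thesis
  proof (rule that[OF C0])
    fix \<delta> X :: real assume \<delta>: "\<delta> > 0" and X: "X \<ge> 1"
    define l where "l = ln (1 + \<delta>)"
    have l: "l > 0" "exp l = 1 + \<delta>" "l \<le> \<delta>" using \<delta> ln_le_minus_one[of "1 + \<delta>"] by (auto simp: l_def)
    define D where "D = (\<lambda>u. logpsi \<Lambda> M (u + l) - logpsi \<Lambda> M u)"
    define H where "H = (\<lambda>s. (exp (of_real l * s) - 1) * L s)"
    define P where "P = \<delta> powr (1 - \<epsilon>) * (1 + \<delta>) powr (1 + 2 * \<epsilon>)"
    have [measurable]: "D \<in> borel_measurable borel" unfolding D_def by measurable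
    have lp: "norm (logpsi \<Lambda> M u) \<le> (K + \<bar>M\<bar>) * exp (3 * \<bar>u\<bar>)" for u
    proof -
      have "indicat_real {0..} u * exp (5/2 * u) \<le> exp (3 * \<bar>u\<bar>)" by (auto simp: indicator_def)
      then have "(K + \<bar>M\<bar>) * (indicat_real {0..} u * exp (5/2 * u)) \<le> (K + \<bar>M\<bar>) * exp (3 * \<bar>u\<bar>)"
        using K by (intro mult_left_mono) auto
      then show ?thesis using logpsi_growth[OF K(2), of M u] by (simp only: mult.assoc)
    qed
    have growth: "norm (D v) \<le> ((K + \<bar>M\<bar>) * (exp (3 * l) + 1)) * exp (3 * \<bar>v\<bar>)" for v
    proof -
      have "norm (D v) \<le> norm (logpsi \<Lambda> M (v + l)) + norm (logpsi \<Lambda> M v)" unfolding D_def by (rule norm_triangle_ineq4)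
      also have "\<dots> \<le> (K + \<bar>M\<bar>) * exp (3 * \<bar>v + l\<bar>) + (K + \<bar>M\<bar>) * exp (3 * \<bar>v\<bar>)" by (intro add_mono lp)
      also have "exp (3 * \<bar>v + l\<bar>) \<le> exp (3 * l) * exp (3 * \<bar>v\<bar>)" using l abs_triangle_ineq[of v l] by (simp add: exp_add[symmetric])
      then have "(K + \<bar>M\<bar>) * exp (3 * \<bar>v + l\<bar>) \<le> (K + \<bar>M\<bar>) * (exp (3 * l) * exp (3 * \<bar>v\<bar>))" using K by (intro mult_left_mono) auto
      finally show ?thesis by (simp add: algebra_simps)
    qed
    have i0: "integrable lborel (\<lambda>v. norm (logpsi \<Lambda> M v) * exp (- 3 * v))" by (rule integrable_logpsi[OF K(2)])
    have i1: "integrable lborel (\<lambda>v. norm (logpsi \<Lambda> M (v + l)) * exp (- 3 * v))"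
    proof -
      have "integrable lborel (\<lambda>v. exp (3 * l) * (norm (logpsi \<Lambda> M (l + 1 * v)) * exp (- 3 * (l + 1 * v))))"
        by (intro integrable_mult_right lborel_integrable_real_affine[OF i0]) simp
      moreover have "exp (3 * l) * (norm (logpsi \<Lambda> M (l + 1 * v)) * exp (- 3 * (l + 1 * v))) = norm (logpsi \<Lambda> M (v + l)) * exp (- 3 * v)" for v
      proof -
        have "exp (3 * l) * exp (- 3 * (l + 1 * v)) = exp (- 3 * v)" by (simp add: exp_add[symmetric])
        then show ?thesis by (metis add.commute mult.left_commute mult_1)
      qed
      ultimately show ?thesis by (simp only:)
    qed
    have int: "integrable lborel (\<lambda>v. norm (D v) * exp (- 3 * v))"
    proof (rule Bochner_Integration.integrable_bound[OF Bochner_Integration.integrable_add[OF i1 i0]])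
      show "AE v in lborel. norm (norm (D v) * exp (- 3 * v)) \<le> norm (norm (logpsi \<Lambda> M (v + l)) * exp (- 3 * v) + norm (logpsi \<Lambda> M v) * exp (- 3 * v))"
      proof (rule AE_I2)
        fix v
        have "norm (D v) * exp (- 3 * v) \<le> (norm (logpsi \<Lambda> M (v + l)) + norm (logpsi \<Lambda> M v)) * exp (- 3 * v)"
          unfolding D_def by (intro mult_right_mono norm_triangle_ineq4) simp
        then show "norm (norm (D v) * exp (- 3 * v)) \<le> norm (norm (logpsi \<Lambda> M (v + l)) * exp (- 3 * v) + norm (logpsi \<Lambda> M v) * exp (- 3 * v))"
          by (simp add: distrib_right)
      qed
    qed measurable
    \<comment> \<open>The points where \<open>exp u\<close> or \<open>exp (u + l)\<close> meets a
      jump of \<open>psiF\<close>; the jumps of the two cut-offs are among them.\<close>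
    define S where "S = {u. exp u \<in> \<int>} \<union> {u. exp (u + l) \<in> \<int>}"
    have cS: "countable S"
    proof (rule countable_subset)
      show "S \<subseteq> range (\<lambda>n::int. ln (real_of_int n)) \<union> range (\<lambda>n::int. ln (real_of_int n) - l)"
      proof
        fix u assume "u \<in> S"
        then consider n :: int where "exp u = real_of_int n" | n :: int where "exp (u + l) = real_of_int n"
          unfolding S_def by (auto elim!: Ints_cases)
        then show "u \<in> range (\<lambda>n::int. ln (real_of_int n)) \<union> range (\<lambda>n::int. ln (real_of_int n) - l)"
        proof cases
          case 1 then have "u = ln (real_of_int n)" by (metis ln_exp)
          then show ?thesis by blast
        next
          case 2 then have "u = ln (real_of_int n) - l" by (metis ln_exp add_diff_cancel_right')
          then show ?thesis by blast
        qed
      qed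
    qed auto
    have contD: "isCont D u" if "u \<notin> S" for u
    proof -
      have 1: "isCont (logpsi \<Lambda> M) u" "isCont (logpsi \<Lambda> M) (u + l)"
        using that by (auto simp: S_def intro!: isCont_logpsi)
      have "isCont (\<lambda>u. logpsi \<Lambda> M (u + l)) u"
        using isCont_o2[of u "\<lambda>u. u + l" "logpsi \<Lambda> M"] 1 by (simp add: continuous_intros)
      then show ?thesis unfolding D_def using 1 by (intro continuous_intros)
    qed
    have holH: "H holomorphic_on {s. Re s > 1/2}" unfolding H_def by (intro holomorphic_intros holL)
    have H3: "H (Complex 3 t) = (\<integral>v. D v * exp (- Complex 3 t * of_real v) \<partial>lborel)" for t
    proof -
      let ?s = "Complex 3 t"
      have c0: "integrable lborel (\<lambda>v. logpsi \<Lambda> M v * exp (- ?s * of_real v))"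
        by (rule Bochner_Integration.integrable_bound[OF i0]) (auto simp: norm_mult)
      have c1: "integrable lborel (\<lambda>v. logpsi \<Lambda> M (v + l) * exp (- ?s * of_real v))"
        by (rule Bochner_Integration.integrable_bound[OF i1]) (auto simp: norm_mult)
      have "L ?s = \<bar>1\<bar> *\<^sub>R (\<integral>v. logpsi \<Lambda> M (l + 1 * v) * exp (- ?s * of_real (l + 1 * v)) \<partial>lborel)"
        unfolding L3[OF complex.sel(1), symmetric] by (rule lborel_integral_real_affine) simp
      also have "\<dots> = (\<integral>v. exp (- ?s * of_real l) * (logpsi \<Lambda> M (v + l) * exp (- ?s * of_real v)) \<partial>lborel)"
      proof -
        have "logpsi \<Lambda> M (l + 1 * v) * exp (- ?s * of_real (l + 1 * v)) = exp (- ?s * of_real l) * (logpsi \<Lambda> M (v + l) * exp (- ?s * of_real v))" for v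
        proof -
          have "exp (- ?s * of_real (l + 1 * v)) = exp (- ?s * of_real l) * exp (- ?s * of_real v)"
            by (simp add: exp_add[symmetric] distrib_left)
          then show ?thesis by (simp add: add.commute mult_ac)
        qed
        then show ?thesis by (simp only: abs_one scaleR_one)
      qed
      also have "\<dots> = exp (- ?s * of_real l) * (\<integral>v. logpsi \<Lambda> M (v + l) * exp (- ?s * of_real v) \<partial>lborel)" by (rule integral_mult_right_zero)
      finally have "exp (of_real l * ?s) * L ?s = (exp (of_real l * ?s) * exp (- ?s * of_real l)) * (\<integral>v. logpsi \<Lambda> M (v + l) * exp (- ?s * of_real v) \<partial>lborel)"
        by (simp only: mult.assoc)
      also have "exp (of_real l * ?s) * exp (- ?s * of_real l) = 1" by (simp add: exp_add[symmetric] mult.commute)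
      finally have e: "(\<integral>v. logpsi \<Lambda> M (v + l) * exp (- ?s * of_real v) \<partial>lborel) = exp (of_real l * ?s) * L ?s" by simp
      have "(\<integral>v. D v * exp (- ?s * of_real v) \<partial>lborel) = (\<integral>v. logpsi \<Lambda> M (v + l) * exp (- ?s * of_real v) - logpsi \<Lambda> M v * exp (- ?s * of_real v) \<partial>lborel)"
        by (simp only: D_def left_diff_distrib)
      also have "\<dots> = exp (of_real l * ?s) * L ?s - L ?s"
        using L3[of ?s] by (subst Bochner_Integration.integral_diff[OF c1 c0]) (simp only: e complex.sel)
      finally show ?thesis by (simp add: H_def algebra_simps)
    qed
    have strip: "norm (H s) \<le> ((exp (3 * l) + 1) * (2 * C2)) * (1 + \<bar>Im s\<bar>)" if s: "\<sigma> \<le> Re s" "Re s \<le> 3" for s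
    proof -
      have "norm (exp (of_real l * s) - 1) \<le> norm (exp (of_real l * s)) + 1"
        using norm_triangle_ineq4[of "exp (of_real l * s)" 1] by simp
      also have "norm (exp (of_real l * s)) \<le> exp (3 * l)" using l s by (simp add: mult.commute)
      finally have 1: "norm (exp (of_real l * s) - 1) \<le> exp (3 * l) + 1" by simp
      have ns: "norm s \<ge> 1/2" using abs_Re_le_cmod[of s] s \<sigma> by linarith
      have "norm (L s) \<le> C2 * (1 + \<bar>Im s\<bar>) powr (\<epsilon> / 4) / norm s" by (rule Lb[OF s])
      also have "\<dots> \<le> C2 * (1 + \<bar>Im s\<bar>) powr 1 / (1/2)"
        using C2 ns \<epsilon> by (intro frac_le mult_left_mono powr_mono mult_nonneg_nonneg) auto
      finally have 2: "norm (L s) \<le> 2 * C2 * (1 + \<bar>Im s\<bar>)" by simp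
      have "norm (H s) \<le> (exp (3 * l) + 1) * (2 * C2 * (1 + \<bar>Im s\<bar>))"
        unfolding H_def norm_mult by (intro mult_mono 1 2) (auto intro!: add_nonneg_nonneg)
      then show ?thesis by (simp only: mult.assoc)
    qed
    have Hsq: "(norm (H (Complex \<sigma> t)))\<^sup>2 \<le> C3 * P * (1 + \<bar>t\<bar>) powr (- 1 - \<epsilon> / 2)" for t
    proof -
      let ?s = "Complex \<sigma> t"
      define E where "E = (1 + \<delta>) powr \<sigma>"
      have E: "exp (l * \<sigma>) = E" "E \<ge> 1" using \<delta> \<sigma> by (auto simp: E_def l_def powr_def mult.commute intro!: ge_one_powr_ge_zero)
      \<comment> \<open>Normalised by \<open>E\<close>, the factor is bounded both by
        \<open>norm ?s * \<delta>\<close> and by 2, as the interpolation requires;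
        \<open>E\<^sup>2\<close> reappears as the power of \<open>1 + \<delta>\<close>.\<close>
      define y where "y = norm (exp (of_real l * ?s) - 1) / E"
      have "norm (exp (of_real l * ?s) - 1) \<le> norm ?s * l * exp (l * Re ?s)" by (rule norm_cexp_minus_1_le) (use l \<sigma> in auto)
      also have "\<dots> \<le> norm ?s * \<delta> * E" using l E by (intro mult_mono) auto
      finally have y1: "y \<le> norm ?s * \<delta>" using E by (simp add: y_def divide_le_eq)
      have "norm (exp (of_real l * ?s) - 1) \<le> norm (exp (of_real l * ?s)) + 1"
        using norm_triangle_ineq4[of "exp (of_real l * ?s)" 1] by simp
      also have "\<dots> \<le> 2 * E" using E by simp
      finally have y2: "y \<le> 2" using E by (simp add: y_def divide_le_eq)
      have "y\<^sup>2 \<le> 4 * (norm ?s * \<delta>) powr (1 - \<epsilon>)"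
        by (rule min_square_le_powr) (use \<delta> \<epsilon> y1 y2 E in \<open>auto simp: y_def\<close>)
      also have "(norm ?s * \<delta>) powr (1 - \<epsilon>) = norm ?s powr (1 - \<epsilon>) * \<delta> powr (1 - \<epsilon>)" using \<delta> by (simp add: powr_mult)
      finally have ysq: "y\<^sup>2 \<le> 4 * (norm ?s powr (1 - \<epsilon>) * \<delta> powr (1 - \<epsilon>))" .
      have ns: "norm ?s > 0" using s_low[of ?s] \<sigma> abs_ge_zero[of t] by (simp add: complex_eq_iff)
      have E2: "E\<^sup>2 = (1 + \<delta>) powr (1 + 2 * \<epsilon>)" using \<delta> by (simp add: E_def power2_eq_square powr_add[symmetric] \<sigma>_def)
      have "(norm (H ?s))\<^sup>2 = y\<^sup>2 * E\<^sup>2 * (norm (L ?s))\<^sup>2" using E by (simp add: H_def norm_mult y_def power_mult_distrib power_divide)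
      also have "\<dots> \<le> (4 * (norm ?s powr (1 - \<epsilon>) * \<delta> powr (1 - \<epsilon>))) * E\<^sup>2 * (C2 * (1 + \<bar>t\<bar>) powr (\<epsilon> / 4) / norm ?s)\<^sup>2"
        using Lb[of ?s] \<sigma> ysq order_trans[OF zero_le_one E(2)] by (intro mult_mono power_mono) auto
      also have "\<dots> = 4 * C2\<^sup>2 * P * (1 + \<bar>t\<bar>) powr (\<epsilon> / 2) * norm ?s powr (- 1 - \<epsilon>)"
      proof -
        have "((1 + \<bar>t\<bar>) powr (\<epsilon> / 4))\<^sup>2 = (1 + \<bar>t\<bar>) powr (\<epsilon> / 2)" by (simp add: power2_eq_square powr_add[symmetric])
        moreover have "norm ?s powr (1 - \<epsilon>) / (norm ?s)\<^sup>2 = norm ?s powr (- 1 - \<epsilon>)"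
        proof -
          have "norm ?s powr (1 - \<epsilon>) / norm ?s powr 2 = norm ?s powr (1 - \<epsilon> - 2)" by (rule powr_diff[symmetric])
          then show ?thesis using ns by (simp add: powr_realpow)
        qed
        moreover have "(4 * (A * B)) * X' * (C2 * q / n)\<^sup>2 = 4 * C2\<^sup>2 * (B * X') * q\<^sup>2 * (A / n\<^sup>2)" for A B X' q n :: real
          by (simp add: power_mult_distrib power_divide)
        ultimately show ?thesis unfolding P_def E2 by (simp only:)
      qed
      also have "\<dots> \<le> 4 * C2\<^sup>2 * P * (1 + \<bar>t\<bar>) powr (\<epsilon> / 2) * (3 powr (1 + \<epsilon>) * (1 + \<bar>t\<bar>) powr (- 1 - \<epsilon>))"
      proof (intro mult_left_mono)
        have "norm ?s powr (- 1 - \<epsilon>) \<le> ((1 + \<bar>t\<bar>) / 3) powr (- 1 - \<epsilon>)"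
          using s_low[of ?s] \<sigma> \<epsilon> by (intro powr_mono2') auto
        also have "\<dots> = 3 powr (1 + \<epsilon>) * (1 + \<bar>t\<bar>) powr (- 1 - \<epsilon>)"
        proof -
          have "(3::real) powr (- 1 - \<epsilon>) = 1 / 3 powr (1 + \<epsilon>)" using powr_minus_divide[of 3 "1 + \<epsilon>"] by simp
          then show ?thesis by (simp add: powr_divide)
        qed
        finally show "norm ?s powr (- 1 - \<epsilon>) \<le> 3 powr (1 + \<epsilon>) * (1 + \<bar>t\<bar>) powr (- 1 - \<epsilon>)" .
      qed (auto simp: P_def)
      also have "\<dots> = C3 * P * ((1 + \<bar>t\<bar>) powr (\<epsilon> / 2) * (1 + \<bar>t\<bar>) powr (- 1 - \<epsilon>))" by (simp only: C3_def mult_ac)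
      also have "(1 + \<bar>t\<bar>) powr (\<epsilon> / 2) * (1 + \<bar>t\<bar>) powr (- 1 - \<epsilon>) = (1 + \<bar>t\<bar>) powr (- 1 - \<epsilon> / 2)"
      proof -
        have "\<epsilon> / 2 + (- 1 - \<epsilon>) = - 1 - \<epsilon> / 2" by simp
        then show ?thesis by (simp only: powr_add[symmetric])
      qed
      finally show ?thesis .
    qed
    have ib: "integrable lborel (\<lambda>t. C3 * P * (1 + \<bar>t\<bar>) powr (- 1 - \<epsilon> / 2))"
      using integrable_one_plus_abs_powr[of "\<epsilon> / 2"] \<epsilon> by (intro integrable_mult_right) auto
    have int2: "integrable lborel (\<lambda>t. (norm (H (Complex \<sigma> t)))\<^sup>2)"
    proof (rule Bochner_Integration.integrable_bound[OF ib])
      have "continuous_on UNIV (\<lambda>t. H (Complex \<sigma> t))"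
        using \<sigma> by (intro continuous_on_compose2[OF holomorphic_on_imp_continuous_on[OF holH]]) (auto intro!: continuous_intros simp: Complex_eq)
      then have [measurable]: "(\<lambda>t. H (Complex \<sigma> t)) \<in> borel_measurable borel" by (rule borel_measurable_continuous_onI)
      show "(\<lambda>t. (norm (H (Complex \<sigma> t)))\<^sup>2) \<in> borel_measurable lborel" by measurable
      show "AE t in lborel. norm ((norm (H (Complex \<sigma> t)))\<^sup>2) \<le> norm (C3 * P * (1 + \<bar>t\<bar>) powr (- 1 - \<epsilon> / 2))"
        by (rule AE_I2) (use Hsq in \<open>auto intro: order_trans[OF _ abs_ge_self]\<close>)
    qed
    have IH: "(\<integral>t. (norm (H (Complex \<sigma> t)))\<^sup>2 \<partial>lborel) \<le> C3 * P * J"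
    proof -
      have "(\<integral>t. (norm (H (Complex \<sigma> t)))\<^sup>2 \<partial>lborel) \<le> (\<integral>t. C3 * P * (1 + \<bar>t\<bar>) powr (- 1 - \<epsilon> / 2) \<partial>lborel)"
        by (intro integral_mono int2 ib Hsq)
      also have "\<dots> = C3 * P * J" unfolding J_def by (rule integral_mult_right_zero)
      finally show ?thesis .
    qed
    define U where "U = ln X"
    have U: "U \<ge> 0" "exp U = X" using X by (auto simp: U_def)
    \<comment> \<open>The bound of \<open>laplace_mean_square\<close> does not depend on
      \<open>\<tau>\<close>, which is therefore free to be so small that the Gaussian weight is at
      least 1/2 on \<open>{0..U}\<close>.\<close>
    define \<tau> where "\<tau> = 1 / (U + 1)"
    have \<tau>: "\<tau> > 0" using U by (simp add: \<tau>_def)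
    define f where "f = (\<lambda>x. (norm (psiF \<Lambda> (x + \<delta> * x) - psiF \<Lambda> x - of_real (M * \<delta> * x)))\<^sup>2)"
    have fD: "f (exp u) = (norm (D u))\<^sup>2" if "u \<ge> 0" for u
    proof -
      have "exp (u + l) = exp u + \<delta> * exp u" using l by (simp add: exp_add algebra_simps)
      then have "D u = psiF \<Lambda> (exp u + \<delta> * exp u) - psiF \<Lambda> (exp u) - of_real (M * \<delta> * exp u)"
        using that l(1) by (simp add: D_def logpsi_def algebra_simps)
      then show ?thesis by (simp add: f_def)
    qed
    have "(\<integral>\<^sup>+x. ennreal (f x * indicator {exp 0..exp U} x) \<partial>lborel) = (\<integral>\<^sup>+u. ennreal (f (exp u) * exp u * indicator {0..U} u) \<partial>lborel)"
    proof (rule nn_integral_substitution)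
      show "set_borel_measurable borel {exp 0..exp U} f" unfolding set_borel_measurable_def f_def by measurable
      show "continuous_on {0..U} exp" by (intro continuous_intros)
    qed (use U in \<open>auto intro!: derivative_eq_intros\<close>)
    also have "\<dots> \<le> (\<integral>\<^sup>+u. ennreal (2 * X powr (2 + 2 * \<epsilon>)) * ennreal ((norm (D u))\<^sup>2 * exp (- 2 * \<sigma> * u) * exp (- (\<tau> * u)\<^sup>2 / 2)) \<partial>lborel)"
    proof (rule nn_integral_mono)
      fix u :: real
      show "ennreal (f (exp u) * exp u * indicator {0..U} u) \<le> ennreal (2 * X powr (2 + 2 * \<epsilon>)) * ennreal ((norm (D u))\<^sup>2 * exp (- 2 * \<sigma> * u) * exp (- (\<tau> * u)\<^sup>2 / 2))"
      proof (cases "u \<in> {0..U}")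
        case False then show ?thesis by simp
      next
        case True
        have "\<tau> * u \<le> 1" "0 \<le> \<tau> * u" using True U by (auto simp: \<tau>_def divide_le_eq)
        then have "(\<tau> * u)\<^sup>2 \<le> 1" by (simp add: power_le_one)
        then have "exp (- (\<tau> * u)\<^sup>2 / 2) \<ge> 1 + (- (\<tau> * u)\<^sup>2 / 2)" "1 + (- (\<tau> * u)\<^sup>2 / 2) \<ge> 1/2" using exp_ge_add_one_self[of "- (\<tau> * u)\<^sup>2 / 2"] by auto
        then have w: "2 * exp (- (\<tau> * u)\<^sup>2 / 2) \<ge> 1" by simp
        \<comment> \<open>Here \<open>exp u\<close> is the Jacobian of \<open>x = exp u\<close>, and
          \<open>1 + 2 * \<sigma> = 2 + 2 * \<epsilon>\<close> is the origin of the power of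
          \<open>X\<close>.\<close>
        have "exp u \<le> X powr (2 + 2 * \<epsilon>) * exp (- 2 * \<sigma> * u)"
        proof -
          have "X powr (2 + 2 * \<epsilon>) = exp ((2 + 2 * \<epsilon>) * U)" using X by (simp add: powr_def U_def)
          moreover have "u * (2 + 2 * \<epsilon>) \<le> (2 + 2 * \<epsilon>) * U" using True \<epsilon> by simp
          ultimately show ?thesis by (simp add: exp_add[symmetric] \<sigma>_def algebra_simps)
        qed
        then have "exp u * 1 \<le> (X powr (2 + 2 * \<epsilon>) * exp (- 2 * \<sigma> * u)) * (2 * exp (- (\<tau> * u)\<^sup>2 / 2))"
          using w by (intro mult_mono) auto
        then have "f (exp u) * exp u \<le> f (exp u) * ((X powr (2 + 2 * \<epsilon>) * exp (- 2 * \<sigma> * u)) * (2 * exp (- (\<tau> * u)\<^sup>2 / 2)))"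
          by (intro mult_left_mono) (auto simp: f_def)
        also have "\<dots> = (2 * X powr (2 + 2 * \<epsilon>)) * ((norm (D u))\<^sup>2 * exp (- 2 * \<sigma> * u) * exp (- (\<tau> * u)\<^sup>2 / 2))"
          using True by (simp only: fD atLeastAtMost_iff mult_ac)
        finally show ?thesis using True by (subst ennreal_mult[symmetric]) (auto intro!: ennreal_leI)
      qed
    qed
    also have "\<dots> = ennreal (2 * X powr (2 + 2 * \<epsilon>)) * (\<integral>\<^sup>+u. ennreal ((norm (D u))\<^sup>2 * exp (- 2 * \<sigma> * u) * exp (- (\<tau> * u)\<^sup>2 / 2)) \<partial>lborel)"
      by (rule nn_integral_cmult) measurable
    also have "\<dots> \<le> ennreal (2 * X powr (2 + 2 * \<epsilon>)) * ennreal ((\<integral>t. (norm (H (Complex \<sigma> t)))\<^sup>2 \<partial>lborel) / (2 * pi))"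
      using \<sigma> \<tau> by (intro mult_left_mono laplace_mean_square[OF _ growth int cS contD holH _ _ _ H3 strip int2]) auto
    also have "\<dots> = ennreal (2 * X powr (2 + 2 * \<epsilon>) * ((\<integral>t. (norm (H (Complex \<sigma> t)))\<^sup>2 \<partial>lborel) / (2 * pi)))"
      by (rule ennreal_mult[symmetric]) (auto intro!: divide_nonneg_pos integral_nonneg_AE)
    also have "\<dots> \<le> ennreal (C * X powr (2 + 2 * \<epsilon>) * \<delta> powr (1 - \<epsilon>) * (1 + \<delta>) powr (1 + 2 * \<epsilon>))"
    proof (rule ennreal_leI)
      have "(\<integral>t. (norm (H (Complex \<sigma> t)))\<^sup>2 \<partial>lborel) / (2 * pi) \<le> C3 * P * J / (2 * pi)"
        using IH by (rule divide_right_mono) simp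
      then have "2 * X powr (2 + 2 * \<epsilon>) * ((\<integral>t. (norm (H (Complex \<sigma> t)))\<^sup>2 \<partial>lborel) / (2 * pi)) \<le> 2 * X powr (2 + 2 * \<epsilon>) * (C3 * P * J / (2 * pi))"
        by (rule mult_left_mono) simp
      also have "\<dots> = (2 * (C3 * J / (2 * pi))) * (X powr (2 + 2 * \<epsilon>) * P)" by simp
      also have "\<dots> \<le> C * (X powr (2 + 2 * \<epsilon>) * P)" by (intro mult_right_mono) (auto simp: C_def P_def)
      finally show "2 * X powr (2 + 2 * \<epsilon>) * ((\<integral>t. (norm (H (Complex \<sigma> t)))\<^sup>2 \<partial>lborel) / (2 * pi)) \<le> C * X powr (2 + 2 * \<epsilon>) * \<delta> powr (1 - \<epsilon>) * (1 + \<delta>) powr (1 + 2 * \<epsilon>)"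
        by (simp only: P_def mult.assoc)
    qed
    finally show "(\<integral>\<^sup>+x. ennreal (indicat_real {1..X} x * (norm (psiF \<Lambda> (x + \<delta> * x) - psiF \<Lambda> x - of_real ((real m - real k) * \<delta> * x)))\<^sup>2) \<partial>lborel)
     \<le> ennreal (C * X powr (2 + 2 * \<epsilon>) * \<delta> powr (1 - \<epsilon>) * (1 + \<delta>) powr (1 + 2 * \<epsilon>))"
      using U by (simp only: f_def M_def exp_zero mult.commute[of "indicat_real _ _"])
  qed
qed

lemma entire_factor_zero:
  fixes g :: "complex \<Rightarrow> complex"
  assumes hol: "g holomorphic_on UNIV" and nz: "g b \<noteq> 0"
  obtains k g0 where "g0 holomorphic_on UNIV" "\<And>s. g s = (s - z) ^ k * g0 s" "g0 z \<noteq> 0"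
proof (cases "g z = 0")
  case False
  then show ?thesis using that[of g 0] hol by simp
next
  case True
  have nc: "\<not> g constant_on UNIV" using True nz unfolding constant_on_def by (metis UNIV_I)
  obtain h r n where h: "0 < n" "0 < r" "h holomorphic_on ball z r"
    "\<And>w. w \<in> ball z r \<Longrightarrow> g w = (w - z) ^ n * h w" "\<And>w. w \<in> ball z r \<Longrightarrow> h w \<noteq> 0"
    by (rule holomorphic_factor_zero_nonconstant[OF hol open_UNIV connected_UNIV UNIV_I True nc])
       (rule that, assumption, assumption, assumption, blast, blast)
  define g0 where "g0 = (\<lambda>s. if s \<in> ball z r then h s else g s / (s - z) ^ n)"
  have eq: "g0 s = g s / (s - z) ^ n" if "s \<noteq> z" for s
    using h(4)[of s] that by (auto simp: g0_def)
  have "g0 holomorphic_on ball z r"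
    using h(3) by (rule holomorphic_transform) (simp add: g0_def)
  moreover have "g0 holomorphic_on - {z}"
  proof (rule holomorphic_transform)
    show "(\<lambda>s. g s / (s - z) ^ n) holomorphic_on - {z}"
      by (intro holomorphic_intros holomorphic_on_subset[OF hol]) auto
  qed (simp add: eq)
  moreover have "ball z r \<union> - {z} = UNIV" using h(2) by auto
  ultimately have "g0 holomorphic_on UNIV"
    using holomorphic_on_Un[of g0 "ball z r" "- {z}"] by (simp add: open_Compl)
  moreover have "g s = (s - z) ^ n * g0 s" for s
  proof (cases "s = z")
    case True
    then show ?thesis using h(1,2) \<open>g z = 0\<close> by (simp add: zero_power)
  next
    case False
    then show ?thesis by (simp add: eq)
  qed
  moreover have "g0 z \<noteq> 0" using h(2,5) by (simp add: g0_def)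
  ultimately show ?thesis using that by blast
qed

text \<open>To the right of 1/2 no Gamma factor has a pole, so a zero there would be nontrivial and
  contradict GRH. Since \<open>pole_order\<close> links \<open>g\<close> to \<open>F\<close> only
  away from 1, a zero of \<open>g\<close> at 1 is split off as \<open>(s - 1) ^ k\<close>. The
  number \<open>M = m - k\<close> is fixed before \<open>\<epsilon>\<close>, so that one
  \<open>M\<close> serves all \<open>\<epsilon>\<close>.\<close>

lemma GRH_mean_square:
  assumes prim: "primitive_selberg F"
    and fe: "functional_eq F Q r lam mu eps"
    and pole: "pole_order F m"
    and Lam: "log_deriv_coeffs F \<Lambda>"
    and grh: "GRH F m r lam mu"
  obtains M :: real where "\<And>\<epsilon>. 0 < \<epsilon> \<Longrightarrow> \<epsilon> \<le> 1/4 \<Longrightarrow> \<exists>C>0. \<forall>\<delta>>0. \<forall>X\<ge>1.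
     (\<integral>\<^sup>+x. ennreal (indicat_real {1..X} x * (norm (psiF \<Lambda> (x + \<delta> * x) - psiF \<Lambda> x - of_real (M * \<delta> * x)))\<^sup>2) \<partial>lborel)
     \<le> ennreal (C * X powr (2 + 2 * \<epsilon>) * \<delta> powr (1 - \<epsilon>) * (1 + \<delta>) powr (1 + 2 * \<epsilon>))"
proof -
  obtain a where rep: "dirichlet_rep a F"
    using prim unfolding primitive_selberg_def selberg_class_def by blast
  obtain g where g: "entire_finite_order g" "\<And>s. s \<noteq> 1 \<Longrightarrow> g s = (s - 1) ^ m * F s" and g1: "m > 0 \<Longrightarrow> g 1 \<noteq> 0"
    using pole unfolding pole_order_def by blast
  have lm: "lam j > 0" "Re (mu j) \<ge> 0" if "j < r" for j
    using fe that unfolding functional_eq_def by blast+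
  have F_nz: "F s \<noteq> 0" if "Re s > 1/2" "s \<noteq> 1" for s
  proof
    assume "F s = 0"
    moreover have "of_real (lam j) * s + mu j \<notin> \<int>\<^sub>\<le>\<^sub>0" if j: "j < r" for j
    proof
      assume "of_real (lam j) * s + mu j \<in> \<int>\<^sub>\<le>\<^sub>0"
      then obtain n where n: "of_real (lam j) * s + mu j = of_int n" "n \<le> 0" by (auto elim!: nonpos_Ints_cases)
      have "Re (of_real (lam j) * s + mu j) = of_int n" unfolding n(1) by simp
      moreover have "lam j * Re s > 0" using lm(1)[OF j] \<open>Re s > 1/2\<close> by (intro mult_pos_pos) auto
      ultimately show False using lm(2)[OF j] n(2) by simp
    qed
    ultimately have "Re s = 1/2" using grh \<open>s \<noteq> 1\<close> unfolding GRH_def by blast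
    then show False using \<open>Re s > 1/2\<close> by simp
  qed
  have hol: "g holomorphic_on UNIV" using g(1) by (simp add: entire_finite_order_def)
  have "g 2 \<noteq> 0" using g(2)[of 2] F_nz[of 2] by simp
  then obtain k g0 where g0: "g0 holomorphic_on UNIV" "\<And>s. g s = (s - 1) ^ k * g0 s" "g0 1 \<noteq> 0"
    using entire_factor_zero[OF hol, of 2 1] by blast
  have nz: "g0 s \<noteq> 0" if "Re s > 1/2" for s
  proof (cases "s = 1")
    case False
    then show ?thesis using g(2)[of s] g0(2)[of s] F_nz[OF that False] by auto
  qed (use g0(3) in simp)
  show ?thesis
  proof (rule that[of "real m - real k"])
    fix \<epsilon> :: real assume \<epsilon>: "0 < \<epsilon>" "\<epsilon> \<le> 1/4"
    obtain C where "C > 0" "\<And>\<delta> X. \<delta> > 0 \<Longrightarrow> X \<ge> 1 \<Longrightarrow>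
     (\<integral>\<^sup>+x. ennreal (indicat_real {1..X} x * (norm (psiF \<Lambda> (x + \<delta> * x) - psiF \<Lambda> x - of_real ((real m - real k) * \<delta> * x)))\<^sup>2) \<partial>lborel)
     \<le> ennreal (C * X powr (2 + 2 * \<epsilon>) * \<delta> powr (1 - \<epsilon>) * (1 + \<delta>) powr (1 + 2 * \<epsilon>))"
      by (rule selberg_mean_square[OF rep fe g(1) g(2) g0(1) g0(2) nz Lam \<epsilon>]) blast+
    then show "\<exists>C>0. \<forall>\<delta>>0. \<forall>X\<ge>1.
     (\<integral>\<^sup>+x. ennreal (indicat_real {1..X} x * (norm (psiF \<Lambda> (x + \<delta> * x) - psiF \<Lambda> x - of_real ((real m - real k) * \<delta> * x)))\<^sup>2) \<partial>lborel)
     \<le> ennreal (C * X powr (2 + 2 * \<epsilon>) * \<delta> powr (1 - \<epsilon>) * (1 + \<delta>) powr (1 + 2 * \<epsilon>))" by blast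
  qed
qed

section \<open>Additive increments\<close>

text \<open>Both variances become integrals of this one function: \<open>v = \<delta> * x\<close>
  gives the multiplicative increments, \<open>v = h\<close> the additive ones.\<close>

definition incr_sq :: "(real \<Rightarrow> complex) \<Rightarrow> real \<Rightarrow> real \<Rightarrow> real" where
  "incr_sq G x v = (norm (G (x + v) - G x))\<^sup>2"

lemma incr_sq_nonneg [simp]: "0 \<le> incr_sq G x v"
  by (simp add: incr_sq_def)

lemma incr_sq_measurable [measurable]:
  assumes [measurable]: "G \<in> borel_measurable borel" "f \<in> borel_measurable N" "g \<in> borel_measurable N"
  shows "(\<lambda>x. incr_sq G (f x) (g x)) \<in> borel_measurable N"
  unfolding incr_sq_def by measurable

text \<open>The increments of length \<open>v\<close> at \<open>x\<close> and of length
  \<open>v - w\<close> at \<open>x + w\<close> end at the same point, so their difference is the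
  increment of length \<open>w\<close> at \<open>x\<close>.\<close>

lemma incr_sq_split: "incr_sq G x w \<le> 2 * incr_sq G x v + 2 * incr_sq G (x + w) (v - w)"
proof -
  have "norm (G (x + w) - G x) \<le> norm (G (x + v) - G x) + norm (G (x + v) - G (x + w))"
    using norm_triangle_ineq4[of "G (x + v) - G x" "G (x + v) - G (x + w)"] by simp
  then have "(norm (G (x + w) - G x))\<^sup>2 \<le> (norm (G (x + v) - G x) + norm (G (x + v) - G (x + w)))\<^sup>2"
    by (intro power_mono) auto
  also have "\<dots> \<le> 2 * (norm (G (x + v) - G x))\<^sup>2 + 2 * (norm (G (x + v) - G (x + w)))\<^sup>2"
    using sum_squares_bound[of "norm (G (x + v) - G x)" "norm (G (x + v) - G (x + w))"] by (simp add: power2_sum)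
  finally show ?thesis by (simp add: incr_sq_def)
qed

lemma nn_integral_powr_half_line:
  assumes "e > 0" "a > 0"
  shows "(\<integral>\<^sup>+x. ennreal (indicat_real {a..} x * x powr (- 1 - e)) \<partial>lborel) = ennreal (a powr (- e) / e)"
proof -
  have hi: "((\<lambda>x. x powr (- 1 - e)) has_integral (a powr (- e) / e)) {a..}"
    using has_integral_powr_to_inf[of "- 1 - e" a] assms by simp
  have si: "set_integrable lborel {a..} (\<lambda>x. x powr (- 1 - e))"
    using hi assms by (intro set_integrable_lborel_nonneg) (auto simp: integrable_on_def)
  have "(\<integral>\<^sup>+x. ennreal (indicat_real {a..} x * x powr (- 1 - e)) \<partial>lborel) = ennreal (\<integral>x. indicat_real {a..} x * x powr (- 1 - e) \<partial>lborel)"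
    using si by (intro nn_integral_eq_integral) (auto simp: set_integrable_def)
  also have "(\<integral>x. indicat_real {a..} x * x powr (- 1 - e) \<partial>lborel) = integral {a..} (\<lambda>x. x powr (- 1 - e))"
    using set_borel_integral_eq_integral(2)[OF si] by (simp add: set_lebesgue_integral_def)
  also have "\<dots> = a powr (- e) / e" using hi by (rule integral_unique)
  finally show ?thesis .
qed

lemma borel_measurable_case_prod_compose:
  assumes "case_prod f \<in> borel_measurable (borel \<Otimes>\<^sub>M borel)" "h \<in> borel_measurable N" "k \<in> borel_measurable N"
  shows "(\<lambda>z. f (h z) (k z)) \<in> borel_measurable N"
  using measurable_compose[OF measurable_Pair[OF assms(2,3)] assms(1)] by simp

text \<open>For fixed \<open>x\<close> the substitution \<open>v = d * x\<close> has Jacobian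
  \<open>x\<close>; exchanging the order afterwards leaves an inner integral over \<open>x\<close>
  at fixed \<open>d\<close>, which is where a mean square of multiplicative increments
  appears.\<close>

lemma nn_integral_dilation:
  fixes f :: "real \<Rightarrow> real \<Rightarrow> real"
  assumes [measurable]: "case_prod f \<in> borel_measurable (borel \<Otimes>\<^sub>M borel)" and "Z1 > 0"
  shows "(\<integral>\<^sup>+v. \<integral>\<^sup>+x. ennreal (indicat_real {Z1..Z} x * indicat_real {p..q} v * f x v) \<partial>lborel \<partial>lborel) =
    (\<integral>\<^sup>+d. \<integral>\<^sup>+x. ennreal (indicat_real {Z1..Z} x * indicat_real {p..q} (d * x) * (x * f x (d * x))) \<partial>lborel \<partial>lborel)"
proof -
  note [measurable (raw)] = borel_measurable_case_prod_compose[OF assms(1)]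
  have "(\<integral>\<^sup>+v. \<integral>\<^sup>+x. ennreal (indicat_real {Z1..Z} x * indicat_real {p..q} v * f x v) \<partial>lborel \<partial>lborel) =
    (\<integral>\<^sup>+x. \<integral>\<^sup>+v. ennreal (indicat_real {Z1..Z} x * indicat_real {p..q} v * f x v) \<partial>lborel \<partial>lborel)"
    by (rule lborel_pair.Fubini') measurable
  also have "\<dots> = (\<integral>\<^sup>+x. \<integral>\<^sup>+d. ennreal (indicat_real {Z1..Z} x * indicat_real {p..q} (d * x) * (x * f x (d * x))) \<partial>lborel \<partial>lborel)"
  proof (rule nn_integral_cong)
    fix x :: real
    show "(\<integral>\<^sup>+v. ennreal (indicat_real {Z1..Z} x * indicat_real {p..q} v * f x v) \<partial>lborel) =
      (\<integral>\<^sup>+d. ennreal (indicat_real {Z1..Z} x * indicat_real {p..q} (d * x) * (x * f x (d * x))) \<partial>lborel)"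
    proof (cases "x \<in> {Z1..Z}")
      case True
      then have x: "x > 0" using \<open>Z1 > 0\<close> by auto
      have "(\<integral>\<^sup>+v. ennreal (indicat_real {Z1..Z} x * indicat_real {p..q} v * f x v) \<partial>lborel) =
        ennreal \<bar>x\<bar> * (\<integral>\<^sup>+d. ennreal (indicat_real {Z1..Z} x * indicat_real {p..q} (0 + x * d) * f x (0 + x * d)) \<partial>lborel)"
        using x by (intro nn_integral_real_affine) measurable
      also have "\<dots> = (\<integral>\<^sup>+d. ennreal \<bar>x\<bar> * ennreal (indicat_real {Z1..Z} x * indicat_real {p..q} (0 + x * d) * f x (0 + x * d)) \<partial>lborel)"
        by (intro nn_integral_cmult[symmetric]) measurable
      also have "\<dots> = (\<integral>\<^sup>+d. ennreal (indicat_real {Z1..Z} x * indicat_real {p..q} (d * x) * (x * f x (d * x))) \<partial>lborel)"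
        using x by (intro nn_integral_cong) (simp add: ennreal_mult'[symmetric] mult_ac)
      finally show ?thesis .
    qed simp
  qed
  also have "\<dots> = (\<integral>\<^sup>+d. \<integral>\<^sup>+x. ennreal (indicat_real {Z1..Z} x * indicat_real {p..q} (d * x) * (x * f x (d * x))) \<partial>lborel \<partial>lborel)"
    by (rule lborel_pair.Fubini'[symmetric]) measurable
  finally show ?thesis .
qed


text \<open>An increment of length \<open>w\<close> is a difference of increments of lengths \<open>v\<close> and \<open>v - w\<close>; averaging over
  \<open>v \<in> [2w, 3w]\<close> makes both of them accessible through the substitution \<open>v = \<delta> x\<close>.\<close>
lemma short_interval_mean_square:
  fixes G :: "real \<Rightarrow> complex"
  assumes [measurable]: "G \<in> borel_measurable borel"
    and MS: "\<And>\<epsilon>. 0 < \<epsilon> \<Longrightarrow> \<epsilon> \<le> 1/4 \<Longrightarrow> \<exists>C>0. \<forall>\<delta>>0. \<forall>X\<ge>1.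
     (\<integral>\<^sup>+x. ennreal (indicat_real {1..X} x * incr_sq G x (\<delta> * x)) \<partial>lborel)
     \<le> ennreal (C * X powr (2 + 2 * \<epsilon>) * \<delta> powr (1 - \<epsilon>) * (1 + \<delta>) powr (1 + 2 * \<epsilon>))"
    and \<epsilon>: "\<epsilon> > 0"
  shows "\<exists>C>0. \<forall>X\<ge>1. \<forall>w. X powr (-3) \<le> w \<and> w \<le> X \<longrightarrow>
     (\<integral>\<^sup>+x. ennreal (indicat_real {1..X} x * incr_sq G x w) \<partial>lborel) \<le> ennreal (C * w * X powr (1 + \<epsilon>))"
proof -
  \<comment> \<open>The losses add up to \<open>X powr (8 * e)\<close>: \<open>2 * e\<close> from
    the range \<open>3 * Z\<close>, \<open>2 * e\<close> from \<open>1 + 3 * w\<close>, and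
    \<open>4 * e\<close> from \<open>a powr (- e)\<close> through the lower bound on
    \<open>w\<close>.\<close>
  define e where "e = min (1/4) (\<epsilon> / 8)"
  have e: "0 < e" "e \<le> 1/4" "8 * e \<le> \<epsilon>" using \<epsilon> by (auto simp: e_def)
  obtain C where C: "C > 0" and ms: "\<And>\<delta> X. \<delta> > 0 \<Longrightarrow> X \<ge> 1 \<Longrightarrow>
     (\<integral>\<^sup>+x. ennreal (indicat_real {1..X} x * incr_sq G x (\<delta> * x)) \<partial>lborel)
     \<le> ennreal (C * X powr (2 + 2 * e) * \<delta> powr (1 - e) * (1 + \<delta>) powr (1 + 2 * e))"
    using MS[OF e(1,2)] by blast
  define C' where "C' = 216 * C * (1 + 1 / e) * (6 powr (2 * e) * 4 powr (2 * e) * 2 powr e)"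
  have C': "C' > 0" using C e by (simp add: C'_def add_pos_pos)
  show ?thesis
  proof (rule exI[of _ C'], intro conjI allI impI C')
    fix X w :: real assume X: "1 \<le> X" and w': "X powr (-3) \<le> w \<and> w \<le> X"
    have w: "0 < w" "X powr (-3) \<le> w" "w \<le> X" using w' X by (auto intro: less_le_trans[of 0 "X powr (-3)"])
    \<comment> \<open>Room for the shifted point \<open>x + w\<close>, which can reach
      \<open>2 * X\<close>.\<close>
    define Z where "Z = 2 * X"
    have Z: "Z \<ge> 1" "w \<le> Z" using X w by (auto simp: Z_def)
    \<comment> \<open>The least \<open>d\<close> for which some \<open>x\<close> up to
      \<open>Z\<close> satisfies \<open>d * x >= w\<close>.\<close>
    define a where "a = w / Z"
    have a: "a > 0" using w Z by (simp add: a_def)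
    define K where "K = 27 * C * w ^ 3 * (3 * Z) powr (2 * e) * (1 + 3 * w) powr (2 * e)"
    have K: "K \<ge> 0" using C w by (simp add: K_def)
    define B where "B = (\<lambda>v. \<integral>\<^sup>+x. ennreal (indicat_real {1..Z} x * indicat_real {w..3 * w} v * incr_sq G x v) \<partial>lborel)"
    define T where "T = (\<integral>\<^sup>+v. B v \<partial>lborel)"
    have [measurable]: "B \<in> borel_measurable borel" unfolding B_def by measurable
    have R: "(\<integral>\<^sup>+x. ennreal (indicat_real {1..Z} x * indicat_real {w..3 * w} (d * x) * (x * incr_sq G x (d * x))) \<partial>lborel)
       \<le> ennreal K * ennreal (indicat_real {a..} d * d powr (- 1 - (1 + e))) + ennreal K * ennreal (indicat_real {a..} d * d powr (- 1 - e))" for d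
    proof (cases "a \<le> d \<and> d \<le> 3 * w")
      case False
      have z: "indicat_real {1..Z} x * indicat_real {w..3 * w} (d * x) = 0" for x
      proof (rule ccontr)
        assume "indicat_real {1..Z} x * indicat_real {w..3 * w} (d * x) \<noteq> 0"
        then have x: "1 \<le> x" "x \<le> Z" "w \<le> d * x" "d * x \<le> 3 * w" by (auto simp: indicator_def split: if_splits)
        have d0: "d > 0" using x w by (metis less_le_trans not_less zero_less_one zero_less_mult_pos2 mult_nonpos_nonneg order_trans zero_le_one)
        have "d * x \<le> d * Z" using d0 x by simp
        then have "a \<le> d" using x Z by (simp add: a_def divide_le_eq)
        moreover have "d * 1 \<le> d * x" using d0 x by (intro mult_left_mono) auto
        then have "d \<le> 3 * w" using x by simp
        ultimately show False using False by simp
      qed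
      show ?thesis unfolding z by simp
    next
      case True
      then have d: "a \<le> d" "d \<le> 3 * w" "d > 0" using a by auto
      \<comment> \<open>At fixed \<open>d\<close> the condition \<open>d * x <= 3 * w\<close> cuts
        \<open>x\<close> off here. The mean square bound is used at this height rather than at
        \<open>Z\<close>, which yields the decay in \<open>d\<close>.\<close>
      define Y where "Y = 3 * w / d"
      have Y: "1 \<le> Y" "Y > 0" using d w by (auto simp: Y_def)
      have YZ: "Y \<le> 3 * Z" using d Z w unfolding Y_def a_def by (simp add: field_simps)
      have "(\<integral>\<^sup>+x. ennreal (indicat_real {1..Z} x * indicat_real {w..3 * w} (d * x) * (x * incr_sq G x (d * x))) \<partial>lborel)
        \<le> (\<integral>\<^sup>+x. ennreal Y * ennreal (indicat_real {1..Y} x * incr_sq G x (d * x)) \<partial>lborel)"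
      proof (rule nn_integral_mono)
        fix x :: real
        show "ennreal (indicat_real {1..Z} x * indicat_real {w..3 * w} (d * x) * (x * incr_sq G x (d * x))) \<le> ennreal Y * ennreal (indicat_real {1..Y} x * incr_sq G x (d * x))"
        proof (cases "x \<in> {1..Z} \<and> d * x \<in> {w..3 * w}")
          case True
          then have "x \<le> Y" "1 \<le> x" using d by (auto simp: Y_def field_simps)
          then show ?thesis using True Y by (subst ennreal_mult[symmetric]) (auto intro!: ennreal_leI mult_right_mono)
        qed (auto simp: indicator_def)
      qed
      also have "\<dots> = ennreal Y * (\<integral>\<^sup>+x. ennreal (indicat_real {1..Y} x * incr_sq G x (d * x)) \<partial>lborel)"
        by (rule nn_integral_cmult) measurable
      also have "\<dots> \<le> ennreal Y * ennreal (C * Y powr (2 + 2 * e) * d powr (1 - e) * (1 + d) powr (1 + 2 * e))"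
        by (intro mult_left_mono ms d Y) simp
      also have "\<dots> = ennreal (Y * (C * Y powr (2 + 2 * e) * d powr (1 - e) * (1 + d) powr (1 + 2 * e)))"
        using Y C by (intro ennreal_mult[symmetric]) auto
      \<comment> \<open>With \<open>Y = 3 * w / d\<close> the dependence on \<open>d\<close> is
        \<open>d powr (- 2 - e) * (1 + d)\<close>; the two summands are integrated over
        \<open>{a..}\<close> separately.\<close>
      also have "\<dots> \<le> ennreal (K * d powr (- 1 - (1 + e)) + K * d powr (- 1 - e))"
      proof (rule ennreal_leI)
        have 1: "Y powr (2 + 2 * e) \<le> Y ^ 2 * (3 * Z) powr (2 * e)"
        proof -
          have "Y powr (2 + 2 * e) = Y ^ 2 * Y powr (2 * e)" using Y by (simp add: powr_add powr_realpow)
          also have "\<dots> \<le> Y ^ 2 * (3 * Z) powr (2 * e)" using Y YZ e by (intro mult_left_mono powr_mono2) auto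
          finally show ?thesis .
        qed
        have 2: "(1 + d) powr (1 + 2 * e) \<le> (1 + d) * (1 + 3 * w) powr (2 * e)"
        proof -
          have "(1 + d) powr (1 + 2 * e) = (1 + d) * (1 + d) powr (2 * e)" using d by (simp add: powr_add)
          also have "\<dots> \<le> (1 + d) * (1 + 3 * w) powr (2 * e)" using d e by (intro mult_left_mono powr_mono2) auto
          finally show ?thesis .
        qed
        have "Y * (C * Y powr (2 + 2 * e) * d powr (1 - e) * (1 + d) powr (1 + 2 * e)) \<le>
          Y * (C * (Y ^ 2 * (3 * Z) powr (2 * e)) * d powr (1 - e) * ((1 + d) * (1 + 3 * w) powr (2 * e)))"
          using 1 2 Y C d by (intro mult_left_mono mult_mono) auto
        also have "\<dots> = (C * (3 * Z) powr (2 * e) * (1 + 3 * w) powr (2 * e)) * (Y ^ 3 * d powr (1 - e) * (1 + d))"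
          by (simp add: power2_eq_square power3_eq_cube mult_ac)
        also have "Y ^ 3 * d powr (1 - e) * (1 + d) = 27 * w ^ 3 * (d powr (- 1 - (1 + e)) + d powr (- 1 - e))"
        proof -
          have p3: "d ^ 3 = d powr 3" using d by (simp add: powr_realpow)
          have "d powr (1 - e) / d ^ 3 = d powr (- 1 - (1 + e))"
            unfolding p3 powr_diff[symmetric] by (simp add: algebra_simps)
          moreover have "d powr (- 1 - (1 + e)) * d = d powr (- 1 - e)"
            using d powr_mult_base[of d "- 1 - (1 + e)"] by (simp add: mult.commute algebra_simps)
          moreover have "Y ^ 3 * d powr (1 - e) = 27 * w ^ 3 * (d powr (1 - e) / d ^ 3)" by (simp add: Y_def power_divide power_mult_distrib)
          ultimately show ?thesis by (simp only: distrib_left mult.assoc mult_1_right)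
        qed
        finally show "Y * (C * Y powr (2 + 2 * e) * d powr (1 - e) * (1 + d) powr (1 + 2 * e)) \<le> K * d powr (- 1 - (1 + e)) + K * d powr (- 1 - e)"
          by (simp add: K_def algebra_simps)
      qed
      also have "\<dots> = ennreal K * ennreal (indicat_real {a..} d * d powr (- 1 - (1 + e))) + ennreal K * ennreal (indicat_real {a..} d * d powr (- 1 - e))"
        using d(1) K by (simp add: ennreal_mult' ennreal_plus)
      finally show ?thesis .
    qed
    define Tb where "Tb = K * (a powr (- (1 + e)) / (1 + e)) + K * (a powr (- e) / e)"
    have "T = (\<integral>\<^sup>+d. \<integral>\<^sup>+x. ennreal (indicat_real {1..Z} x * indicat_real {w..3 * w} (d * x) * (x * incr_sq G x (d * x))) \<partial>lborel \<partial>lborel)"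
      unfolding T_def B_def by (rule nn_integral_dilation) auto
    also have "\<dots> \<le> (\<integral>\<^sup>+d. ennreal K * ennreal (indicat_real {a..} d * d powr (- 1 - (1 + e))) + ennreal K * ennreal (indicat_real {a..} d * d powr (- 1 - e)) \<partial>lborel)"
      by (rule nn_integral_mono) (rule R)
    also have "\<dots> = ennreal K * (\<integral>\<^sup>+d. ennreal (indicat_real {a..} d * d powr (- 1 - (1 + e))) \<partial>lborel) + ennreal K * (\<integral>\<^sup>+d. ennreal (indicat_real {a..} d * d powr (- 1 - e)) \<partial>lborel)"
      by (subst nn_integral_add) (auto simp: nn_integral_cmult)
    also have "\<dots> = ennreal Tb"
    proof -
      have "(\<integral>\<^sup>+d. ennreal (indicat_real {a..} d * d powr (- 1 - (1 + e))) \<partial>lborel) = ennreal (a powr (- (1 + e)) / (1 + e))"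
        "(\<integral>\<^sup>+d. ennreal (indicat_real {a..} d * d powr (- 1 - e)) \<partial>lborel) = ennreal (a powr (- e) / e)"
        using e a by (intro nn_integral_powr_half_line; simp)+
      then show ?thesis using K e unfolding Tb_def by (simp add: ennreal_mult[symmetric] ennreal_plus[symmetric] del: ennreal_plus)
    qed
    finally have T_le: "T \<le> ennreal Tb" .
    define V where "V = (\<integral>\<^sup>+x. ennreal (indicat_real {1..X} x * incr_sq G x w) \<partial>lborel)"
    \<comment> \<open>The window \<open>{2 * w..3 * w}\<close> has length \<open>w\<close>, and both
      \<open>v\<close> and \<open>v - w\<close> lie in \<open>{w..3 * w}\<close>.\<close>
    have "ennreal w * V = (\<integral>\<^sup>+v. indicator {2 * w..3 * w} v * V \<partial>lborel)"
      using w by (subst nn_integral_multc) (auto simp: mult.commute)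
    also have "\<dots> \<le> (\<integral>\<^sup>+v. 2 * B v + 2 * B (- w + 1 * v) \<partial>lborel)"
    proof (rule nn_integral_mono)
      fix v :: real
      show "indicator {2 * w..3 * w} v * V \<le> 2 * B v + 2 * B (- w + 1 * v)"
      proof (cases "v \<in> {2 * w..3 * w}")
        case True
        have "V \<le> (\<integral>\<^sup>+x. 2 * ennreal (indicat_real {1..X} x * incr_sq G x v) + 2 * ennreal (indicat_real {1..X} x * incr_sq G (x + w) (v - w)) \<partial>lborel)"
          unfolding V_def
        proof (rule nn_integral_mono)
          fix x
          have "indicat_real {1..X} x * incr_sq G x w \<le> 2 * (indicat_real {1..X} x * incr_sq G x v) + 2 * (indicat_real {1..X} x * incr_sq G (x + w) (v - w))"
            using incr_sq_split[of G x w v] by (simp add: indicator_def)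
          then have "ennreal (indicat_real {1..X} x * incr_sq G x w) \<le> ennreal (2 * (indicat_real {1..X} x * incr_sq G x v) + 2 * (indicat_real {1..X} x * incr_sq G (x + w) (v - w)))"
            by (rule ennreal_leI)
          also have "\<dots> = 2 * ennreal (indicat_real {1..X} x * incr_sq G x v) + 2 * ennreal (indicat_real {1..X} x * incr_sq G (x + w) (v - w))"
            by (subst ennreal_plus) (auto simp: ennreal_mult')
          finally show "ennreal (indicat_real {1..X} x * incr_sq G x w) \<le> 2 * ennreal (indicat_real {1..X} x * incr_sq G x v) + 2 * ennreal (indicat_real {1..X} x * incr_sq G (x + w) (v - w))" .
        qed
        also have "\<dots> = 2 * (\<integral>\<^sup>+x. ennreal (indicat_real {1..X} x * incr_sq G x v) \<partial>lborel) + 2 * (\<integral>\<^sup>+x. ennreal (indicat_real {1..X} x * incr_sq G (x + w) (v - w)) \<partial>lborel)"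
          by (subst nn_integral_add) (auto simp: nn_integral_cmult)
        also have "(\<integral>\<^sup>+x. ennreal (indicat_real {1..X} x * incr_sq G x v) \<partial>lborel) \<le> B v"
          unfolding B_def using True w X by (intro nn_integral_mono ennreal_leI) (auto simp: indicator_def Z_def)
        also have "(\<integral>\<^sup>+x. ennreal (indicat_real {1..X} x * incr_sq G (x + w) (v - w)) \<partial>lborel) \<le> B (- w + 1 * v)"
        proof -
          have "B (- w + 1 * v) = ennreal \<bar>1\<bar> * (\<integral>\<^sup>+x. ennreal (indicat_real {1..Z} (w + 1 * x) * indicat_real {w..3 * w} (- w + 1 * v) * incr_sq G (w + 1 * x) (- w + 1 * v)) \<partial>lborel)"
            unfolding B_def by (intro nn_integral_real_affine) auto
          also have "\<dots> \<ge> (\<integral>\<^sup>+x. ennreal (indicat_real {1..X} x * incr_sq G (x + w) (v - w)) \<partial>lborel)"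
          proof -
            have "(\<integral>\<^sup>+x. ennreal (indicat_real {1..X} x * incr_sq G (x + w) (v - w)) \<partial>lborel) \<le>
              (\<integral>\<^sup>+x. ennreal (indicat_real {1..Z} (w + 1 * x) * indicat_real {w..3 * w} (- w + 1 * v) * incr_sq G (w + 1 * x) (- w + 1 * v)) \<partial>lborel)"
              using True w X by (intro nn_integral_mono ennreal_leI) (auto simp: indicator_def Z_def add.commute)
            then show ?thesis by simp
          qed
          finally show ?thesis .
        qed
        finally show ?thesis using True by (simp add: add_mono mult_left_mono)
      qed simp
    qed
    also have "\<dots> = 2 * T + 2 * (\<integral>\<^sup>+v. B (- w + 1 * v) \<partial>lborel)"
      unfolding T_def by (subst nn_integral_add) (auto simp: nn_integral_cmult)
    also have "(\<integral>\<^sup>+v. B (- w + 1 * v) \<partial>lborel) = T"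
      unfolding T_def by (subst (2) nn_integral_real_affine[where c = 1 and t = "- w"]) auto
    finally have "ennreal w * V \<le> 4 * T" by (simp add: mult_2[symmetric] mult.assoc[symmetric])
    also have "\<dots> \<le> 4 * ennreal Tb" using T_le by (intro mult_left_mono) auto
    also have "\<dots> = ennreal (4 * Tb)" by (simp add: ennreal_mult')
    also have "\<dots> \<le> ennreal (w * (C' * w * X powr (1 + \<epsilon>)))"
    proof (rule ennreal_leI)
      have "a powr (- (1 + e)) = a powr (- e) * (Z / w)"
      proof -
        have "- (1 + e) = - e - 1" by simp
        then have "a powr (- (1 + e)) = a powr (- e) / a" using a by (simp only: powr_diff) simp
        then show ?thesis by (simp add: a_def)
      qed
      moreover have "a powr (- (1 + e)) / (1 + e) \<le> a powr (- (1 + e))" using e by (simp add: divide_le_eq mult_le_cancel_left1)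
      ultimately have "a powr (- (1 + e)) / (1 + e) \<le> a powr (- e) * (Z / w)" by (simp only:)
      then have "Tb \<le> K * (a powr (- e) * (Z / w)) + K * (a powr (- e) / e)"
        unfolding Tb_def using K by (intro add_mono mult_left_mono) auto
      also have "\<dots> = K * a powr (- e) * (Z / w + 1 / e)" by (simp add: algebra_simps)
      also have "\<dots> \<le> K * a powr (- e) * ((Z / w) * (1 + 1 / e))"
      proof (intro mult_left_mono)
        have "1 \<le> Z / w" using Z w by simp
        then have "1 * (1 / e) \<le> (Z / w) * (1 / e)" using e by (intro mult_right_mono) auto
        then show "Z / w + 1 / e \<le> (Z / w) * (1 + 1 / e)" by (simp add: algebra_simps)
      qed (use K in auto)
      finally have Tb: "Tb \<le> K * a powr (- e) * ((Z / w) * (1 + 1 / e))" .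
      have q1: "(3 * Z) powr (2 * e) = 6 powr (2 * e) * X powr (2 * e)" using X by (simp add: Z_def powr_mult[symmetric])
      have q2: "(1 + 3 * w) powr (2 * e) \<le> 4 powr (2 * e) * X powr (2 * e)"
        using X w e by (subst powr_mult[symmetric]) (auto intro!: powr_mono2)
      have q3: "a powr (- e) \<le> 2 powr e * X powr (4 * e)"
      proof -
        have "a powr (- e) = (Z / w) powr e" using a by (simp add: a_def powr_minus powr_divide divide_simps)
        also have "\<dots> \<le> (2 * X powr 4) powr e"
        proof (intro powr_mono2)
          have "X powr 4 * X powr (-3) = X" using X by (simp only: powr_add[symmetric]) simp
          then have "Z \<le> 2 * X powr 4 * X powr (-3)" by (simp only: Z_def mult.assoc)
          also have "\<dots> \<le> 2 * X powr 4 * w" using w by (intro mult_left_mono) auto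
          finally show "Z / w \<le> 2 * X powr 4" using w by (simp add: divide_le_eq)
        qed (use e Z w in auto)
        also have "\<dots> = 2 powr e * (X powr 4) powr e" by (simp add: powr_mult)
        also have "(X powr 4) powr e = X powr (4 * e)" by (rule powr_powr)
        finally show ?thesis .
      qed
      have "K \<le> 27 * C * w ^ 3 * (6 powr (2 * e) * X powr (2 * e)) * (4 powr (2 * e) * X powr (2 * e))"
        unfolding K_def q1 using q2 C w by (intro mult_left_mono) auto
      then have "K * a powr (- e) \<le> (27 * C * w ^ 3 * (6 powr (2 * e) * X powr (2 * e)) * (4 powr (2 * e) * X powr (2 * e))) * (2 powr e * X powr (4 * e))"
        using q3 C w by (intro mult_mono) auto
      also have "\<dots> = 27 * C * w ^ 3 * (6 powr (2 * e) * 4 powr (2 * e) * 2 powr e) * (X powr (2 * e) * X powr (2 * e) * X powr (4 * e))"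
        by (simp only: mult_ac)
      also have "X powr (2 * e) * X powr (2 * e) * X powr (4 * e) = X powr (8 * e)" by (simp add: powr_add[symmetric])
      also have "27 * C * w ^ 3 * (6 powr (2 * e) * 4 powr (2 * e) * 2 powr e) * X powr (8 * e) \<le> 27 * C * w ^ 3 * (6 powr (2 * e) * 4 powr (2 * e) * 2 powr e) * X powr \<epsilon>"
        using C w e X by (intro mult_left_mono powr_mono) auto
      finally have Ka: "K * a powr (- e) \<le> 27 * C * w ^ 3 * (6 powr (2 * e) * 4 powr (2 * e) * 2 powr e) * X powr \<epsilon>" .
      have "0 \<le> (Z / w) * (1 + 1 / e)" using Z w e by simp
      from mult_right_mono[OF Ka this] Tb have "4 * Tb \<le> 4 * ((27 * C * w ^ 3 * (6 powr (2 * e) * 4 powr (2 * e) * 2 powr e) * X powr \<epsilon>) * ((Z / w) * (1 + 1 / e)))"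
        by linarith
      also have "\<dots> = w * (C' * w * X powr (1 + \<epsilon>))"
        using w X by (simp add: C'_def Z_def powr_add power3_eq_cube field_simps)
      finally show "4 * Tb \<le> w * (C' * w * X powr (1 + \<epsilon>))" .
    qed
    also have "\<dots> = ennreal w * ennreal (C' * w * X powr (1 + \<epsilon>))" using w C' by (intro ennreal_mult) auto
    finally show "V \<le> ennreal (C' * w * X powr (1 + \<epsilon>))"
      using w by (subst (asm) ennreal_mult_le_mult_iff) auto
  qed
qed

section \<open>Averaging the asymptotic formula\<close>

lemma lborel_Icc_bounded:
  fixes f :: "real \<Rightarrow> real"
  assumes f[measurable]: "f \<in> borel_measurable borel" and B: "\<And>x. x \<in> {a..b} \<Longrightarrow> \<bar>f x\<bar> \<le> B"
  shows "integrable lborel (\<lambda>x. indicat_real {a..b} x * f x)"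
    and "f integrable_on {a..b}"
    and "integral {a..b} f = (\<integral>x. indicat_real {a..b} x * f x \<partial>lborel)"
proof -
  have "integrable lborel (\<lambda>x. B * indicat_real {a..b} x)"
    by (intro integrable_mult_right integrable_real_indicator) (auto simp: emeasure_lborel_Icc_eq)
  then show i: "integrable lborel (\<lambda>x. indicat_real {a..b} x * f x)"
    by (rule Bochner_Integration.integrable_bound) (use B in \<open>auto simp: indicator_def intro: order_trans[OF _ abs_ge_self]\<close>)
  then have "set_integrable lborel {a..b} f" by (simp add: set_integrable_def)
  from set_borel_integral_eq_integral[OF this]
  show "f integrable_on {a..b}" "integral {a..b} f = (\<integral>x. indicat_real {a..b} x * f x \<partial>lborel)"
    by (auto simp: set_lebesgue_integral_def)
qed

text \<open>Second mean value theorem with the increasing weight \<open>x\<close>: the integral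
  equals \<open>\<alpha>\<close> times one partial integral plus \<open>\<beta>\<close> times the
  complementary one. The latter is a difference of two integrals starting at
  \<open>\<alpha>\<close>, which gives \<open>1 + 2 = 3\<close>.\<close>

lemma weighted_integral_bound:
  fixes \<phi> :: "real \<Rightarrow> real"
  assumes int: "\<phi> integrable_on {\<alpha>..\<beta>}" and ab: "0 \<le> \<alpha>" "\<alpha> \<le> \<beta>"
    and E: "\<And>t. \<alpha> \<le> t \<Longrightarrow> t \<le> \<beta> \<Longrightarrow> \<bar>integral {\<alpha>..t} \<phi>\<bar> \<le> E"
  shows "\<bar>integral {\<alpha>..\<beta>} (\<lambda>x. x * \<phi> x)\<bar> \<le> 3 * \<beta> * E"
proof -
  obtain c where c: "c \<in> {\<alpha>..\<beta>}"
    "integral {\<alpha>..\<beta>} (\<lambda>x. x * \<phi> x) = \<alpha> * integral {\<alpha>..c} \<phi> + \<beta> * integral {c..\<beta>} \<phi>"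
    using second_mean_value_theorem[OF int ab(2), of "\<lambda>x. x"] by auto
  have E0: "E \<ge> 0" using E[of \<alpha>] ab by simp
  have "integral {\<alpha>..c} \<phi> + integral {c..\<beta>} \<phi> = integral {\<alpha>..\<beta>} \<phi>"
    using c int by (intro Henstock_Kurzweil_Integration.integral_combine) auto
  then have "\<bar>integral {c..\<beta>} \<phi>\<bar> \<le> 2 * E" using E[of c] E[of \<beta>] c ab by auto
  then have "\<beta> * \<bar>integral {c..\<beta>} \<phi>\<bar> \<le> \<beta> * (2 * E)" using ab by (intro mult_left_mono) auto
  moreover have "\<alpha> * \<bar>integral {\<alpha>..c} \<phi>\<bar> \<le> \<beta> * E" using ab E[of c] c E0 by (intro mult_mono) auto
  moreover have "\<bar>integral {\<alpha>..\<beta>} (\<lambda>x. x * \<phi> x)\<bar> \<le> \<alpha> * \<bar>integral {\<alpha>..c} \<phi>\<bar> + \<beta> * \<bar>integral {c..\<beta>} \<phi>\<bar>"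
    unfolding c(2) using ab by (intro order_trans[OF abs_triangle_ineq]) (simp add: abs_mult)
  ultimately show ?thesis by (simp add: algebra_simps)
qed

lemma integrable_lborel_pair_indicator:
  fixes f :: "real \<Rightarrow> real \<Rightarrow> real"
  assumes [measurable]: "case_prod f \<in> borel_measurable (borel \<Otimes>\<^sub>M borel)"
    and le: "\<And>x v. \<bar>f x v\<bar> \<le> K * (indicat_real {a..b} x * indicat_real {p..q} v)"
  shows "integrable (lborel \<Otimes>\<^sub>M lborel) (case_prod f)"
proof (rule Bochner_Integration.integrable_bound)
  have "integrable (lborel \<Otimes>\<^sub>M lborel) (\<lambda>(x, v). indicat_real {a..b} x * indicat_real {p..q} v)"
    by (intro integrable_lborel_pair_mult integrable_real_indicator) (auto simp: emeasure_lborel_Icc_eq)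
  then show "integrable (lborel \<Otimes>\<^sub>M lborel) (\<lambda>z. K * (case z of (x, v) \<Rightarrow> indicat_real {a..b} x * indicat_real {p..q} v))"
    by (rule integrable_mult_right)
  show "case_prod f \<in> borel_measurable (lborel \<Otimes>\<^sub>M lborel)" by measurable
  show "AE z in lborel \<Otimes>\<^sub>M lborel. norm (case_prod f z) \<le> norm (K * (case z of (x, v) \<Rightarrow> indicat_real {a..b} x * indicat_real {p..q} v))"
    by (rule AE_I2) (use le in \<open>auto simp: split_beta intro: order_trans[OF _ abs_ge_self]\<close>)
qed

text \<open>The signed counterpart of \<open>nn_integral_dilation\<close>: the deviation from the
  main term changes sign, so boundedness on a compact region justifies Fubini. In the new variable
  that region has \<open>d\<close> between \<open>p / X\<close> and \<open>q / Y\<close>.\<close>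

lemma lborel_integral_dilation:
  fixes f :: "real \<Rightarrow> real \<Rightarrow> real"
  assumes meas: "case_prod f \<in> borel_measurable (borel \<Otimes>\<^sub>M borel)" and YX: "0 < Y" "Y \<le> X" and pq: "0 < p" "p \<le> q"
    and K: "\<And>x v. x \<in> {Y..X} \<Longrightarrow> v \<in> {p..q} \<Longrightarrow> \<bar>f x v\<bar> \<le> K"
  shows "(\<integral>v. \<integral>x. indicat_real {Y..X} x * indicat_real {p..q} v * f x v \<partial>lborel \<partial>lborel) =
    (\<integral>d. \<integral>x. indicat_real {Y..X} x * indicat_real {p..q} (d * x) * (x * f x (d * x)) \<partial>lborel \<partial>lborel)" (is ?eq)
    and "integrable lborel (\<lambda>d. \<integral>x. indicat_real {Y..X} x * indicat_real {p..q} (d * x) * (x * f x (d * x)) \<partial>lborel)" (is ?int)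
proof -
  note [measurable (raw)] = borel_measurable_case_prod_compose[OF meas]
  have K0: "K \<ge> 0" using K[of Y p] YX pq by (auto intro: order_trans[OF abs_ge_zero])
  have i1: "integrable (lborel \<Otimes>\<^sub>M lborel) (\<lambda>(x, v). indicat_real {Y..X} x * indicat_real {p..q} v * f x v)"
    by (rule integrable_lborel_pair_indicator[of _ K Y X p q]) (use K K0 in \<open>auto simp: indicator_def\<close>)
  have i2: "integrable (lborel \<Otimes>\<^sub>M lborel) (\<lambda>(x, d). indicat_real {Y..X} x * indicat_real {p..q} (d * x) * (x * f x (d * x)))"
  proof (rule integrable_lborel_pair_indicator[of _ "X * K" Y X "p / X" "q / Y"])
    fix x d :: real
    show "\<bar>indicat_real {Y..X} x * indicat_real {p..q} (d * x) * (x * f x (d * x))\<bar> \<le> X * K * (indicat_real {Y..X} x * indicat_real {p / X..q / Y} d)"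
    proof (cases "x \<in> {Y..X} \<and> d * x \<in> {p..q}")
      case True
      then have x: "Y \<le> x" "x \<le> X" "p \<le> d * x" "d * x \<le> q" by auto
      have "d > 0" using x pq YX by (metis less_le_trans zero_less_mult_pos2)
      then have "d * x \<le> d * X" "d * Y \<le> d * x" using x by auto
      then have "d \<in> {p / X..q / Y}" using x YX by (auto simp: field_simps)
      moreover have "\<bar>x * f x (d * x)\<bar> \<le> X * K" unfolding abs_mult using x K[of x "d * x"] YX by (intro mult_mono) auto
      ultimately show ?thesis using True by simp
    next
      case False
      then show ?thesis using K0 YX by (auto simp: indicator_def)
    qed
  qed measurable
  have "(\<integral>v. \<integral>x. indicat_real {Y..X} x * indicat_real {p..q} v * f x v \<partial>lborel \<partial>lborel) =
    (\<integral>x. \<integral>v. indicat_real {Y..X} x * indicat_real {p..q} v * f x v \<partial>lborel \<partial>lborel)"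
    by (rule lborel_pair.Fubini_integral[OF i1])
  also have "\<dots> = (\<integral>x. \<integral>d. indicat_real {Y..X} x * indicat_real {p..q} (d * x) * (x * f x (d * x)) \<partial>lborel \<partial>lborel)"
  proof (rule Bochner_Integration.integral_cong[OF refl])
    fix x :: real
    show "(\<integral>v. indicat_real {Y..X} x * indicat_real {p..q} v * f x v \<partial>lborel) = (\<integral>d. indicat_real {Y..X} x * indicat_real {p..q} (d * x) * (x * f x (d * x)) \<partial>lborel)"
    proof (cases "x \<in> {Y..X}")
      case True
      then have x: "x > 0" using YX by auto
      have "(\<integral>v. indicat_real {Y..X} x * indicat_real {p..q} v * f x v \<partial>lborel) = \<bar>x\<bar> *\<^sub>R (\<integral>d. indicat_real {Y..X} x * indicat_real {p..q} (0 + x * d) * f x (0 + x * d) \<partial>lborel)"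
        using x by (intro lborel_integral_real_affine) simp
      also have "\<dots> = (\<integral>d. \<bar>x\<bar> *\<^sub>R (indicat_real {Y..X} x * indicat_real {p..q} (0 + x * d) * f x (0 + x * d)) \<partial>lborel)"
        by (rule integral_scaleR_right[symmetric])
      also have "\<dots> = (\<integral>d. indicat_real {Y..X} x * indicat_real {p..q} (d * x) * (x * f x (d * x)) \<partial>lborel)"
        using x by (intro Bochner_Integration.integral_cong) (auto simp: mult_ac)
      finally show ?thesis .
    qed simp
  qed
  also have "\<dots> = (\<integral>d. \<integral>x. indicat_real {Y..X} x * indicat_real {p..q} (d * x) * (x * f x (d * x)) \<partial>lborel \<partial>lborel)"
    by (rule lborel_pair.Fubini_integral[OF i2, symmetric])
  finally show ?eq .
  show ?int using lborel_pair.integrable_snd[OF i2] .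
qed

lemma integral_inverse_Icc:
  assumes "0 < a" "a \<le> b"
  shows "integrable lborel (\<lambda>d. indicat_real {a..b} d * (1 / d))" "(\<integral>d. indicat_real {a..b} d * (1 / d) \<partial>lborel) = ln (b / a)"
proof -
  have cont: "continuous_on {a..b} (\<lambda>d. 1 / d)" using assms by (intro continuous_intros) auto
  have der: "(ln has_vector_derivative 1 / d) (at d within {a..b})" if "a \<le> d" "d \<le> b" for d
    using that assms by (auto intro!: derivative_eq_intros simp: has_real_derivative_iff_has_vector_derivative[symmetric])
  show "integrable lborel (\<lambda>d. indicat_real {a..b} d * (1 / d))"
    using borel_integrable_atLeastAtMost'[OF cont] by (simp add: set_integrable_def)
  have "(\<integral>d. indicat_real {a..b} d *\<^sub>R (1 / d) \<partial>lborel) = ln b - ln a"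
    by (rule integral_FTC_Icc[OF assms(2) der cont])
  then show "(\<integral>d. indicat_real {a..b} d * (1 / d) \<partial>lborel) = ln (b / a)"
    using assms by (simp add: ln_div)
qed


text \<open>Weighted arithmetic-geometric inequality for the cross term. When the square of
  \<open>norm (a - b)\<close> has relative size \<open>\<eta>\<close>, the choice
  \<open>t = sqrt \<eta>\<close> makes both terms of relative size \<open>sqrt \<eta>\<close>: the
  price of replacing \<open>v\<close> by \<open>h\<close>.\<close>

lemma norm_sq_diff_le:
  fixes a b :: complex
  assumes "0 < t"
  shows "\<bar>(norm a)\<^sup>2 - (norm b)\<^sup>2\<bar> \<le> (1 + 1 / t) * (norm (a - b))\<^sup>2 + t * (norm b)\<^sup>2"
proof -
  define n where "n = norm (a - b)"
  have n: "\<bar>norm a - norm b\<bar> \<le> n" "n \<ge> 0" unfolding n_def by (auto intro: norm_triangle_ineq3)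
  have "(norm a)\<^sup>2 - (norm b)\<^sup>2 = (norm a - norm b)\<^sup>2 + 2 * (norm b * (norm a - norm b))"
    by (simp add: power2_eq_square algebra_simps)
  then have "\<bar>(norm a)\<^sup>2 - (norm b)\<^sup>2\<bar> \<le> (norm a - norm b)\<^sup>2 + 2 * \<bar>norm b * (norm a - norm b)\<bar>"
    by (simp add: abs_if split: if_splits)
  also have "(norm a - norm b)\<^sup>2 \<le> n\<^sup>2" using n by (metis abs_le_square_iff abs_of_nonneg)
  also have "\<bar>norm b * (norm a - norm b)\<bar> \<le> norm b * n" using n by (simp add: abs_mult mult_left_mono)
  also have "2 * (norm b * n) \<le> t * (norm b)\<^sup>2 + n\<^sup>2 / t"
  proof -
    have "2 * (sqrt t * norm b) * (n / sqrt t) \<le> (sqrt t * norm b)\<^sup>2 + (n / sqrt t)\<^sup>2" by (rule sum_squares_bound)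
    then show ?thesis using assms by (simp add: power_mult_distrib power_divide)
  qed
  finally show ?thesis by (simp add: n_def algebra_simps)
qed

text \<open>The main term of the hypothesis has derivative \<open>\<delta> x \<cdot> main_dens x\<close> in \<open>X = x\<close>; at \<open>\<delta> = v / x\<close> this is
  \<open>v \<cdot> main_dens x\<close>, with antiderivative \<open>v \<cdot> main_int x\<close>: the main term of the conclusion.\<close>

definition main_dens :: "real \<Rightarrow> real" where
  "main_dens x = (6 * ln x - 8 * ln 2 + 3) / 6"

definition main_int :: "real \<Rightarrow> real" where
  "main_int x = x * (6 * ln x - (3 + 8 * ln 2)) / 6"

lemma main_int_deriv:
  assumes "x > 0"
  shows "(main_int has_vector_derivative main_dens x) (at x within S)"
    and "((\<lambda>x. 1/6 * \<delta> * x\<^sup>2 * (3 * ln x - 4 * ln 2)) has_vector_derivative \<delta> * x * main_dens x) (at x within S)"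
proof -
  have "(main_int has_real_derivative main_dens x) (at x)"
    unfolding main_int_def[abs_def] main_dens_def using assms
    by (auto intro!: derivative_eq_intros simp: field_simps)
  then show "(main_int has_vector_derivative main_dens x) (at x within S)"
    unfolding has_real_derivative_iff_has_vector_derivative by (rule has_vector_derivative_at_within)
  have "((\<lambda>x. 1/6 * \<delta> * x\<^sup>2 * (3 * ln x - 4 * ln 2)) has_real_derivative \<delta> * x * main_dens x) (at x)"
    unfolding main_dens_def using assms
    by (auto intro!: derivative_eq_intros simp: field_simps power2_eq_square)
  then show "((\<lambda>x. 1/6 * \<delta> * x\<^sup>2 * (3 * ln x - 4 * ln 2)) has_vector_derivative \<delta> * x * main_dens x) (at x within S)"
    unfolding has_real_derivative_iff_has_vector_derivative by (rule has_vector_derivative_at_within)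
qed

lemma main_int_bound:
  assumes \<epsilon>: "\<epsilon> > 0" and x: "x \<ge> 1"
  shows "\<bar>main_int x\<bar> \<le> (1 / \<epsilon> + 2) * x powr (1 + \<epsilon>)" "ln (3 * x) \<le> (1 / \<epsilon> + 2) * x powr \<epsilon>"
proof -
  have p: "1 \<le> x powr \<epsilon>" using x \<epsilon> by (intro ge_one_powr_ge_zero) auto
  have l: "0 \<le> ln x" "ln x \<le> x powr \<epsilon> / \<epsilon>" using x ln_powr_bound[of x \<epsilon>] \<epsilon> by auto
  have l2: "0 \<le> ln (2::real)" "ln (2::real) \<le> 1" using ln_le_minus_one[of "2::real"] by auto
  have "\<bar>6 * ln x - (3 + 8 * ln 2)\<bar> / 6 \<le> ln x + 2"
  proof -
    have "\<bar>6 * a - (3 + 8 * b)\<bar> / 6 \<le> a + 2" if "0 \<le> a" "0 \<le> b" "b \<le> 1" for a b :: real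
      using that by (simp add: abs_le_iff)
    from this[OF l(1) l2] show ?thesis .
  qed
  also have "\<dots> \<le> x powr \<epsilon> / \<epsilon> + 2 * x powr \<epsilon>" using l p by simp
  also have "\<dots> = (1 / \<epsilon> + 2) * x powr \<epsilon>" by (simp add: algebra_simps)
  finally have "x * (\<bar>6 * ln x - (3 + 8 * ln 2)\<bar> / 6) \<le> x * ((1 / \<epsilon> + 2) * x powr \<epsilon>)" using x by (intro mult_left_mono) auto
  moreover have "x powr (1 + \<epsilon>) = x * x powr \<epsilon>" using x by (simp add: powr_add)
  ultimately show "\<bar>main_int x\<bar> \<le> (1 / \<epsilon> + 2) * x powr (1 + \<epsilon>)"
    using x by (simp add: main_int_def abs_mult mult_ac)
  have "ln (3 * x) = ln 3 + ln x" using x by (simp add: ln_mult)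
  also have "\<dots> \<le> 2 * x powr \<epsilon> + x powr \<epsilon> / \<epsilon>" using l p ln_le_minus_one[of "3::real"] by simp
  finally show "ln (3 * x) \<le> (1 / \<epsilon> + 2) * x powr \<epsilon>" by (simp add: algebra_simps)
qed

lemma incr_sq_locally_bounded:
  assumes bdd: "\<And>B. \<exists>K. \<forall>x\<in>{0..B}. norm (G x) \<le> K"
  shows "\<exists>K. \<forall>x\<in>{0..B}. \<forall>v\<in>{0..B}. incr_sq G x v \<le> K"
proof -
  obtain K where K: "\<And>x. x \<in> {0..2 * B} \<Longrightarrow> norm (G x) \<le> K" using bdd[of "2 * B"] by blast
  have "incr_sq G x v \<le> (2 * K)\<^sup>2" if "x \<in> {0..B}" "v \<in> {0..B}" for x v
    unfolding incr_sq_def using K[of x] K[of "x + v"] that norm_triangle_ineq4[of "G (x + v)" "G x"]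
    by (intro power_mono) auto
  then show ?thesis by blast
qed

text \<open>Subtracting the asymptotic formula at \<open>\<alpha>\<close> from the one at
  \<open>t\<close> controls the partial integrals from \<open>\<alpha>\<close>, with error
  \<open>2 * E * \<beta>\<^sup>2\<close>. The second mean value bound then inserts the weight
  \<open>x\<close>, the Jacobian of the dilation, whence the factor
  \<open>6 = 2 * 3\<close>.\<close>

lemma mean_square_inner_bound:
  fixes G :: "real \<Rightarrow> complex"
  assumes meas[measurable]: "G \<in> borel_measurable borel" and bdd: "\<And>B. \<exists>K. \<forall>x\<in>{0..B}. norm (G x) \<le> K"
    and ab: "1 \<le> \<alpha>" "\<alpha> \<le> \<beta>" and \<delta>: "\<delta> > 0" and E0: "E \<ge> 0"
    and V: "\<And>t. \<alpha> \<le> t \<Longrightarrow> t \<le> \<beta> \<Longrightarrow>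
      \<bar>integral {1..t} (\<lambda>x. incr_sq G x (\<delta> * x)) - 1/6 * \<delta> * t\<^sup>2 * (3 * ln t - 4 * ln 2)\<bar> \<le> E * t\<^sup>2"
  shows "\<bar>\<integral>x. indicat_real {\<alpha>..\<beta>} x * (x * (incr_sq G x (\<delta> * x) - (\<delta> * x) * main_dens x)) \<partial>lborel\<bar> \<le> 6 * E * \<beta> ^ 3"
proof -
  define \<phi> where "\<phi> = (\<lambda>x. incr_sq G x (\<delta> * x) - (\<delta> * x) * main_dens x)"
  have [measurable]: "main_dens \<in> borel_measurable borel" unfolding main_dens_def[abs_def] by measurable
  have [measurable]: "\<phi> \<in> borel_measurable borel" unfolding \<phi>_def by measurable
  define W where "W = (1 + \<delta>) * \<beta>"
  obtain K where K: "\<And>x v. x \<in> {0..W} \<Longrightarrow> v \<in> {0..W} \<Longrightarrow> incr_sq G x v \<le> K"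
    using incr_sq_locally_bounded[OF bdd, of W] by blast
  have inW: "x \<in> {0..W}" "\<delta> * x \<in> {0..W}" if "1 \<le> x" "x \<le> \<beta>" for x
  proof -
    have "0 \<le> \<delta> * x" "\<delta> * x \<le> \<delta> * \<beta>" "0 \<le> \<delta> * \<beta>" using that \<delta> ab by auto
    then show "x \<in> {0..W}" "\<delta> * x \<in> {0..W}" using that ab unfolding W_def by (auto simp: algebra_simps)
  qed
  have int1: "(\<lambda>x. incr_sq G x (\<delta> * x)) integrable_on {p..q}" if "1 \<le> p" "q \<le> \<beta>" for p q
    by (rule lborel_Icc_bounded(2)[of _ _ _ K]) (use K inW that in auto)
  have hm: "((\<lambda>x. (\<delta> * x) * main_dens x) has_integral
      (1/6 * \<delta> * q\<^sup>2 * (3 * ln q - 4 * ln 2) - 1/6 * \<delta> * p\<^sup>2 * (3 * ln p - 4 * ln 2))) {p..q}" if "1 \<le> p" "p \<le> q" for p q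
    using that by (intro fundamental_theorem_of_calculus main_int_deriv(2)) auto
  have \<phi>_int: "integral {\<alpha>..t} \<phi> = (integral {1..t} (\<lambda>x. incr_sq G x (\<delta> * x)) - 1/6 * \<delta> * t\<^sup>2 * (3 * ln t - 4 * ln 2)) -
      (integral {1..\<alpha>} (\<lambda>x. incr_sq G x (\<delta> * x)) - 1/6 * \<delta> * \<alpha>\<^sup>2 * (3 * ln \<alpha> - 4 * ln 2))" if t: "\<alpha> \<le> t" "t \<le> \<beta>" for t
  proof -
    have "integral {\<alpha>..t} \<phi> = integral {\<alpha>..t} (\<lambda>x. incr_sq G x (\<delta> * x)) - integral {\<alpha>..t} (\<lambda>x. (\<delta> * x) * main_dens x)"
      unfolding \<phi>_def using int1[of \<alpha> t] hm[of \<alpha> t] ab t by (intro Henstock_Kurzweil_Integration.integral_diff) (auto simp: integrable_on_def)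
    moreover have "integral {\<alpha>..t} (\<lambda>x. (\<delta> * x) * main_dens x) = 1/6 * \<delta> * t\<^sup>2 * (3 * ln t - 4 * ln 2) - 1/6 * \<delta> * \<alpha>\<^sup>2 * (3 * ln \<alpha> - 4 * ln 2)"
      using hm[of \<alpha> t] ab t by (intro integral_unique) auto
    moreover have "integral {1..\<alpha>} (\<lambda>x. incr_sq G x (\<delta> * x)) + integral {\<alpha>..t} (\<lambda>x. incr_sq G x (\<delta> * x)) = integral {1..t} (\<lambda>x. incr_sq G x (\<delta> * x))"
      using ab t int1[of 1 t] by (intro Henstock_Kurzweil_Integration.integral_combine) auto
    ultimately show ?thesis by simp
  qed
  have "\<bar>integral {\<alpha>..\<beta>} (\<lambda>x. x * \<phi> x)\<bar> \<le> 3 * \<beta> * (2 * E * \<beta>\<^sup>2)"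
  proof (rule weighted_integral_bound)
    show "\<phi> integrable_on {\<alpha>..\<beta>}"
      unfolding \<phi>_def using int1[of \<alpha> \<beta>] hm[of \<alpha> \<beta>] ab by (intro Henstock_Kurzweil_Integration.integrable_diff) (auto simp: integrable_on_def)
    fix t assume t: "\<alpha> \<le> t" "t \<le> \<beta>"
    have "E * t\<^sup>2 \<le> E * \<beta>\<^sup>2" "E * \<alpha>\<^sup>2 \<le> E * \<beta>\<^sup>2" using t ab E0 by (auto intro!: mult_left_mono power_mono)
    then show "\<bar>integral {\<alpha>..t} \<phi>\<bar> \<le> 2 * E * \<beta>\<^sup>2"
      unfolding \<phi>_int[OF t] using V[OF t] V[of \<alpha>] ab by (intro order_trans[OF abs_triangle_ineq4]) auto
  qed (use ab in auto)
  also have "3 * \<beta> * (2 * E * \<beta>\<^sup>2) = 6 * E * \<beta> ^ 3" by (simp add: power2_eq_square power3_eq_cube)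
  also have "integral {\<alpha>..\<beta>} (\<lambda>x. x * \<phi> x) = (\<integral>x. indicat_real {\<alpha>..\<beta>} x * (x * \<phi> x) \<partial>lborel)"
  proof (rule lborel_Icc_bounded(3))
    fix x assume x: "x \<in> {\<alpha>..\<beta>}"
    have b1: "incr_sq G x (\<delta> * x) \<le> K" using x ab by (intro K inW) auto
    have l2: "0 \<le> ln (2::real)" "ln (2::real) \<le> 1" using ln_le_minus_one[of "2::real"] by auto
    have "0 \<le> ln x" "ln x \<le> ln \<beta>" using x ab by auto
    have b2: "\<bar>main_dens x\<bar> \<le> ln \<beta> + 2"
    proof -
      have "\<bar>(6 * a - 8 * b + 3) / 6\<bar> \<le> m + 2" if "0 \<le> a" "a \<le> m" "0 \<le> b" "b \<le> 1" for a b m :: real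
        using that by (simp add: abs_le_iff)
      from this[OF \<open>0 \<le> ln x\<close> \<open>ln x \<le> ln \<beta>\<close> l2] show ?thesis unfolding main_dens_def .
    qed
    have "\<bar>\<phi> x\<bar> \<le> incr_sq G x (\<delta> * x) + \<bar>(\<delta> * x) * main_dens x\<bar>"
      unfolding \<phi>_def using abs_triangle_ineq4[of "incr_sq G x (\<delta> * x)" "(\<delta> * x) * main_dens x"] by simp
    also have "\<dots> \<le> K + (\<delta> * \<beta>) * (ln \<beta> + 2)"
      unfolding abs_mult using b1 b2 x ab \<delta> by (intro add_mono mult_mono) auto
    finally have "\<bar>\<phi> x\<bar> \<le> K + (\<delta> * \<beta>) * (ln \<beta> + 2)" .
    then show "\<bar>x * \<phi> x\<bar> \<le> \<beta> * (K + (\<delta> * \<beta>) * (ln \<beta> + 2))"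
      unfolding abs_mult using x ab by (intro mult_mono) auto
  qed measurable
  finally show ?thesis by (simp only: \<phi>_def)
qed

text \<open>Values \<open>c > 1\<close> are cut down to 1: the second error term of the theorem absorbs \<open>(h/X)\<^sup>1\<^sup>/\<^sup>3\<close>.\<close>
lemma dilated_mean_square_bound:
  fixes G :: "real \<Rightarrow> complex"
  assumes meas[measurable]: "G \<in> borel_measurable borel" and bdd: "\<And>B. \<exists>K. \<forall>x\<in>{0..B}. norm (G x) \<le> K"
    and Y: "1 \<le> Y" "h \<le> Y" "Y \<le> X" and h: "0 < h" and pq: "h \<le> p" "p \<le> q" "q \<le> 3 * h"
    and c: "0 < c" and C1: "C1 \<ge> 0"
    and V: "\<And>t d. Y \<le> t \<Longrightarrow> t \<le> X \<Longrightarrow> h \<le> d * t \<Longrightarrow> d * t \<le> 3 * h \<Longrightarrow>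
      \<bar>integral {1..t} (\<lambda>x. incr_sq G x (d * x)) - 1/6 * d * t\<^sup>2 * (3 * ln t - 4 * ln 2)\<bar> \<le> C1 * d powr (1 + c) * t\<^sup>2"
  shows "\<bar>\<integral>v. \<integral>x. indicat_real {Y..X} x * indicat_real {p..q} v * (incr_sq G x v - v * main_dens x) \<partial>lborel \<partial>lborel\<bar>
     \<le> 162 * C1 * 3 powr c * h\<^sup>2 * X * (h / X) powr (min c 1) * ln (3 * X)"
proof -
  define c' where "c' = min c 1"
  have c': "0 < c'" "c' \<le> 1" "c' \<le> c" using c by (auto simp: c'_def)
  define f where "f = (\<lambda>x v. incr_sq G x v - v * main_dens x)"
  have [measurable]: "main_dens \<in> borel_measurable borel" unfolding main_dens_def[abs_def] by measurable
  have fm: "case_prod f \<in> borel_measurable (borel \<Otimes>\<^sub>M borel)" unfolding f_def by measurable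
  obtain K where K: "\<And>x v. x \<in> {0..3 * X} \<Longrightarrow> v \<in> {0..3 * X} \<Longrightarrow> incr_sq G x v \<le> K"
    using incr_sq_locally_bounded[OF bdd, of "3 * X"] by blast
  have X: "X \<ge> 1" "h \<le> X" using Y by auto
  have p0: "0 < p" using h pq by simp
  have fb: "\<bar>f x v\<bar> \<le> K + (3 * X) * (ln X + 2)" if "x \<in> {Y..X}" "v \<in> {p..q}" for x v
  proof -
    have b1: "incr_sq G x v \<le> K" using that Y X pq h by (intro K) auto
    have l2: "0 \<le> ln (2::real)" "ln (2::real) \<le> 1" using ln_le_minus_one[of "2::real"] by auto
    have "0 \<le> ln x" "ln x \<le> ln X" using that Y by auto
    have b2: "\<bar>main_dens x\<bar> \<le> ln X + 2"
    proof -
      have "\<bar>(6 * a - 8 * b + 3) / 6\<bar> \<le> m + 2" if "0 \<le> a" "a \<le> m" "0 \<le> b" "b \<le> 1" for a b m :: real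
        using that by (simp add: abs_le_iff)
      from this[OF \<open>0 \<le> ln x\<close> \<open>ln x \<le> ln X\<close> l2] show ?thesis unfolding main_dens_def .
    qed
    have "\<bar>f x v\<bar> \<le> incr_sq G x v + \<bar>v\<bar> * \<bar>main_dens x\<bar>"
      unfolding f_def using abs_triangle_ineq4[of "incr_sq G x v" "v * main_dens x"] by (simp add: abs_mult)
    also have "\<dots> \<le> K + (3 * X) * (ln X + 2)" using b1 b2 that X pq p0 h by (intro add_mono mult_mono) auto
    finally show ?thesis .
  qed
  define N where "N = (\<lambda>d. \<integral>x. indicat_real {Y..X} x * indicat_real {p..q} (d * x) * (x * f x (d * x)) \<partial>lborel)"
  have eq: "(\<integral>v. \<integral>x. indicat_real {Y..X} x * indicat_real {p..q} v * f x v \<partial>lborel \<partial>lborel) = (\<integral>d. N d \<partial>lborel)"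
    and Ni: "integrable lborel N"
    unfolding N_def using lborel_integral_dilation[OF fm _ Y(3) p0 pq(2) fb] Y by auto
  \<comment> \<open>The constant is \<open>6 * 27\<close>, from the inner bound with
    \<open>\<beta>\<close> at most \<open>3 * h / d\<close>. Of \<open>d powr (c - 2)\<close> one
    factor \<open>1 / d\<close> is kept for the integration over \<open>d\<close>; the rest is at
    most of order \<open>(h / X) powr (c' - 1)\<close> because \<open>d >= h / X\<close> and
    \<open>c' <= 1\<close>.\<close>
  define R where "R = 162 * C1 * 3 powr c * h ^ 3 * (h / X) powr (c' - 1)"
  have R0: "R \<ge> 0" using C1 h by (simp add: R_def)
  have Nb: "\<bar>N d\<bar> \<le> R * (indicat_real {h / X..3 * h / Y} d * (1 / d))" for d
  proof -
    \<comment> \<open>For fixed \<open>d\<close> the admissible \<open>x\<close> form the interval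
      from \<open>\<alpha>\<close> to \<open>\<beta>\<close>, possibly empty.\<close>
    define \<alpha> where "\<alpha> = max Y (p / d)"
    define \<beta> where "\<beta> = min X (q / d)"
    show ?thesis
    proof (cases "d > 0 \<and> \<alpha> \<le> \<beta>")
      case False
      have "indicat_real {Y..X} x * indicat_real {p..q} (d * x) = 0" for x
      proof (rule ccontr)
        assume "indicat_real {Y..X} x * indicat_real {p..q} (d * x) \<noteq> 0"
        then have x: "Y \<le> x" "x \<le> X" "p \<le> d * x" "d * x \<le> q" by (auto simp: indicator_def split: if_splits)
        have d: "d > 0" using x p0 Y by (metis less_le_trans zero_less_mult_pos2 zero_less_one)
        then have "\<alpha> \<le> x" "x \<le> \<beta>" using x by (auto simp: \<alpha>_def \<beta>_def field_simps)
        then show False using False d by simp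
      qed
      then have "N d = 0" unfolding N_def by (simp only: mult_zero_left) simp
      moreover have "0 \<le> indicat_real {h / X..3 * h / Y} d * (1 / d)" using h X Y
        by (auto simp: indicator_def intro: order_trans[of 0 "h / X"])
      ultimately show ?thesis using R0 by (simp del: times_divide_eq_right)
    next
      case True
      then have d: "d > 0" and ab: "\<alpha> \<le> \<beta>" by auto
      have \<alpha>: "Y \<le> \<alpha>" "p \<le> d * \<alpha>" using d by (auto simp: \<alpha>_def field_simps max_def)
      have \<beta>: "\<beta> \<le> X" "d * \<beta> \<le> q" using d by (auto simp: \<beta>_def field_simps min_def)
      have in_iff: "indicat_real {Y..X} x * indicat_real {p..q} (d * x) = indicat_real {\<alpha>..\<beta>} x" for x
        using d by (auto simp: indicator_def \<alpha>_def \<beta>_def field_simps)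
      have dt: "h \<le> d * t" "d * t \<le> 3 * h" if "\<alpha> \<le> t" "t \<le> \<beta>" for t
      proof -
        have "d * \<alpha> \<le> d * t" "d * t \<le> d * \<beta>" using d that by auto
        then show "h \<le> d * t" "d * t \<le> 3 * h" using \<alpha> \<beta> pq by auto
      qed
      have "\<bar>N d\<bar> \<le> 6 * (C1 * d powr (1 + c)) * \<beta> ^ 3"
        unfolding N_def in_iff f_def
      proof (rule mean_square_inner_bound[OF meas bdd])
        fix t assume t: "\<alpha> \<le> t" "t \<le> \<beta>"
        show "\<bar>integral {1..t} (\<lambda>x. incr_sq G x (d * x)) - 1 / 6 * d * t\<^sup>2 * (3 * ln t - 4 * ln 2)\<bar> \<le> C1 * d powr (1 + c) * t\<^sup>2"
          by (rule V) (use t \<alpha> \<beta> dt[OF t] in auto)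
      qed (use Y \<alpha> ab d C1 in auto)
      also have "\<dots> \<le> 6 * (C1 * d powr (1 + c)) * (3 * h / d) ^ 3"
        using C1 d \<beta>(2) pq ab \<alpha> Y by (intro mult_left_mono power_mono) (auto simp: field_simps)
      also have "\<dots> = 162 * C1 * h ^ 3 * (d powr (1 + c) / d ^ 3)" by (simp add: power_divide power_mult_distrib)
      also have "\<dots> \<le> 162 * C1 * h ^ 3 * (3 powr c * (h / X) powr (c' - 1) * (1 / d))"
      proof (intro mult_left_mono)
        have dX: "h / X \<le> d"
        proof -
          have "h \<le> d * \<beta>" using dt[of \<beta>] ab by simp
          also have "\<dots> \<le> d * X" using \<beta> d by simp
          finally show ?thesis using X by (simp add: divide_le_eq)
        qed
        have d3: "d \<le> 3"
        proof -
          have "d * Y \<le> d * \<alpha>" using \<alpha> d by simp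
          also have "\<dots> \<le> 3 * h" using dt[of \<alpha>] ab by simp
          also have "\<dots> \<le> 3 * Y" using Y by simp
          finally show ?thesis using Y by simp
        qed
        have "d powr (1 + c) / d ^ 3 = d powr (c - c') * d powr (c' - 1) * (1 / d)"
        proof -
          have "d ^ 3 = d powr 3" using d by (simp add: powr_realpow)
          then have "d powr (1 + c) / d ^ 3 = d powr (1 + c - 3)" by (simp only: powr_diff)
          also have "1 + c - 3 = (c - c') + (c' - 1) + (-1)" by simp
          also have "d powr ((c - c') + (c' - 1) + (-1)) = d powr (c - c') * d powr (c' - 1) * d powr (-1)" by (simp only: powr_add)
          also have "d powr (-1) = 1 / d" using d by (simp add: powr_minus_divide)
          finally show ?thesis .
        qed
        also have "\<dots> \<le> 3 powr c * (h / X) powr (c' - 1) * (1 / d)"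
        proof (intro mult_right_mono mult_mono)
          have "d powr (c - c') \<le> 3 powr (c - c')" using d d3 c' by (intro powr_mono2) auto
          also have "\<dots> \<le> 3 powr c" using c' by (intro powr_mono) auto
          finally show "d powr (c - c') \<le> 3 powr c" .
          show "d powr (c' - 1) \<le> (h / X) powr (c' - 1)" using dX h X c' by (intro powr_mono2') auto
        qed (use d in auto)
        finally show "d powr (1 + c) / d ^ 3 \<le> 3 powr c * (h / X) powr (c' - 1) * (1 / d)" .
      qed (use C1 h in auto)
      also have "\<dots> = R * (1 / d)" by (simp add: R_def)
      also have "1 / d = indicat_real {h / X..3 * h / Y} d * (1 / d)"
      proof -
        have "h \<le> d * \<beta>" "d * \<beta> \<le> d * X" "d * Y \<le> d * \<alpha>" "d * \<alpha> \<le> 3 * h" using dt[of \<beta>] dt[of \<alpha>] ab \<alpha> \<beta> d by auto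
        then have "h \<le> d * X" "d * Y \<le> 3 * h" by linarith+
        then have "d \<in> {h / X..3 * h / Y}" using X Y by (simp add: divide_le_eq le_divide_eq)
        then show ?thesis by simp
      qed
      finally show ?thesis .
    qed
  qed
  have hX: "0 < h / X" "h / X \<le> 3 * h / Y" using h X Y by (auto simp: divide_simps mult_mono)
  have "\<bar>\<integral>d. N d \<partial>lborel\<bar> \<le> (\<integral>d. \<bar>N d\<bar> \<partial>lborel)" by (rule integral_abs_bound)
  also have "\<dots> \<le> (\<integral>d. R * (indicat_real {h / X..3 * h / Y} d * (1 / d)) \<partial>lborel)"
    using integral_inverse_Icc(1)[OF hX] by (intro integral_mono integrable_abs Ni integrable_mult_right Nb)
  also have "\<dots> = R * ln ((3 * h / Y) / (h / X))"
    by (simp only: integral_mult_right_zero integral_inverse_Icc(2)[OF hX])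
  \<comment> \<open>The range of \<open>d\<close> has logarithmic length
    \<open>ln (3 * X / Y)\<close>, and \<open>Y >= 1\<close>.\<close>
  also have "\<dots> \<le> R * ln (3 * X)"
  proof (intro mult_left_mono R0)
    have "(3 * h / Y) / (h / X) \<le> 3 * X" using h X Y by (simp add: divide_le_eq)
    moreover have "0 < (3 * h / Y) / (h / X)" using h X Y by simp
    ultimately show "ln ((3 * h / Y) / (h / X)) \<le> ln (3 * X)" by simp
  qed
  also have "R = 162 * C1 * 3 powr c * h\<^sup>2 * X * (h / X) powr c'"
  proof -
    have "(h / X) powr (c' - 1) = (h / X) powr c' / (h / X)" using h X by (simp add: powr_diff)
    then show ?thesis using h X by (simp add: R_def power2_eq_square power3_eq_cube)
  qed
  finally show ?thesis using eq by (simp only: f_def c'_def)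
qed

text \<open>On \<open>{Y..X}\<close> the average of \<open>A v - v * md\<close> over the window is
  known up to a relative error of order \<open>q ^ 3 / \<eta>\<close>, the denominator coming from
  the window's length \<open>\<eta> * h\<close>. Replacing \<open>v\<close> by \<open>h\<close>
  costs \<open>q\<close> in \<open>A\<close> and \<open>\<eta>\<close> in the main term. With
  \<open>\<eta> = q\<^sup>2\<close> nothing exceeds the order of \<open>q\<close>. On
  \<open>{1..Y}\<close> mean square and main term are bounded separately, which gives
  \<open>Y / X\<close>.\<close>

lemma mean_square_transfer_step:
  fixes G :: "real \<Rightarrow> complex"
  assumes meas[measurable]: "G \<in> borel_measurable borel" and bdd: "\<And>B. \<exists>K. \<forall>x\<in>{0..B}. norm (G x) \<le> K"
    and Y: "1 \<le> Y" "h \<le> Y" "Y \<le> X" and h: "1 \<le> h" and c: "0 < c" and C1: "C1 \<ge> 0" and Cs: "Cs > 0" and \<epsilon>: "\<epsilon> > 0"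
    and V: "\<And>t d. Y \<le> t \<Longrightarrow> t \<le> X \<Longrightarrow> h \<le> d * t \<Longrightarrow> d * t \<le> 3 * h \<Longrightarrow>
      \<bar>integral {1..t} (\<lambda>x. incr_sq G x (d * x)) - 1/6 * d * t\<^sup>2 * (3 * ln t - 4 * ln 2)\<bar> \<le> C1 * d powr (1 + c) * t\<^sup>2"
    and short: "\<And>Z w. 1 \<le> Z \<Longrightarrow> Z powr (-3) \<le> w \<Longrightarrow> w \<le> Z \<Longrightarrow> integral {1..Z} (\<lambda>x. incr_sq G x w) \<le> Cs * w * Z powr (1 + \<epsilon>)"
  shows "\<bar>integral {1..X} (\<lambda>x. incr_sq G x h) - h * main_int X\<bar> \<le>
     h * X powr (1 + \<epsilon>) * ((162 * C1 * 3 powr c * (1 / \<epsilon> + 2) + Cs * (4 * 2 powr (1 + \<epsilon>) + 1) + 4 * (1 / \<epsilon> + 2)) * (h / X) powr (min c 1 / 3)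
       + (Cs + 1 / \<epsilon> + 2) * (Y / X))"
proof -
  define c' where "c' = min c 1"
  have c': "0 < c'" "c' \<le> 1" using c by (auto simp: c'_def)
  define q where "q = (h / X) powr (c' / 3)"
  define \<eta> where "\<eta> = q\<^sup>2"
  define Kl where "Kl = 1 / \<epsilon> + 2"
  define L where "L = X powr (1 + \<epsilon>)"
  have X: "X \<ge> 1" "h \<le> X" "h > 0" "h / X \<le> 1" "h / X > 0" using Y h by auto
  have q: "0 < q" "q \<le> 1" unfolding q_def using X c' by (auto intro!: powr_le1)
  have q3: "q ^ 3 = (h / X) powr c'" using X by (simp add: q_def powr_power)
  have q_low: "h / X \<le> q"
  proof -
    have "(h / X) powr 1 \<le> (h / X) powr (c' / 3)" using X c' by (intro powr_mono') auto
    then show ?thesis using X by (simp add: q_def)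
  qed
  have \<eta>: "0 < \<eta>" "\<eta> \<le> q" "\<eta> \<le> 1" using q by (auto simp: \<eta>_def power2_eq_square mult_le_one intro: mult_left_le_one_le)
  have \<eta>h: "0 < \<eta> * h" using \<eta> X by simp
  define J where "J = (\<lambda>a b v. \<integral>x. indicat_real {a..b} x * incr_sq G x v \<partial>lborel)"
  have incr_b: "\<exists>K. \<forall>x\<in>{a..b}. \<bar>incr_sq G (x + u) v\<bar> \<le> K" if "0 \<le> a" "0 \<le> v" "0 \<le> u" for a b u v
  proof -
    define W where "W = \<bar>b\<bar> + u + v"
    obtain K where K: "\<And>x v. x \<in> {0..W} \<Longrightarrow> v \<in> {0..W} \<Longrightarrow> incr_sq G x v \<le> K"
      using incr_sq_locally_bounded[OF bdd, of W] by blast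
    have "\<bar>incr_sq G (x + u) v\<bar> \<le> K" if x: "x \<in> {a..b}" for x
      using K[of "x + u" v] x \<open>0 \<le> a\<close> \<open>0 \<le> v\<close> \<open>0 \<le> u\<close> by (auto simp: W_def)
    then show ?thesis by blast
  qed
  have Ji': "integrable lborel (\<lambda>x. indicat_real {a..b} x * incr_sq G (x + u) v)" if "0 \<le> a" "0 \<le> v" "0 \<le> u" for a b u v
  proof -
    note b = incr_b[OF that, of b]
    obtain K where "\<And>x. x \<in> {a..b} \<Longrightarrow> \<bar>incr_sq G (x + u) v\<bar> \<le> K" using b by blast
    then show ?thesis by (intro lborel_Icc_bounded(1)[of _ _ _ K]) auto
  qed
  have Ji: "integrable lborel (\<lambda>x. indicat_real {a..b} x * incr_sq G x v)" if "0 \<le> a" "0 \<le> v" for a b v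
    using Ji'[OF that, of 0] by simp
  have J_int: "integral {a..b} (\<lambda>x. incr_sq G x v) = J a b v" if "0 \<le> a" "0 \<le> v" for a b v
  proof -
    note b = incr_b[OF that, of 0 b]
    obtain K where "\<And>x. x \<in> {a..b} \<Longrightarrow> \<bar>incr_sq G x v\<bar> \<le> K" using b unfolding add_0_right by blast
    then show ?thesis unfolding J_def by (intro lborel_Icc_bounded(3)[of _ _ _ K]) auto
  qed
  have Jshort: "J 1 Z w \<le> Cs * w * Z powr (1 + \<epsilon>)" if "1 \<le> Z" "Z powr (-3) \<le> w" "w \<le> Z" for Z w
  proof -
    have "0 \<le> w" using that(2) powr_ge_zero order_trans by blast
    then show ?thesis using short[OF that] J_int[of 1 w Z] by simp
  qed
  have Jmono: "J a b v \<le> J a' b' v" if "a' \<le> a" "b \<le> b'" "0 \<le> a'" "0 \<le> v" for a b a' b' v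
    unfolding J_def using that by (intro integral_mono Ji) (auto simp: indicator_def)
  define A where "A = J Y X"
  have small_w: "Z powr (-3) \<le> w" if "Z \<ge> 1" "w \<ge> 1" for Z w :: real
  proof -
    have "Z powr (-3) \<le> Z powr 0" using that by (intro powr_mono) auto
    then show ?thesis using that by simp
  qed
  have J1Y: "J 1 Y h \<le> Cs * h * Y powr (1 + \<epsilon>)" using Y h by (intro Jshort small_w) auto
  have A_h: "0 \<le> A h" "A h \<le> Cs * h * L"
  proof -
    show "0 \<le> A h" unfolding A_def J_def by (intro integral_nonneg_AE AE_I2) auto
    have "A h \<le> J 1 X h" unfolding A_def using Y X by (intro Jmono) auto
    also have "\<dots> \<le> Cs * h * L" unfolding L_def using X h by (intro Jshort small_w) auto
    finally show "A h \<le> Cs * h * L" .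
  qed
  \<comment> \<open>Starting the window at \<open>(1 + \<eta>) * h\<close> keeps
    \<open>w = v - h\<close> at least \<open>\<eta> * h\<close>, so that \<open>short\<close>
    applies to it.\<close>
  define p where "p = (1 + \<eta>) * h"
  define r where "r = (1 + 2 * \<eta>) * h"
  have pr: "h \<le> p" "p \<le> r" "r \<le> 3 * h" "r - p = \<eta> * h"
    using \<eta> X by (auto simp: p_def r_def algebra_simps)
  define Ea where "Ea = Cs * (4 * 2 powr (1 + \<epsilon>) + 1) * q * h * L"
  have Av: "\<bar>A v - A h\<bar> \<le> Ea" if v: "v \<in> {p..r}" for v
  proof -
    define w where "w = v - h"
    have w: "\<eta> * h \<le> w" "w \<le> 2 * \<eta> * h" "0 \<le> w" using v \<eta>h by (auto simp: w_def p_def r_def algebra_simps)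
    have v0: "0 \<le> v" using v pr X by auto
    have ptw: "\<bar>indicat_real {Y..X} x * incr_sq G x v - indicat_real {Y..X} x * incr_sq G x h\<bar> \<le>
      (1 + 1 / q) * (indicat_real {Y..X} x * incr_sq G (x + h) w) + q * (indicat_real {Y..X} x * incr_sq G x h)" for x
    proof (cases "x \<in> {Y..X}")
      case True
      have "G (x + v) - G x - (G (x + h) - G x) = G (x + h + w) - G (x + h)" by (simp add: w_def)
      then show ?thesis using True norm_sq_diff_le[OF q(1), of "G (x + v) - G x" "G (x + h) - G x"] by (simp add: incr_sq_def)
    qed simp
    have i: "integrable lborel (\<lambda>x. indicat_real {Y..X} x * incr_sq G (x + h) w)" using Y w X by (intro Ji') auto
    have "A v - A h = (\<integral>x. indicat_real {Y..X} x * incr_sq G x v - indicat_real {Y..X} x * incr_sq G x h \<partial>lborel)"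
      unfolding A_def J_def using Y v0 X by (intro Bochner_Integration.integral_diff[symmetric] Ji) auto
    then have "\<bar>A v - A h\<bar> \<le> (\<integral>x. \<bar>indicat_real {Y..X} x * incr_sq G x v - indicat_real {Y..X} x * incr_sq G x h\<bar> \<partial>lborel)"
      by (simp only: integral_abs_bound)
    also have "\<dots> \<le> (\<integral>x. (1 + 1 / q) * (indicat_real {Y..X} x * incr_sq G (x + h) w) + q * (indicat_real {Y..X} x * incr_sq G x h) \<partial>lborel)"
      using Y v0 X i by (intro integral_mono ptw integrable_abs Bochner_Integration.integrable_diff Bochner_Integration.integrable_add integrable_mult_right Ji) auto
    also have "\<dots> = (1 + 1 / q) * (\<integral>x. indicat_real {Y..X} x * incr_sq G (x + h) w \<partial>lborel) + q * A h"
    proof -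
      have "integrable lborel (\<lambda>x. indicat_real {Y..X} x * incr_sq G x h)" using Y X by (intro Ji) auto
      with i show ?thesis unfolding A_def J_def
        by (subst Bochner_Integration.integral_add) (auto simp del: distrib_right_numeral)
    qed
    also have "(\<integral>x. indicat_real {Y..X} x * incr_sq G (x + h) w \<partial>lborel) \<le> Cs * w * (2 * X) powr (1 + \<epsilon>)"
    proof -
      have "(\<integral>x. indicat_real {Y..X} x * incr_sq G (x + h) w \<partial>lborel) = (\<integral>x. indicat_real {Y + h..X + h} (h + 1 * x) * incr_sq G (h + 1 * x) w \<partial>lborel)"
        by (intro Bochner_Integration.integral_cong) (auto simp: indicator_def add.commute)
      also have "\<dots> = J (Y + h) (X + h) w"
        unfolding J_def using lborel_integral_real_affine[of 1 "\<lambda>x. indicat_real {Y + h..X + h} x * incr_sq G x w" h] by simp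
      also have "\<dots> \<le> J 1 (2 * X) w" using Y X w by (intro Jmono) auto
      also have "\<dots> \<le> Cs * w * (2 * X) powr (1 + \<epsilon>)"
      proof (rule Jshort)
        show "1 \<le> 2 * X" using X by simp
        have "\<eta> * h \<le> 1 * X" using \<eta> X by (intro mult_mono) auto
        then show "w \<le> 2 * X" using w by simp
        \<comment> \<open>As \<open>h >= 1\<close> and \<open>q >= h / X\<close>, the length
          \<open>\<eta> * h\<close> is at least \<open>X powr (- 2)\<close>, above the threshold
          \<open>(2 * X) powr (- 3)\<close> of \<open>short\<close>.\<close>
        have "(1 / X)\<^sup>2 \<le> q\<^sup>2"
        proof (rule power_mono)
          have "1 / X \<le> h / X" using h X by (intro divide_right_mono) auto
          then show "1 / X \<le> q" using q_low by linarith
        qed (use X in auto)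
        then have "(1 / X)\<^sup>2 * 1 \<le> \<eta> * h" unfolding \<eta>_def using h by (intro mult_mono) auto
        moreover have "(2 * X) powr (-3) \<le> (1 / X)\<^sup>2"
        proof -
          have "(2 * X) powr (-3) \<le> X powr (-2)"
          proof -
            have "(2 * X) powr (-3) \<le> X powr (-3)" using X by (intro powr_mono2') auto
            also have "\<dots> \<le> X powr (-2)" using X by (intro powr_mono) auto
            finally show ?thesis .
          qed
          also have "X powr (-2) = (1 / X)\<^sup>2" using X by (simp add: powr_minus powr_realpow power_divide field_simps)
          finally show ?thesis .
        qed
        ultimately show "(2 * X) powr (-3) \<le> w" using w by linarith
      qed
      finally show ?thesis .
    qed
    finally have "\<bar>A v - A h\<bar> \<le> (1 + 1 / q) * (Cs * w * (2 * X) powr (1 + \<epsilon>)) + q * A h" using q by (simp add: mult_left_mono)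
    also have "(2 * X) powr (1 + \<epsilon>) = 2 powr (1 + \<epsilon>) * L" using X by (simp add: L_def powr_mult)
    \<comment> \<open>The coefficient \<open>1 / q\<close> meets a length \<open>w\<close> of order
      \<open>q\<^sup>2 * h\<close>, and a single \<open>q = sqrt \<eta>\<close> survives.\<close>
    also have "(1 + 1 / q) * (Cs * w * (2 powr (1 + \<epsilon>) * L)) \<le> (4 * q * h) * (Cs * (2 powr (1 + \<epsilon>) * L))"
    proof -
      have "(1 + 1 / q) * w \<le> (1 + 1 / q) * (2 * \<eta> * h)" using w q by (intro mult_left_mono) auto
      also have "\<dots> = 2 * (q\<^sup>2 + q) * h" using q by (simp add: \<eta>_def power2_eq_square field_simps)
      also have "\<dots> \<le> 2 * (q + q) * h" using \<eta> X by (intro mult_right_mono) (auto simp: \<eta>_def)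
      finally have "(1 + 1 / q) * w \<le> 4 * q * h" by simp
      then have "((1 + 1 / q) * w) * (Cs * (2 powr (1 + \<epsilon>) * L)) \<le> (4 * q * h) * (Cs * (2 powr (1 + \<epsilon>) * L))"
        using Cs by (intro mult_right_mono) (auto simp: L_def)
      then show ?thesis by (simp only: mult_ac)
    qed
    also have "q * A h \<le> q * (Cs * h * L)" using A_h q by (intro mult_left_mono) auto
    finally show ?thesis by (simp add: Ea_def algebra_simps)
  qed
  define md where "md = main_int X - main_int Y"
  have mb: "\<bar>main_int X\<bar> \<le> Kl * L" "\<bar>main_int Y\<bar> \<le> Kl * Y powr (1 + \<epsilon>)"
    unfolding Kl_def L_def using main_int_bound(1)[OF \<epsilon>] X Y by auto
  have YL: "Y powr (1 + \<epsilon>) \<le> L" unfolding L_def using Y \<epsilon> by (intro powr_mono2) auto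
  have Kl0: "Kl > 0" using \<epsilon> by (simp add: Kl_def add_pos_pos)
  have L0: "L > 0" using X by (simp add: L_def)
  have "Kl * Y powr (1 + \<epsilon>) \<le> Kl * L" using YL Kl0 by (intro mult_left_mono) auto
  then have md: "\<bar>md\<bar> \<le> 2 * Kl * L" unfolding md_def using mb by linarith
  have [measurable]: "main_dens \<in> borel_measurable borel" unfolding main_dens_def[abs_def] by measurable
  have md_int: "integrable lborel (\<lambda>x. indicat_real {Y..X} x * main_dens x)" "(\<integral>x. indicat_real {Y..X} x * main_dens x \<partial>lborel) = md"
  proof -
    have cont: "continuous_on {Y..X} main_dens" unfolding main_dens_def[abs_def] using Y by (intro continuous_intros) auto
    show "integrable lborel (\<lambda>x. indicat_real {Y..X} x * main_dens x)"
      using borel_integrable_atLeastAtMost'[OF cont] by (simp add: set_integrable_def)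
    have "(\<integral>x. indicat_real {Y..X} x *\<^sub>R main_dens x \<partial>lborel) = main_int X - main_int Y"
      by (rule integral_FTC_Icc[OF Y(3) main_int_deriv(1) cont]) (use Y in auto)
    then show "(\<integral>x. indicat_real {Y..X} x * main_dens x \<partial>lborel) = md" by (simp add: md_def)
  qed
  define D where "D = (\<integral>v. \<integral>x. indicat_real {Y..X} x * indicat_real {p..r} v * (incr_sq G x v - v * main_dens x) \<partial>lborel \<partial>lborel)"
  have D_eq: "D = (\<integral>v. indicat_real {p..r} v * (A v - v * md) \<partial>lborel)"
    unfolding D_def
  proof (rule Bochner_Integration.integral_cong[OF refl])
    fix v
    show "(\<integral>x. indicat_real {Y..X} x * indicat_real {p..r} v * (incr_sq G x v - v * main_dens x) \<partial>lborel) = indicat_real {p..r} v * (A v - v * md)"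
    proof (cases "v \<in> {p..r}")
      case True
      then have v0: "0 \<le> v" using pr X by auto
      have "(\<integral>x. indicat_real {Y..X} x * indicat_real {p..r} v * (incr_sq G x v - v * main_dens x) \<partial>lborel) =
        (\<integral>x. indicat_real {Y..X} x * incr_sq G x v - v * (indicat_real {Y..X} x * main_dens x) \<partial>lborel)"
        using True by (intro Bochner_Integration.integral_cong) (auto simp: algebra_simps)
      also have "\<dots> = A v - v * md"
        unfolding A_def J_def md_int(2)[symmetric] using Ji[of Y v X] v0 Y md_int(1)
        by (subst Bochner_Integration.integral_diff) auto
      finally show ?thesis using True by simp
    qed simp
  qed
  \<comment> \<open>Since \<open>(h / X) powr c' = q ^ 3 = \<eta> * q\<close>, the factor
    \<open>\<eta> * h\<close> can be pulled out, to be cancelled against the length of the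
    window.\<close>
  have D_b: "\<bar>D\<bar> \<le> (\<eta> * h) * (162 * C1 * 3 powr c * Kl * q * h * L)"
  proof -
    have "\<bar>D\<bar> \<le> 162 * C1 * 3 powr c * h\<^sup>2 * X * (h / X) powr c' * ln (3 * X)"
      unfolding D_def c'_def by (rule dilated_mean_square_bound[OF meas bdd Y _ pr(1-3) c C1 V]) (use X in auto)
    also have "\<dots> \<le> 162 * C1 * 3 powr c * h\<^sup>2 * X * (h / X) powr c' * (Kl * X powr \<epsilon>)"
      unfolding Kl_def using C1 X by (intro mult_left_mono main_int_bound(2)[OF \<epsilon>]) auto
    also have "\<dots> = (\<eta> * h) * (162 * C1 * 3 powr c * Kl * q * h * (X * X powr \<epsilon>))"
      unfolding q3[symmetric] by (simp add: \<eta>_def power2_eq_square power3_eq_cube)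
    also have "X * X powr \<epsilon> = L" using X by (simp add: L_def powr_add)
    finally show ?thesis .
  qed
  have ind_i: "integrable lborel (\<lambda>v. indicat_real {p..r} v * k)" for k :: real
    by (intro integrable_mult_left integrable_real_indicator) (auto simp: emeasure_lborel_Icc_eq)
  have ind_I: "(\<integral>v. indicat_real {p..r} v * k \<partial>lborel) = (\<eta> * h) * k" for k :: real
    using pr by simp
  define k0 where "k0 = A h - h * md"
  have Dk: "\<bar>D - (\<eta> * h) * k0\<bar> \<le> (\<eta> * h) * (Ea + 2 * \<eta> * h * \<bar>md\<bar>)"
  proof -
    have b: "\<bar>(A v - v * md) - k0\<bar> \<le> Ea + 2 * \<eta> * h * \<bar>md\<bar>" if v: "v \<in> {p..r}" for v
    proof -
      have "(A v - v * md) - k0 = (A v - A h) - (v - h) * md" by (simp add: k0_def algebra_simps)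
      also have "\<bar>\<dots>\<bar> \<le> \<bar>A v - A h\<bar> + \<bar>(v - h) * md\<bar>" by (rule abs_triangle_ineq4)
      also have "\<bar>(v - h) * md\<bar> \<le> (2 * \<eta> * h) * \<bar>md\<bar>"
        unfolding abs_mult using v \<eta>h by (intro mult_right_mono) (auto simp: p_def r_def algebra_simps)
      finally show ?thesis using Av[OF v] by simp
    qed
    have [measurable]: "A \<in> borel_measurable borel"
    proof -
      have "(\<lambda>(x, v). indicat_real {Y..X} x * incr_sq G x v) \<in> borel_measurable (lborel \<Otimes>\<^sub>M borel)" by measurable
      then have "(\<lambda>v. \<integral>x. indicat_real {Y..X} x * incr_sq G x v \<partial>lborel) \<in> borel_measurable borel"
        by (intro lborel.borel_measurable_lebesgue_integral) measurable
      then show ?thesis by (simp add: A_def J_def[abs_def])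
    qed
    have i1: "integrable lborel (\<lambda>v. indicat_real {p..r} v * (A v - v * md))"
    proof (rule Bochner_Integration.integrable_bound[OF ind_i[of "\<bar>k0\<bar> + (Ea + 2 * \<eta> * h * \<bar>md\<bar>)"]])
      show "AE v in lborel. norm (indicat_real {p..r} v * (A v - v * md)) \<le> norm (indicat_real {p..r} v * (\<bar>k0\<bar> + (Ea + 2 * \<eta> * h * \<bar>md\<bar>)))"
      proof (rule AE_I2)
        fix v
        show "norm (indicat_real {p..r} v * (A v - v * md)) \<le> norm (indicat_real {p..r} v * (\<bar>k0\<bar> + (Ea + 2 * \<eta> * h * \<bar>md\<bar>)))"
          using b[of v] by (cases "v \<in> {p..r}") auto
      qed
    qed measurable
    define f where "f = (\<lambda>v. indicat_real {p..r} v * (A v - v * md) - indicat_real {p..r} v * k0)"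
    define g where "g = (\<lambda>v. indicat_real {p..r} v * (Ea + 2 * \<eta> * h * \<bar>md\<bar>))"
    have fi: "integrable lborel f" unfolding f_def by (rule Bochner_Integration.integrable_diff[OF i1 ind_i[of k0]])
    have gi: "integrable lborel g" unfolding g_def by (rule ind_i)
    have fg: "\<bar>f v\<bar> \<le> g v" for v
      using b[of v] unfolding f_def g_def by (cases "v \<in> {p..r}") auto
    have "D - (\<eta> * h) * k0 = (\<integral>v. f v \<partial>lborel)"
      unfolding D_eq ind_I[of k0, symmetric] f_def by (rule Bochner_Integration.integral_diff[OF i1 ind_i[of k0], symmetric])
    then have "\<bar>D - (\<eta> * h) * k0\<bar> \<le> (\<integral>v. \<bar>f v\<bar> \<partial>lborel)" by (simp only: integral_abs_bound)
    also have "\<dots> \<le> (\<integral>v. g v \<partial>lborel)" by (rule integral_mono[OF integrable_abs[OF fi] gi fg])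
    also have "\<dots> = (\<eta> * h) * (Ea + 2 * \<eta> * h * \<bar>md\<bar>)" unfolding g_def by (rule ind_I)
    finally show ?thesis .
  qed
  have "\<bar>(\<eta> * h) * k0\<bar> \<le> \<bar>D\<bar> + \<bar>D - (\<eta> * h) * k0\<bar>" by linarith
  also have "\<dots> \<le> (\<eta> * h) * (162 * C1 * 3 powr c * Kl * q * h * L) + (\<eta> * h) * (Ea + 2 * \<eta> * h * \<bar>md\<bar>)" by (rule add_mono[OF D_b Dk])
  also have "\<dots> = (\<eta> * h) * (162 * C1 * 3 powr c * Kl * q * h * L + Ea + 2 * \<eta> * h * \<bar>md\<bar>)" by (simp add: algebra_simps)
  finally have "(\<eta> * h) * \<bar>k0\<bar> \<le> (\<eta> * h) * (162 * C1 * 3 powr c * Kl * q * h * L + Ea + 2 * \<eta> * h * \<bar>md\<bar>)"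
    by (simp only: abs_mult[of "\<eta> * h"] abs_of_pos[OF \<eta>h])
  then have "\<bar>k0\<bar> \<le> 162 * C1 * 3 powr c * Kl * q * h * L + Ea + 2 * \<eta> * h * \<bar>md\<bar>" using \<eta>h by (simp only: mult_le_cancel_left_pos)
  also have "2 * \<eta> * h * \<bar>md\<bar> \<le> 2 * q * h * (2 * Kl * L)" using \<eta> X md q by (intro mult_mono) auto
  finally have k0_b: "\<bar>k0\<bar> \<le> h * L * ((162 * C1 * 3 powr c * Kl + Cs * (4 * 2 powr (1 + \<epsilon>) + 1) + 4 * Kl) * q)"
    by (simp add: Ea_def algebra_simps)
  have "integral {1..X} (\<lambda>x. incr_sq G x h) = J 1 Y h + A h"
  proof -
    have "(\<lambda>x. incr_sq G x h) integrable_on {1..X}"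
    proof -
      obtain K where "\<And>x. x \<in> {1..X} \<Longrightarrow> \<bar>incr_sq G x h\<bar> \<le> K"
        using incr_b[of 1 h 0 X] X unfolding add_0_right by fastforce
      then show ?thesis by (intro lborel_Icc_bounded(2)[of _ _ _ K]) auto
    qed
    then have "integral {1..Y} (\<lambda>x. incr_sq G x h) + integral {Y..X} (\<lambda>x. incr_sq G x h) = integral {1..X} (\<lambda>x. incr_sq G x h)"
      using Y by (intro Henstock_Kurzweil_Integration.integral_combine) auto
    then show ?thesis using J_int[of 1 h Y] J_int[of Y h X] X Y by (simp add: A_def)
  qed
  then have "integral {1..X} (\<lambda>x. incr_sq G x h) - h * main_int X = J 1 Y h + k0 - h * main_int Y"
    by (simp add: k0_def md_def algebra_simps)
  also have "\<bar>\<dots>\<bar> \<le> J 1 Y h + \<bar>k0\<bar> + h * \<bar>main_int Y\<bar>"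
  proof -
    have "0 \<le> J 1 Y h" unfolding J_def by (intro integral_nonneg_AE AE_I2) auto
    moreover have "\<bar>h * main_int Y\<bar> = h * \<bar>main_int Y\<bar>" using X by (simp add: abs_mult)
    ultimately show ?thesis by linarith
  qed
  also have "\<dots> \<le> Cs * h * Y powr (1 + \<epsilon>) + h * L * ((162 * C1 * 3 powr c * Kl + Cs * (4 * 2 powr (1 + \<epsilon>) + 1) + 4 * Kl) * q) + h * (Kl * Y powr (1 + \<epsilon>))"
    using J1Y k0_b mb(2) X by (intro add_mono mult_left_mono) auto
  also have "\<dots> = h * L * ((162 * C1 * 3 powr c * Kl + Cs * (4 * 2 powr (1 + \<epsilon>) + 1) + 4 * Kl) * q) + (Cs + Kl) * h * Y powr (1 + \<epsilon>)"
    by (simp add: algebra_simps)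
  \<comment> \<open>\<open>Y powr (1 + \<epsilon>)\<close> is traded for
    \<open>X powr (1 + \<epsilon>) * (Y / X)\<close>, which is the shape of the second error
    term.\<close>
  also have "\<dots> \<le> h * L * ((162 * C1 * 3 powr c * Kl + Cs * (4 * 2 powr (1 + \<epsilon>) + 1) + 4 * Kl) * q) + (Cs + Kl) * h * (L * (Y / X))"
  proof (intro add_left_mono mult_left_mono)
    have "Y powr (1 + \<epsilon>) = Y * Y powr \<epsilon>" using Y by (simp add: powr_add)
    also have "\<dots> \<le> Y * X powr \<epsilon>" using Y \<epsilon> by (intro mult_left_mono powr_mono2) auto
    also have "\<dots> = L * (Y / X)" using X by (simp add: L_def powr_add)
    finally show "Y powr (1 + \<epsilon>) \<le> L * (Y / X)" .
  qed (use Cs Kl0 X in auto)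
  also have "\<dots> = h * L * ((162 * C1 * 3 powr c * Kl + Cs * (4 * 2 powr (1 + \<epsilon>) + 1) + 4 * Kl) * q + (Cs + Kl) * (Y / X))"
    by (simp add: algebra_simps add_divide_distrib)
  finally show ?thesis by (simp only: Kl_def L_def q_def c'_def add.assoc)
qed

text \<open>The cut \<open>Y\<close> is the least \<open>t\<close> with
  \<open>h <= t powr (1 - B1)\<close>. For \<open>t\<close> between \<open>Y\<close> and
  \<open>X\<close> and \<open>d * t\<close> between \<open>h\<close> and \<open>3 * h\<close>, the
  hypothesis with constants \<open>k1\<close> and 3 applies to \<open>t\<close> and
  \<open>d\<close>: its upper constraint on \<open>d\<close> follows from \<open>t >= Y\<close>, its
  lower one from \<open>h >= k1 * X powr (1 - B3)\<close> and \<open>t <= X\<close>.\<close>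

lemma mean_square_transfer:
  fixes G :: "real \<Rightarrow> complex"
  assumes meas: "G \<in> borel_measurable borel" and bdd: "\<And>B. \<exists>K. \<forall>x\<in>{0..B}. norm (G x) \<le> K"
    and B: "0 < B1" "B1 < B2" "B2 \<le> B3" "B3 < 1" and c: "c > 0"
    and hyp: "\<forall>k1>0. \<forall>k2>0. \<exists>C X0. \<forall>X\<ge>X0. \<forall>\<delta>. k1 * X powr (- B3) \<le> \<delta> \<and> \<delta> \<le> k2 * X powr (- B1) \<longrightarrow>
        \<bar>integral {1..X} (\<lambda>x. incr_sq G x (\<delta> * x)) - 1/6 * \<delta> * X\<^sup>2 * (3 * ln X - 4 * ln 2)\<bar> \<le> C * \<delta> powr (1 + c) * X\<^sup>2"
    and short: "\<And>\<epsilon>. \<epsilon> > 0 \<Longrightarrow> \<exists>C>0. \<forall>X\<ge>1. \<forall>w. X powr (-3) \<le> w \<and> w \<le> X \<longrightarrow>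
        integral {1..X} (\<lambda>x. incr_sq G x w) \<le> C * w * X powr (1 + \<epsilon>)"
    and \<epsilon>: "\<epsilon> > 0" and k: "k1 > 0" "k2 > 0"
  shows "\<exists>C X0. \<forall>X\<ge>X0. \<forall>h. k1 * X powr (1 - B3) \<le> h \<and> h \<le> k2 * X powr (1 - B2) \<longrightarrow>
        \<bar>integral {1..X} (\<lambda>x. incr_sq G x h) - 1/6 * h * X * (6 * ln X - (3 + 8 * ln 2))\<bar>
          \<le> C * (h * X powr (1 + \<epsilon>) * (h / X) powr (c / 3)
               + h * X powr (1 + \<epsilon>) * (h * X powr (- (1 - B1))) powr (1 / (3 * (1 - B1))))"
proof -
  define b where "b = 1 - B1"
  have b: "0 < b" "b < 1" using B by (auto simp: b_def)
  obtain C1' X1 where V: "\<And>X \<delta>. X \<ge> X1 \<Longrightarrow> k1 * X powr (- B3) \<le> \<delta> \<Longrightarrow> \<delta> \<le> 3 * X powr (- B1) \<Longrightarrow>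
        \<bar>integral {1..X} (\<lambda>x. incr_sq G x (\<delta> * x)) - 1/6 * \<delta> * X\<^sup>2 * (3 * ln X - 4 * ln 2)\<bar> \<le> C1' * \<delta> powr (1 + c) * X\<^sup>2"
  proof -
    have "\<exists>C X0. \<forall>X\<ge>X0. \<forall>\<delta>. k1 * X powr (- B3) \<le> \<delta> \<and> \<delta> \<le> 3 * X powr (- B1) \<longrightarrow>
        \<bar>integral {1..X} (\<lambda>x. incr_sq G x (\<delta> * x)) - 1/6 * \<delta> * X\<^sup>2 * (3 * ln X - 4 * ln 2)\<bar> \<le> C * \<delta> powr (1 + c) * X\<^sup>2"
      using hyp k(1) zero_less_numeral by blast
    then show ?thesis using that by blast
  qed
  define C1 where "C1 = \<bar>C1'\<bar>"
  obtain Cs where Cs: "Cs > 0" and sh: "\<And>Z w. 1 \<le> Z \<Longrightarrow> Z powr (-3) \<le> w \<Longrightarrow> w \<le> Z \<Longrightarrow> integral {1..Z} (\<lambda>x. incr_sq G x w) \<le> Cs * w * Z powr (1 + \<epsilon>)"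
    using short[OF \<epsilon>] by blast
  have "filterlim (\<lambda>X. k1 * X powr (1 - B3)) at_top at_top"
  proof -
    have "1 - B3 > 0" using B by simp
    with k(1) show ?thesis by real_asymp
  qed
  moreover have "filterlim (\<lambda>X. X powr (B2 - B1)) at_top at_top"
  proof -
    have "B2 - B1 > 0" using B by simp
    then show ?thesis by real_asymp
  qed
  \<comment> \<open>For large \<open>X\<close> this gives \<open>h >= 1\<close>, makes
    \<open>Y >= h\<close> exceed the threshold \<open>X1\<close> of the hypothesis, and lets
    \<open>X powr (B2 - B1)\<close>, unbounded since \<open>B1 < B2\<close>, absorb
    \<open>k2\<close>.\<close>
  ultimately have "eventually (\<lambda>X. k1 * X powr (1 - B3) \<ge> max 1 X1 \<and> X powr (B2 - B1) \<ge> k2 \<and> X \<ge> 1) at_top"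
    unfolding filterlim_at_top by (intro eventually_conj eventually_ge_at_top) blast+
  then obtain X0 where X0: "\<And>X. X \<ge> X0 \<Longrightarrow> k1 * X powr (1 - B3) \<ge> max 1 X1 \<and> X powr (B2 - B1) \<ge> k2 \<and> X \<ge> 1"
    by (auto simp: eventually_at_top_linorder)
  define K1 where "K1 = 162 * C1 * 3 powr c * (1 / \<epsilon> + 2) + Cs * (4 * 2 powr (1 + \<epsilon>) + 1) + 4 * (1 / \<epsilon> + 2)"
  define K2 where "K2 = Cs + 1 / \<epsilon> + 2"
  have K: "K1 \<ge> 0" "K2 \<ge> 0" using Cs \<epsilon> by (auto simp: K1_def K2_def C1_def)
  show ?thesis
  proof (rule exI[of _ "K1 + K2"], rule exI[of _ X0], intro allI impI)
    fix X h :: real assume X0X: "X0 \<le> X" and hh: "k1 * X powr (1 - B3) \<le> h \<and> h \<le> k2 * X powr (1 - B2)"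
    have X: "X \<ge> 1" and Xk: "k1 * X powr (1 - B3) \<ge> 1" "k1 * X powr (1 - B3) \<ge> X1" "X powr (B2 - B1) \<ge> k2" using X0[OF X0X] by auto
    have h: "h \<ge> 1" "h \<ge> X1" using hh Xk by auto
    have hX: "h \<le> X powr b"
    proof -
      have "h \<le> k2 * X powr (1 - B2)" using hh by simp
      also have "\<dots> \<le> X powr (B2 - B1) * X powr (1 - B2)" using Xk by (intro mult_right_mono) auto
      also have "\<dots> = X powr b" by (simp add: powr_add[symmetric] b_def)
      finally show ?thesis .
    qed
    define Y where "Y = h powr (1 / b)"
    have Yb: "Y powr b = h" using h b by (simp add: Y_def powr_powr)
    have YX: "Y \<le> X"
    proof -
      have "Y \<le> (X powr b) powr (1 / b)" unfolding Y_def using hX h b by (intro powr_mono2) auto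
      also have "\<dots> = X" using X b by (simp add: powr_powr)
      finally show ?thesis .
    qed
    have hY: "h \<le> Y"
    proof -
      have "h powr 1 \<le> h powr (1 / b)" using h b by (intro powr_mono) auto
      then show ?thesis using h by (simp add: Y_def)
    qed
    have Y: "1 \<le> Y" "X1 \<le> Y" using hY h by auto
    have V': "\<bar>integral {1..t} (\<lambda>x. incr_sq G x (d * x)) - 1/6 * d * t\<^sup>2 * (3 * ln t - 4 * ln 2)\<bar> \<le> C1 * d powr (1 + c) * t\<^sup>2"
      if t: "Y \<le> t" "t \<le> X" "h \<le> d * t" "d * t \<le> 3 * h" for t d
    proof -
      have t1: "t \<ge> 1" "t > 0" using t Y by auto
      have "\<bar>integral {1..t} (\<lambda>x. incr_sq G x (d * x)) - 1/6 * d * t\<^sup>2 * (3 * ln t - 4 * ln 2)\<bar> \<le> C1' * d powr (1 + c) * t\<^sup>2"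
      proof (rule V)
        show "X1 \<le> t" using t Y by simp
        have "k1 * t powr (- B3) * t = k1 * t powr (1 - B3)" using t1 by (simp add: powr_diff powr_minus field_simps)
        also have "\<dots> \<le> k1 * X powr (1 - B3)" using t t1 k B by (intro mult_left_mono powr_mono2) auto
        also have "\<dots> \<le> d * t" using hh t by linarith
        finally show "k1 * t powr (- B3) \<le> d" using t1 by simp
        have "d * t \<le> 3 * Y powr b" using t Yb by simp
        also have "\<dots> \<le> 3 * t powr b" using t Y b by (intro mult_left_mono powr_mono2) auto
        also have "\<dots> = 3 * t powr (- B1) * t" using t1 by (simp add: b_def powr_diff powr_minus field_simps)
        finally show "d \<le> 3 * t powr (- B1)" using t1 by simp
      qed
      also have "\<dots> \<le> C1 * d powr (1 + c) * t\<^sup>2" unfolding C1_def by (intro mult_right_mono) auto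
      finally show ?thesis .
    qed
    define P where "P = h * X powr (1 + \<epsilon>)"
    have P: "P \<ge> 0" using h by (simp add: P_def)
    define \<rho> where "\<rho> = (h * X powr (- b)) powr (1 / (3 * b))"
    \<comment> \<open>Since \<open>h = Y powr b\<close>, the factor in the second error term is
      exactly the cube root of \<open>Y / X\<close>.\<close>
    have \<rho>_eq: "\<rho> = (Y / X) powr (1/3)"
    proof -
      have "h * X powr (- b) = (Y / X) powr b" using X Y by (simp add: powr_divide Yb powr_minus field_simps)
      then show ?thesis using b X Y by (simp add: \<rho>_def powr_powr)
    qed
    have YX1: "0 < Y / X" "Y / X \<le> 1" using X Y YX by auto
    have r1: "Y / X \<le> \<rho>"
    proof -
      have "(Y / X) powr 1 \<le> (Y / X) powr (1/3)" using YX1 by (intro powr_mono') auto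
      moreover have "(Y / X) powr 1 = Y / X" using YX1(1) by (subst powr_one_gt_zero_iff) simp
      ultimately show ?thesis by (simp only: \<rho>_eq)
    qed
    \<comment> \<open>For \<open>c > 1\<close> the exponent on the left is \<open>1/3\<close>, and
      \<open>h <= Y\<close> compares that power with \<open>\<rho>\<close>.\<close>
    have r2: "(h / X) powr (min c 1 / 3) \<le> (h / X) powr (c / 3) + \<rho>"
    proof (cases "c \<le> 1")
      case True
      then show ?thesis by (simp add: min_def \<rho>_def)
    next
      case False
      have "(h / X) powr (1/3) \<le> (Y / X) powr (1/3)" using hY h X by (intro powr_mono2 divide_right_mono) auto
      also have "\<dots> \<le> (h / X) powr (c / 3) + \<rho>" by (simp add: \<rho>_eq)
      finally show ?thesis using False by (simp add: min_def)
    qed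
    have "\<bar>integral {1..X} (\<lambda>x. incr_sq G x h) - h * main_int X\<bar> \<le> P * (K1 * (h / X) powr (min c 1 / 3) + K2 * (Y / X))"
      unfolding P_def K1_def K2_def
      by (rule mean_square_transfer_step[OF meas bdd Y(1) hY YX h(1) c _ Cs \<epsilon> V' sh]) (auto simp: C1_def)
    also have "\<dots> \<le> P * (K1 * ((h / X) powr (c / 3) + \<rho>) + K2 * \<rho>)"
      using P K r1 r2 by (intro mult_left_mono add_mono) auto
    also have "\<dots> \<le> P * ((K1 + K2) * ((h / X) powr (c / 3) + \<rho>))"
    proof (intro mult_left_mono P)
      have "0 \<le> K2 * (h / X) powr (c / 3)" using K by simp
      then show "K1 * ((h / X) powr (c / 3) + \<rho>) + K2 * \<rho> \<le> (K1 + K2) * ((h / X) powr (c / 3) + \<rho>)" by (simp add: algebra_simps)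
    qed
    also have "\<dots> = (K1 + K2) * (P * (h / X) powr (c / 3) + P * \<rho>)" by (simp add: algebra_simps)
    also have "h * main_int X = 1/6 * h * X * (6 * ln X - (3 + 8 * ln 2))" by (simp add: main_int_def)
    finally show "\<bar>integral {1..X} (\<lambda>x. incr_sq G x h) - 1/6 * h * X * (6 * ln X - (3 + 8 * ln 2))\<bar>
          \<le> (K1 + K2) * (h * X powr (1 + \<epsilon>) * (h / X) powr (c / 3)
               + h * X powr (1 + \<epsilon>) * (h * X powr (- (1 - B1))) powr (1 / (3 * (1 - B1))))"
      by (simp only: P_def \<rho>_def b_def)
  qed
qed

section \<open>The error term of \<open>psiF\<close> and the residue at 1\<close>

definition psi_err :: "(nat \<Rightarrow> complex) \<Rightarrow> real \<Rightarrow> real \<Rightarrow> complex" where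
  "psi_err \<Lambda> M x = psiF \<Lambda> x - of_real (M * x)"

lemma psi_err_measurable [measurable]: "psi_err \<Lambda> M \<in> borel_measurable borel"
  unfolding psi_err_def[abs_def] by measurable

lemma incr_sq_psi_err: "incr_sq (psi_err \<Lambda> M) x v = (norm (psiF \<Lambda> (x + v) - psiF \<Lambda> x - of_real (M * v)))\<^sup>2"
proof -
  have "psi_err \<Lambda> M (x + v) - psi_err \<Lambda> M x = psiF \<Lambda> (x + v) - psiF \<Lambda> x - of_real (M * v)"
    by (simp add: psi_err_def algebra_simps)
  then show ?thesis by (simp add: incr_sq_def)
qed

lemma psi_err_locally_bounded: "\<exists>K. \<forall>x\<in>{0..B}. norm (psi_err \<Lambda> M x) \<le> K"
proof -
  have "norm (psi_err \<Lambda> M x) \<le> (\<Sum>n\<in>{1..nat \<lfloor>B\<rfloor>}. norm (\<Lambda> n)) + \<bar>M\<bar> * B" if x: "x \<in> {0..B}" for x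
  proof -
    have "norm (psi_err \<Lambda> M x) \<le> norm (psiF \<Lambda> x) + norm (complex_of_real (M * x))"
      unfolding psi_err_def by (rule norm_triangle_ineq4)
    also have "norm (psiF \<Lambda> x) \<le> (\<Sum>n\<in>{1..nat \<lfloor>x\<rfloor>}. norm (\<Lambda> n))" unfolding psiF_def by (rule norm_sum)
    also have "\<dots> \<le> (\<Sum>n\<in>{1..nat \<lfloor>B\<rfloor>}. norm (\<Lambda> n))"
    proof (rule sum_mono2)
      have "nat \<lfloor>x\<rfloor> \<le> nat \<lfloor>B\<rfloor>" using x by (intro nat_mono floor_mono) auto
      then show "{1..nat \<lfloor>x\<rfloor>} \<subseteq> {1..nat \<lfloor>B\<rfloor>}" by auto
    qed auto
    also have "norm (complex_of_real (M * x)) \<le> \<bar>M\<bar> * B" using x by (simp add: norm_mult mult_left_mono)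
    finally show ?thesis by simp
  qed
  then show ?thesis by blast
qed

text \<open>The bound \<open>W\<close> on \<open>v\<close> confines the arguments of
  \<open>G\<close> to a bounded interval on which \<open>G\<close> is bounded; the integral with
  values in \<open>ennreal\<close> then agrees with the gauge integral used in \<open>VF\<close> and
  \<open>VtF\<close>.\<close>

lemma integral_incr_sq_le:
  fixes G :: "real \<Rightarrow> complex"
  assumes G[measurable]: "G \<in> borel_measurable borel" and bdd: "\<And>B. \<exists>K. \<forall>x\<in>{0..B}. norm (G x) \<le> K"
    and v[measurable]: "v \<in> borel_measurable borel" and W: "\<And>x. x \<in> {1..X} \<Longrightarrow> 0 \<le> v x \<and> v x \<le> W"
    and le: "(\<integral>\<^sup>+x. ennreal (indicat_real {1..X} x * incr_sq G x (v x)) \<partial>lborel) \<le> ennreal r" and r: "0 \<le> r"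
  shows "integral {1..X} (\<lambda>x. incr_sq G x (v x)) \<le> r"
proof -
  obtain K where K: "\<And>x v. x \<in> {0..max X W} \<Longrightarrow> v \<in> {0..max X W} \<Longrightarrow> incr_sq G x v \<le> K"
    using incr_sq_locally_bounded[OF bdd, of "max X W"] by blast
  have bd: "\<bar>incr_sq G x (v x)\<bar> \<le> K" if "x \<in> {1..X}" for x
    using K[of x "v x"] W[OF that] that by auto
  have "ennreal (\<integral>x. indicat_real {1..X} x * incr_sq G x (v x) \<partial>lborel) = (\<integral>\<^sup>+x. ennreal (indicat_real {1..X} x * incr_sq G x (v x)) \<partial>lborel)"
    by (intro nn_integral_eq_integral[symmetric] lborel_Icc_bounded(1)[OF _ bd]) auto
  also have "\<dots> \<le> ennreal r" by (rule le)
  finally have "(\<integral>x. indicat_real {1..X} x * incr_sq G x (v x) \<partial>lborel) \<le> r" using r by simp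
  then show ?thesis using lborel_Icc_bounded(3)[OF _ bd] by simp
qed

text \<open>The residue of \<open>- F'/F\<close> at 1 could a priori be smaller than the pole order: if \<open>m = 0\<close>,
  the value \<open>F 1\<close> is unconstrained and the entire function may vanish at 1.
  A nonzero discrepancy would contribute \<open>\<delta>\<^sup>2 X\<^sup>3\<close> to the variance, which the hypothesis excludes.\<close>
lemma residue_eq_pole_order:
  assumes B: "0 < B1" "B1 \<le> B3" "B1 < 1" and c: "c > 0"
    and hyp: "\<And>X \<delta>. X \<ge> X0 \<Longrightarrow> X powr (- B3) \<le> \<delta> \<Longrightarrow> \<delta> \<le> X powr (- B1) \<Longrightarrow>
        \<bar>integral {1..X} (\<lambda>x. incr_sq (psi_err \<Lambda> m) x (\<delta> * x)) - 1/6 * \<delta> * X\<^sup>2 * (3 * ln X - 4 * ln 2)\<bar> \<le> C1 * \<delta> powr (1 + c) * X\<^sup>2"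
    and MS: "\<And>\<epsilon>. 0 < \<epsilon> \<Longrightarrow> \<epsilon> \<le> 1/4 \<Longrightarrow> \<exists>C>0. \<forall>\<delta>>0. \<forall>X\<ge>1.
     (\<integral>\<^sup>+x. ennreal (indicat_real {1..X} x * incr_sq (psi_err \<Lambda> M) x (\<delta> * x)) \<partial>lborel)
     \<le> ennreal (C * X powr (2 + 2 * \<epsilon>) * \<delta> powr (1 - \<epsilon>) * (1 + \<delta>) powr (1 + 2 * \<epsilon>))"
  shows "M = m"
proof (rule ccontr)
  assume "M \<noteq> m"
  define d where "d = (m - M)\<^sup>2"
  have d: "d > 0" using \<open>M \<noteq> m\<close> by (simp add: d_def)
  define \<kappa> where "\<kappa> = 1 - B1"
  have \<kappa>: "\<kappa> > 0" "\<kappa> < 1" using B by (auto simp: \<kappa>_def)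
  \<comment> \<open>With \<open>\<delta> = X powr (- B1)\<close> one has
    \<open>\<delta> * X = X powr \<kappa>\<close>. Up to constants the mean square about
    \<open>M\<close> is at most \<open>\<delta> * X\<^sup>2\<close> times
    \<open>X powr (2 * e + B1 * e)\<close>, and this choice of \<open>e\<close> keeps the latter
    power below \<open>X powr (\<kappa> / 2)\<close>.\<close>
  define e where "e = \<kappa> / 8"
  have e: "0 < e" "e \<le> 1/4" "3 * e \<le> \<kappa> / 2" using \<kappa> by (auto simp: e_def)
  obtain C where C: "C > 0" and ms: "\<And>\<delta> X. \<delta> > 0 \<Longrightarrow> X \<ge> 1 \<Longrightarrow>
     (\<integral>\<^sup>+x. ennreal (indicat_real {1..X} x * incr_sq (psi_err \<Lambda> M) x (\<delta> * x)) \<partial>lborel)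
     \<le> ennreal (C * X powr (2 + 2 * e) * \<delta> powr (1 - e) * (1 + \<delta>) powr (1 + 2 * e))"
    using MS[OF e(1,2)] by blast
  \<comment> \<open>The inequality to be contradicted, divided by
    \<open>\<delta> * X\<^sup>2\<close>: the discrepancy contributes
    \<open>d * X powr \<kappa>\<close>, the two mean squares only a logarithm and
    \<open>X powr (\<kappa> / 2)\<close>. The 6 is \<open>3 * 2\<close>, because
    \<open>X ^ 3 - 1\<close> is at least half of \<open>X ^ 3\<close> for
    \<open>X >= 2\<close>.\<close>
  have "filterlim (\<lambda>X. d * X powr \<kappa> / 6 - 2 * (ln X + \<bar>C1\<bar>) - 8 * C * X powr (\<kappa> / 2)) at_top at_top"
    using d \<kappa>(1) C by real_asymp
  then have "eventually (\<lambda>X. d * X powr \<kappa> / 6 - 2 * (ln X + \<bar>C1\<bar>) - 8 * C * X powr (\<kappa> / 2) > 0) at_top"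
    unfolding filterlim_at_top_dense by (rule spec)
  then have "eventually (\<lambda>X. d * X powr \<kappa> / 6 - 2 * (ln X + \<bar>C1\<bar>) - 8 * C * X powr (\<kappa> / 2) > 0 \<and> X \<ge> X0 \<and> X \<ge> 2) at_top"
    by (intro eventually_conj eventually_ge_at_top)
  then obtain X where big: "d * X powr \<kappa> / 6 - 2 * (ln X + \<bar>C1\<bar>) - 8 * C * X powr (\<kappa> / 2) > 0" and X: "X \<ge> X0" "X \<ge> 2"
    by (auto simp: eventually_at_top_linorder)
  define \<delta> where "\<delta> = X powr (- B1)"
  have \<delta>: "0 < \<delta>" "\<delta> \<le> 1"
  proof -
    have "X powr (- B1) \<le> X powr 0" using X B by (intro powr_mono) auto
    then show "\<delta> \<le> 1" using X by (simp add: \<delta>_def)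
  qed (use X in \<open>simp add: \<delta>_def\<close>)
  define I1 where "I1 = integral {1..X} (\<lambda>x. incr_sq (psi_err \<Lambda> m) x (\<delta> * x))"
  define I2 where "I2 = integral {1..X} (\<lambda>x. incr_sq (psi_err \<Lambda> M) x (\<delta> * x))"
  have "\<bar>I1 - 1/6 * \<delta> * X\<^sup>2 * (3 * ln X - 4 * ln 2)\<bar> \<le> C1 * \<delta> powr (1 + c) * X\<^sup>2"
    unfolding I1_def using X B by (intro hyp) (auto simp: \<delta>_def intro!: powr_mono)
  also have "\<dots> \<le> \<bar>C1\<bar> * \<delta> * X\<^sup>2"
  proof (intro mult_right_mono mult_mono)
    have "\<delta> powr (1 + c) \<le> \<delta> powr 1" using \<delta> c by (intro powr_mono') auto
    then show "\<delta> powr (1 + c) \<le> \<delta>" using \<delta> by simp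
  qed (use \<delta> in auto)
  finally have "I1 \<le> 1/6 * \<delta> * X\<^sup>2 * (3 * ln X - 4 * ln 2) + \<bar>C1\<bar> * \<delta> * X\<^sup>2" by linarith
  also have "1/6 * \<delta> * X\<^sup>2 * (3 * ln X - 4 * ln 2) \<le> \<delta> * X\<^sup>2 * ln X"
  proof -
    have "1/6 * (3 * a - 4 * b) \<le> a" if "0 \<le> a" "0 \<le> b" for a b :: real using that by simp
    from this[of "ln X" "ln 2"] have "1/6 * (3 * ln X - 4 * ln 2) \<le> ln X" using X by simp
    then have "\<delta> * X\<^sup>2 * (1/6 * (3 * ln X - 4 * ln 2)) \<le> \<delta> * X\<^sup>2 * ln X" using \<delta> by (intro mult_left_mono) auto
    then show ?thesis by simp
  qed
  finally have I1: "I1 \<le> \<delta> * X\<^sup>2 * (ln X + \<bar>C1\<bar>)" by (simp add: algebra_simps)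
  have I2: "I2 \<le> 4 * C * (\<delta> * X\<^sup>2) * X powr (\<kappa> / 2)"
  proof -
    have a1: "I2 \<le> C * X powr (2 + 2 * e) * \<delta> powr (1 - e) * (1 + \<delta>) powr (1 + 2 * e)"
      unfolding I2_def
    proof (rule integral_incr_sq_le[OF psi_err_measurable psi_err_locally_bounded _ _ ms])
      show "0 \<le> \<delta> * x \<and> \<delta> * x \<le> \<delta> * X" if "x \<in> {1..X}" for x using that \<delta> by auto
    qed (use \<delta> X C in auto)
    have a2: "(1 + \<delta>) powr (1 + 2 * e) \<le> 4"
    proof -
      have "(1 + \<delta>) powr (1 + 2 * e) \<le> 2 powr (1 + 2 * e)" using \<delta> e by (intro powr_mono2) auto
      also have "\<dots> \<le> 2 powr 2" using e by (intro powr_mono) auto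
      finally show ?thesis by simp
    qed
    have a3: "X powr (2 + 2 * e) * \<delta> powr (1 - e) \<le> (\<delta> * X\<^sup>2) * X powr (\<kappa> / 2)"
    proof -
      have "\<delta> powr (1 - e) = \<delta> * X powr (B1 * e)"
      proof -
        have "\<delta> powr (1 - e) = \<delta> powr 1 * \<delta> powr (- e)" by (simp only: powr_add[symmetric]) simp
        also have "\<delta> powr (- e) = X powr (B1 * e)" unfolding \<delta>_def powr_powr by simp
        finally show ?thesis using \<delta> by simp
      qed
      moreover have "X powr (2 + 2 * e) = X\<^sup>2 * X powr (2 * e)" using X by (simp add: powr_add powr_realpow)
      ultimately have "X powr (2 + 2 * e) * \<delta> powr (1 - e) = (\<delta> * X\<^sup>2) * (X powr (2 * e) * X powr (B1 * e))" by simp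
      also have "X powr (2 * e) * X powr (B1 * e) = X powr (2 * e + B1 * e)" by (rule powr_add[symmetric])
      also have "\<dots> \<le> X powr (\<kappa> / 2)"
      proof (rule powr_mono)
        have "B1 * e \<le> 1 * e" using B e by (intro mult_right_mono) auto
        then show "2 * e + B1 * e \<le> \<kappa> / 2" using e(3) by linarith
      qed (use X in auto)
      finally show ?thesis using \<delta> by (simp add: mult_left_mono)
    qed
    have "(X powr (2 + 2 * e) * \<delta> powr (1 - e)) * (1 + \<delta>) powr (1 + 2 * e) \<le> ((\<delta> * X\<^sup>2) * X powr (\<kappa> / 2)) * 4"
      using \<delta> by (intro mult_mono a2 a3) auto
    then have "C * ((X powr (2 + 2 * e) * \<delta> powr (1 - e)) * (1 + \<delta>) powr (1 + 2 * e)) \<le> C * (((\<delta> * X\<^sup>2) * X powr (\<kappa> / 2)) * 4)"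
      using C by (intro mult_left_mono) auto
    then have "I2 \<le> C * (((\<delta> * X\<^sup>2) * X powr (\<kappa> / 2)) * 4)" using a1 by (simp only: mult.assoc)
    then show ?thesis by (simp only: mult_ac)
  qed
  \<comment> \<open>The increments about \<open>m\<close> and about \<open>M\<close> differ by
    \<open>(m - M) * \<delta> * x\<close>, whose square is \<open>Q x\<close>.\<close>
  define Q where "Q = (\<lambda>x. d * \<delta>\<^sup>2 * x\<^sup>2)"
  have ptw: "Q x \<le> 2 * incr_sq (psi_err \<Lambda> m) x (\<delta> * x) + 2 * incr_sq (psi_err \<Lambda> M) x (\<delta> * x)" for x
  proof -
    define A where "A = psiF \<Lambda> (x + \<delta> * x) - psiF \<Lambda> x - of_real (m * (\<delta> * x))"
    define A' where "A' = psiF \<Lambda> (x + \<delta> * x) - psiF \<Lambda> x - of_real (M * (\<delta> * x))"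
    have "A' - A = of_real ((m - M) * (\<delta> * x))" by (simp add: A_def A'_def algebra_simps)
    then have "norm (A' - A) = \<bar>(m - M) * (\<delta> * x)\<bar>" by (metis norm_of_real)
    then have "Q x = (norm (A' - A))\<^sup>2" by (simp add: Q_def d_def power_mult_distrib mult.assoc)
    also have "\<dots> \<le> (norm A' + norm A)\<^sup>2" by (intro power_mono norm_triangle_ineq4) auto
    also have "\<dots> \<le> 2 * (norm A)\<^sup>2 + 2 * (norm A')\<^sup>2" using sum_squares_bound[of "norm A'" "norm A"] by (simp add: power2_sum)
    finally show ?thesis by (simp add: incr_sq_psi_err A_def A'_def)
  qed
  have int: "(\<lambda>x. incr_sq (psi_err \<Lambda> M') x (\<delta> * x)) integrable_on {1..X}" for M'
  proof -
    obtain K where K: "\<And>x v. x \<in> {0..X} \<Longrightarrow> v \<in> {0..X} \<Longrightarrow> incr_sq (psi_err \<Lambda> M') x v \<le> K"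
      using incr_sq_locally_bounded[OF psi_err_locally_bounded, of X \<Lambda> M'] by blast
    have "\<bar>incr_sq (psi_err \<Lambda> M') x (\<delta> * x)\<bar> \<le> K" if "x \<in> {1..X}" for x
    proof -
      have "\<delta> * x \<le> 1 * x" using that \<delta> by (intro mult_right_mono) auto
      then show ?thesis using that \<delta> K[of x "\<delta> * x"] by auto
    qed
    then show ?thesis by (intro lborel_Icc_bounded(2)[of _ _ _ K]) auto
  qed
  have "(Q has_integral (d * \<delta>\<^sup>2 * X ^ 3 / 3 - d * \<delta>\<^sup>2 * 1 ^ 3 / 3)) {1..X}"
    unfolding Q_def using X
    by (intro fundamental_theorem_of_calculus)
       (auto simp: has_real_derivative_iff_has_vector_derivative[symmetric] intro!: derivative_eq_intros)
  then have IQ: "integral {1..X} Q = d * \<delta>\<^sup>2 * (X ^ 3 - 1) / 3" and Qi: "Q integrable_on {1..X}"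
    by (auto simp: integral_unique integrable_on_def algebra_simps diff_divide_distrib)
  have "integral {1..X} Q \<le> integral {1..X} (\<lambda>x. 2 * incr_sq (psi_err \<Lambda> m) x (\<delta> * x) + 2 * incr_sq (psi_err \<Lambda> M) x (\<delta> * x))"
    using Qi int by (intro integral_le ptw) (auto intro!: integrable_add integrable_on_mult_right)
  also have "\<dots> = 2 * I1 + 2 * I2"
    unfolding I1_def I2_def using int by (subst Henstock_Kurzweil_Integration.integral_add) (auto intro!: integrable_on_mult_right)
  also have "\<dots> \<le> 2 * (\<delta> * X\<^sup>2 * (ln X + \<bar>C1\<bar>)) + 2 * (4 * C * (\<delta> * X\<^sup>2) * X powr (\<kappa> / 2))" using I1 I2 by linarith
  also have "\<dots> = (\<delta> * X\<^sup>2) * (2 * (ln X + \<bar>C1\<bar>) + 8 * C * X powr (\<kappa> / 2))" by (simp add: algebra_simps)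
  also have "\<dots> < (\<delta> * X\<^sup>2) * (d * X powr \<kappa> / 6)" using big \<delta> X by (intro mult_strict_left_mono) auto
  also have "\<dots> = d * \<delta>\<^sup>2 * X ^ 3 / 6"
  proof -
    have "X powr \<kappa> = \<delta> * X" using X by (simp add: \<kappa>_def \<delta>_def powr_diff powr_minus field_simps)
    then show ?thesis by (simp add: power2_eq_square power3_eq_cube)
  qed
  also have "\<dots> \<le> d * \<delta>\<^sup>2 * (X ^ 3 - 1) / 3"
  proof -
    have "2 ^ 3 \<le> X ^ 3" using X by (intro power_mono) auto
    then have "d * \<delta>\<^sup>2 * X ^ 3 \<le> d * \<delta>\<^sup>2 * (2 * (X ^ 3 - 1))" using d by (intro mult_left_mono) auto
    moreover have "w * y / 6 \<le> w * (y - 1) / 3" if "w * y \<le> w * (2 * (y - 1))" for w y :: real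
      using that by (simp add: algebra_simps)
    ultimately show ?thesis by blast
  qed
  finally show False unfolding IQ by simp
qed

theorem theoremC2:
  fixes F :: "complex \<Rightarrow> complex" and \<Lambda> :: "nat \<Rightarrow> complex" and m :: nat
    and Q :: real and r :: nat and lam :: "nat \<Rightarrow> real" and mu :: "nat \<Rightarrow> complex"
    and eps :: complex and B1 B2 B3 c :: real
  assumes prim: "primitive_selberg F"
    and fe: "functional_eq F Q r lam mu eps"
    and pole: "pole_order F m"
    and Lam: "log_deriv_coeffs F \<Lambda>"
    and grh: "GRH F m r lam mu"
    and B: "B1 * (2 * (\<Sum>j<r. lam j)) > 1" "B1 < B2" "B2 \<le> B3" "B3 < 1"
    and c: "c > 0"
    and hyp: "\<forall>k1>0. \<forall>k2>0. \<exists>C X0. \<forall>X\<ge>X0. \<forall>\<delta>.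
        k1 * X powr (- B3) \<le> \<delta> \<and> \<delta> \<le> k2 * X powr (- B1) \<longrightarrow>
        \<bar>VF \<Lambda> m X \<delta> - 1/6 * \<delta> * X\<^sup>2 * (3 * ln X - 4 * ln 2)\<bar> \<le> C * \<delta> powr (1 + c) * X\<^sup>2"
  shows "\<forall>\<epsilon>>0. \<forall>k1>0. \<forall>k2>0. \<exists>C X0. \<forall>X\<ge>X0. \<forall>h.
        k1 * X powr (1 - B3) \<le> h \<and> h \<le> k2 * X powr (1 - B2) \<longrightarrow>
        \<bar>VtF \<Lambda> m X h - 1/6 * h * X * (6 * ln X - (3 + 8 * ln 2))\<bar>
          \<le> C * (h * X powr (1 + \<epsilon>) * (h / X) powr (c / 3)
               + h * X powr (1 + \<epsilon>) * (h * X powr (- (1 - B1))) powr (1 / (3 * (1 - B1))))"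
proof -
  \<comment> \<open>The degree is nonnegative, so its product with \<open>B1\<close> could not
    exceed 1 if \<open>B1\<close> were not positive.\<close>
  have B1: "B1 > 0"
  proof -
    have "lam j > 0" if "j < r" for j using fe that unfolding functional_eq_def by blast
    then have "0 \<le> (\<Sum>j<r. lam j)" by (intro sum_nonneg) (simp add: less_imp_le)
    then show ?thesis using B(1) by (smt (verit) mult_nonpos_nonneg)
  qed
  have VF_eq: "VF \<Lambda> m X \<delta> = integral {1..X} (\<lambda>x. incr_sq (psi_err \<Lambda> (real m)) x (\<delta> * x))" for X \<delta>
    unfolding VF_def incr_sq_psi_err by (simp only: mult.assoc)
  have VtF_eq: "VtF \<Lambda> m X h = integral {1..X} (\<lambda>x. incr_sq (psi_err \<Lambda> (real m)) x h)" for X h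
    unfolding VtF_def incr_sq_psi_err ..
  obtain M where "\<And>\<epsilon>. 0 < \<epsilon> \<Longrightarrow> \<epsilon> \<le> 1/4 \<Longrightarrow> \<exists>C>0. \<forall>\<delta>>0. \<forall>X\<ge>1.
     (\<integral>\<^sup>+x. ennreal (indicat_real {1..X} x * (norm (psiF \<Lambda> (x + \<delta> * x) - psiF \<Lambda> x - of_real (M * \<delta> * x)))\<^sup>2) \<partial>lborel)
     \<le> ennreal (C * X powr (2 + 2 * \<epsilon>) * \<delta> powr (1 - \<epsilon>) * (1 + \<delta>) powr (1 + 2 * \<epsilon>))"
    by (rule GRH_mean_square[OF prim fe pole Lam grh]) blast
  then have MS: "\<exists>C>0. \<forall>\<delta>>0. \<forall>X\<ge>1.
     (\<integral>\<^sup>+x. ennreal (indicat_real {1..X} x * incr_sq (psi_err \<Lambda> M) x (\<delta> * x)) \<partial>lborel)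
     \<le> ennreal (C * X powr (2 + 2 * \<epsilon>) * \<delta> powr (1 - \<epsilon>) * (1 + \<delta>) powr (1 + 2 * \<epsilon>))" if "0 < \<epsilon>" "\<epsilon> \<le> 1/4" for \<epsilon>
    using that unfolding incr_sq_psi_err by (simp only: mult.assoc)
  obtain C1 X1 where "\<And>X \<delta>. X \<ge> X1 \<Longrightarrow> 1 * X powr (- B3) \<le> \<delta> \<Longrightarrow> \<delta> \<le> 1 * X powr (- B1) \<Longrightarrow>
        \<bar>VF \<Lambda> m X \<delta> - 1/6 * \<delta> * X\<^sup>2 * (3 * ln X - 4 * ln 2)\<bar> \<le> C1 * \<delta> powr (1 + c) * X\<^sup>2"
    using hyp by (metis zero_less_one)
  then have "\<bar>integral {1..X} (\<lambda>x. incr_sq (psi_err \<Lambda> (real m)) x (\<delta> * x)) - 1/6 * \<delta> * X\<^sup>2 * (3 * ln X - 4 * ln 2)\<bar> \<le> C1 * \<delta> powr (1 + c) * X\<^sup>2"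
    if "X \<ge> X1" "X powr (- B3) \<le> \<delta>" "\<delta> \<le> X powr (- B1)" for X \<delta>
    using that unfolding VF_eq by simp
  \<comment> \<open>From here on the GRH bounds and the hypothesis concern the same function
    \<open>psi_err \<Lambda> (real m)\<close>.\<close>
  then have M: "M = real m"
    using B1 B c MS by (intro residue_eq_pole_order[of B1 B3 c X1 \<Lambda> "real m" C1 M]) auto
  have short: "\<exists>C>0. \<forall>X\<ge>1. \<forall>w. X powr (-3) \<le> w \<and> w \<le> X \<longrightarrow>
        integral {1..X} (\<lambda>x. incr_sq (psi_err \<Lambda> (real m)) x w) \<le> C * w * X powr (1 + \<epsilon>)" if \<epsilon>: "\<epsilon> > 0" for \<epsilon>
  proof -
    obtain C where C: "C > 0" and s: "\<And>X w. X \<ge> 1 \<Longrightarrow> X powr (-3) \<le> w \<Longrightarrow> w \<le> X \<Longrightarrow>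
       (\<integral>\<^sup>+x. ennreal (indicat_real {1..X} x * incr_sq (psi_err \<Lambda> (real m)) x w) \<partial>lborel) \<le> ennreal (C * w * X powr (1 + \<epsilon>))"
      using short_interval_mean_square[OF psi_err_measurable MS \<epsilon>] unfolding M by blast
    have "integral {1..X} (\<lambda>x. incr_sq (psi_err \<Lambda> (real m)) x w) \<le> C * w * X powr (1 + \<epsilon>)"
      if w: "X \<ge> 1" "X powr (-3) \<le> w" "w \<le> X" for X w
    proof -
      have "0 \<le> w" using w(2) powr_ge_zero order_trans by blast
      then show ?thesis
        using C by (intro integral_incr_sq_le[OF psi_err_measurable psi_err_locally_bounded _ _ s[OF w], of w]) auto
    qed
    then show ?thesis using C by blast
  qed
  show ?thesis
    unfolding VtF_eq
    using mean_square_transfer[OF psi_err_measurable psi_err_locally_bounded B1 B(2-4) c hyp[unfolded VF_eq] short] by blast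
qed

end
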